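(* Let $R>0$, $1<p<q<+\infty$, $N\ge2$, $\alpha<N$, $\beta>1$ and $\gamma=\frac{N-\alpha}{\beta-1}$. Let $$T_{\mathrm{rad}}:=\inf\left\{\int_{B_R}\frac{|\nabla u|^p}{|x|^{\alpha-p}\left(1-\left(\frac{|x|}{R}\right)^\gamma\right)^{\beta-p}}\,dx\ \Big|\ u\in X^{1,p}_{\alpha,\beta,\mathrm{rad}},\ \int_{B_R}\frac{|u|^q}{|x|^{N-\frac qp(N-\alpha)}\left(1-\left(\frac{|x|}{R}\right)^\gamma\right)^{1+\frac{\beta-1}{p}q}}\,dx=1\right\}.$$ Then $$T_{\mathrm{rad}}=\pi^{\frac{N(q-p)}{2q}}\,N\left(\frac{Np}{q(p-1)}\right)^{p-1}\left(\frac{q(N-\alpha)}{Np}\right)^{p-1+\frac pq}\left(\frac{2q(p-1)}{N(q-p)}\right)^{\frac{q-p}{q}}\left\{\frac{\Gamma\left(\frac{q}{q-p}\right)\Gamma\left(\frac{q(p-1)}{q-p}\right)}{\Gamma\left(\frac N2\right)\Gamma\left(\frac{qp}{q-p}\right)}\right\}^{\frac{q-p}{q}}.$$ Moreover, $T_{\mathrm{rad}}$ is attained by functions of the form $$U(x)=\left[a+b\left(\left(\frac{|x|}{R}\right)^{-\gamma}-1\right)^{-\frac{(q-p)(\beta-1)}{p(p-1)}}\right]^{-\frac{p}{q-p}}\qquad(a,b>0).$$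
   Context: $B_R\subset\mathbb{R}^N$ is the open ball of radius $R$ centered at $0$. $C^\infty_{c,\mathrm{rad}}(B_R)$ is the set of radially symmetric functions in $C_c^\infty(B_R)$. $X^{1,p}_{\alpha,\beta,\mathrm{rad}}$ is the completion of $C^\infty_{c,\mathrm{rad}}(B_R)$ with respect to the norm $\|\nabla(\cdot)\|_{L^p(B_R;\,|x|^{p-\alpha}(1-(|x|/R)^\gamma)^{p-\beta}\,dx)}$. $\Gamma$ is the Gamma function. *)

theory Defs
  imports "HOL-Analysis.Analysis"
begin

definition grad :: "('a::euclidean_space \<Rightarrow> real) \<Rightarrow> 'a \<Rightarrow> 'a" where
  "grad f x = (\<Sum>b\<in>Basis. frechet_derivative f (at x) b *\<^sub>R b)"

lemma GDERIV_grad: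
  assumes "f differentiable at x"
  shows "GDERIV f x :> grad f x"
proof -
  let ?D = "frechet_derivative f (at x)"
  have D: "(f has_derivative ?D) (at x)"
    using assms by (simp add: frechet_derivative_works)
  then interpret linear ?D
    by (rule has_derivative_linear)
  have "?D h = inner h (grad f x)" for h
  proof -
    have "?D h = ?D (\<Sum>b\<in>Basis. inner h b *\<^sub>R b)"
      by (simp add: euclidean_representation)
    also have "\<dots> = inner h (grad f x)"
      by (simp add: sum scaleR grad_def inner_sum_right mult.commute)
    finally show ?thesis .
  qed
  then have "?D = (\<lambda>h. inner h (grad f x))" by auto
  with D show ?thesis by (simp add: gderiv_def)
qed

primrec Ck :: "nat \<Rightarrow> ('a::euclidean_space \<Rightarrow> real) \<Rightarrow> bool" where
  "Ck 0 f \<longleftrightarrow> continuous_on UNIV f"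
| "Ck (Suc k) f \<longleftrightarrow> (\<forall>x. f differentiable at x) \<and>
     (\<forall>v. Ck k (\<lambda>x. frechet_derivative f (at x) v))"

text \<open>Functions on the open ball with compact support in it are identified with their
  extension by zero to the whole space.\<close>

definition test_rad :: "real \<Rightarrow> ('a::euclidean_space \<Rightarrow> real) set" where
  "test_rad R = {f. (\<forall>k. Ck k f) \<and>
     compact (closure {x. f x \<noteq> 0}) \<and> closure {x. f x \<noteq> 0} \<subseteq> ball 0 R \<and>
     (\<forall>x y. norm x = norm y \<longrightarrow> f x = f y)}"

text \<open>The $p$-th power of the norm of a vector field \<open>g\<close> in the weighted space
  $L^p(B_R;\,|x|^{p-\alpha}(1-(|x|/R)^\gamma)^{p-\beta}\,dx)$. The value of the integrand at the
  single point \<open>0\<close>, where \<open>powr\<close> is degenerate, is irrelevant here and below.\<close>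

definition energy ::
  "real \<Rightarrow> real \<Rightarrow> real \<Rightarrow> real \<Rightarrow> real \<Rightarrow> ('a::euclidean_space \<Rightarrow> 'a) \<Rightarrow> ennreal" where
  "energy p \<alpha> \<beta> \<gamma> R g =
     (\<integral>\<^sup>+ x. ennreal (norm (g x) powr p /
        (norm x powr (\<alpha> - p) * (1 - (norm x / R) powr \<gamma>) powr (\<beta> - p)))
      \<partial>lebesgue_on (ball 0 R))"

definition constraint ::
  "real \<Rightarrow> real \<Rightarrow> real \<Rightarrow> real \<Rightarrow> real \<Rightarrow> real \<Rightarrow> ('a::euclidean_space \<Rightarrow> real) \<Rightarrow> ennreal" where
  "constraint p q \<alpha> \<beta> \<gamma> R u =
     (\<integral>\<^sup>+ x. ennreal (\<bar>u x\<bar> powr q /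
        (norm x powr (real DIM('a) - q / p * (real DIM('a) - \<alpha>)) *
         (1 - (norm x / R) powr \<gamma>) powr (1 + (\<beta> - 1) / p * q)))
      \<partial>lebesgue_on (ball 0 R))"

text \<open>The completion of the radial test functions in the norm of the weighted gradient, realised
  as a space of functions: \<open>X_rad_grad \<dots> u g\<close> says that \<open>u\<close> is an element of the completion and
  that \<open>g\<close> is its gradient. An element is represented by a sequence of test functions whose
  gradients converge in the weighted $L^p$ space (equivalently, by completeness of that space,
  by a Cauchy sequence), and it is identified with the almost everywhere limit of the sequence.
  For $\alpha < N$, $\beta > 1$ and $\gamma = (N-\alpha)/(\beta-1)$ this identification is sound:
  by Hoelder's inequality, radial test functions satisfy
  $|\varphi(x)| \le C(|x|)\,\|\nabla\varphi\|$ with $C$ locally bounded on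
  $B_R \setminus \{0\}$, so a Cauchy sequence converges pointwise there, and
  \<open>u\<close> and \<open>g\<close> determine each other up to null sets, \<open>g\<close> being the weak gradient of \<open>u\<close> on
  $B_R \setminus \{0\}$.\<close>

definition X_rad_grad ::
  "real \<Rightarrow> real \<Rightarrow> real \<Rightarrow> real \<Rightarrow> real \<Rightarrow>
     ('a::euclidean_space \<Rightarrow> real) \<Rightarrow> ('a \<Rightarrow> 'a) \<Rightarrow> bool" where
  "X_rad_grad p \<alpha> \<beta> \<gamma> R u g \<longleftrightarrow>
     g \<in> borel_measurable (lebesgue_on (ball 0 R)) \<and>
     (\<exists>\<phi> :: nat \<Rightarrow> 'a \<Rightarrow> real.
        (\<forall>n. \<phi> n \<in> test_rad R) \<and>
        (\<lambda>n. energy p \<alpha> \<beta> \<gamma> R (\<lambda>x. grad (\<phi> n) x - g x)) \<longlonglongrightarrow> 0 \<and>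
        (AE x in lebesgue_on (ball 0 R). (\<lambda>n. \<phi> n x) \<longlonglongrightarrow> u x))"

text \<open>The first argument only fixes the ambient space.\<close>

definition T_rad ::
  "'a::euclidean_space itself \<Rightarrow> real \<Rightarrow> real \<Rightarrow> real \<Rightarrow> real \<Rightarrow> real \<Rightarrow> real \<Rightarrow> ennreal" where
  "T_rad _ p q \<alpha> \<beta> \<gamma> R =
     Inf {energy p \<alpha> \<beta> \<gamma> R g | (u :: 'a \<Rightarrow> real) g.
        X_rad_grad p \<alpha> \<beta> \<gamma> R u g \<and> constraint p q \<alpha> \<beta> \<gamma> R u = 1}"

definition attains_T_rad ::
  "real \<Rightarrow> real \<Rightarrow> real \<Rightarrow> real \<Rightarrow> real \<Rightarrow> real \<Rightarrow> ('a::euclidean_space \<Rightarrow> real) \<Rightarrow> bool" where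
  "attains_T_rad p q \<alpha> \<beta> \<gamma> R u \<longleftrightarrow>
     (\<exists>g. X_rad_grad p \<alpha> \<beta> \<gamma> R u g \<and> constraint p q \<alpha> \<beta> \<gamma> R u = 1 \<and>
          energy p \<alpha> \<beta> \<gamma> R g = T_rad TYPE('a) p q \<alpha> \<beta> \<gamma> R)"

definition U_fun ::
  "real \<Rightarrow> real \<Rightarrow> real \<Rightarrow> real \<Rightarrow> real \<Rightarrow> real \<Rightarrow> real \<Rightarrow> 'a::euclidean_space \<Rightarrow> real" where
  "U_fun p q \<beta> \<gamma> R a b x =
     (a + b * ((norm x / R) powr (- \<gamma>) - 1) powr (- ((q - p) * (\<beta> - 1) / (p * (p - 1)))))
       powr (- (p / (q - p)))"

end

theory Submission
  imports Defs
begin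

text \<open>
  The coordinate $s = ((|x|/R)^{-\gamma} - 1)^{\kappa}$ with $\kappa = (\beta-1)/(p-1)$ maps the
  punctured ball to the half-line, the sphere $|x| = R$ to $s = 0$ and the origin to $s = \infty$.
  The relation $\gamma = (N-\alpha)/(\beta-1)$ is exactly what makes all the weights collapse: for
  $u(x) = v(s)$ the two integrals of the problem become constant multiples of
  $$J(v) = \int_0^\infty |v'|^p\,ds \qquad\mbox{and}\qquad
    I(v) = \int_0^\infty |v|^q\, s^{-1-q(p-1)/p}\,ds$$
  (\<open>radial_energy\<close> and \<open>radial_constraint\<close>). The radial problem is therefore the inequality of
  Bliss $J(v) \ge C\, I(v)^{p/q}$ for $v(0) = 0$, with its sharp constant \<open>Bliss_const\<close>, and the
  functions $U$ of the statement are its extremals $v(s) = s\,(a s^r + b)^{-1/r}$, $r = (q-p)/p$.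

  The inequality of Bliss (\<open>Bliss_inequality\<close>) is proved by a calibration that depends on the
  accumulated mass $m(s) \in [0,1]$, the part of $I(v)$ that comes from $(0,s)$, divided by $I(v)$.
  On an extremal, $\theta = s v'/v$ is a function of $m$ alone: it decreases from 1 to 0, and it is
  the inverse of a normalised incomplete Beta function. For arbitrary $v$ one takes this same function
  $\theta(m)$ and bounds $|v'|^p$ from below by its tangent at the slope $\theta(m)\,|v|/s$. After
  subtraction of the derivative of $|v|^p s^{1-p}\theta(m)^{p-1}$ two nonnegative terms remain, and
  the weighted inequality of the arithmetic and geometric means turns them into a constant
  multiple of $m'$: the powers of $\theta$ and $1-\theta$ cancel, and those of $v$ and $s$ combine
  to the integrand of $I$ (\<open>Bliss_pointwise\<close>). The integral of $m'$ is 1, which gives the sharp constant.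

  The lower bound passes from test functions to the completion by convexity of the $p$-th power
  and Fatou's lemma (\<open>X_rad_energy_ge\<close>). In the other direction, the profile of $U$ has a
  derivative that can be cut off smoothly near $s = 0$ and $s = \infty$. The primitives of the
  truncated derivatives are constant near the origin and vanish near the sphere, so they define
  radial test functions; by dominated convergence their gradients tend to that of $U$
  (\<open>extremal_X_rad\<close>). The two integrals of $U$ are Beta integrals with parameters that
  differ by one, and hence give equality in the inequality of Bliss
  (\<open>Bliss_extremal_integrals\<close>).
\<close>

section \<open>Elementary inequalities and the incomplete Beta function\<close>

text \<open>The convex function $|x|^p$ lies above its tangent at $P$; in this form the inequality
  is Young's.\<close>

lemma Young_tangent:
  fixes p P x :: real
  assumes "1 < p" "0 \<le> P"
  shows "p * P powr (p - 1) * x - (p - 1) * P powr p \<le> \<bar>x\<bar> powr p"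
proof (cases "P = 0 \<or> x = 0")
  case False
  have "P powr (p - 1) * x \<le> P powr (p - 1) * \<bar>x\<bar>"
    by (intro mult_left_mono) auto
  also have "\<dots> = (\<bar>x\<bar> powr p) powr (1 / p) * (P powr p) powr ((p - 1) / p)"
    using assms by (simp add: powr_powr)
  also have "\<dots> \<le> 1 / p * \<bar>x\<bar> powr p + (p - 1) / p * P powr p"
    using assms False by (intro Youngs_inequality_0) (auto simp: field_simps)
  finally have "p * (P powr (p - 1) * x) \<le> p * (1 / p * \<bar>x\<bar> powr p + (p - 1) / p * P powr p)"
    using assms by (intro mult_left_mono) auto
  also have "\<dots> = \<bar>x\<bar> powr p + (p - 1) * P powr p"
    using assms by (simp add: field_simps)
  finally show ?thesis by (simp add: algebra_simps)
qed (use assms in auto)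

lemma weighted_am_gm:
  fixes x y l :: real
  assumes "0 \<le> x" "0 \<le> y" "0 < l" "l < 1"
  shows "(x / l) powr l * (y / (1 - l)) powr (1 - l) \<le> x + y"
  using Youngs_inequality_0[of l "1 - l" "x / l" "y / (1 - l)"] assms
  by (cases "x = 0 \<or> y = 0") auto

lemma DERIV_abs_powr:
  fixes p x :: real
  assumes "1 < p"
  shows "((\<lambda>x. \<bar>x\<bar> powr p) has_real_derivative p * \<bar>x\<bar> powr (p - 1) * sgn x) (at x)"
proof -
  consider "x > 0" | "x < 0" | "x = 0" by linarith
  then show ?thesis
  proof cases
    case 1
    have "((\<lambda>x. x powr p) has_real_derivative p * x powr (p - 1)) (at x)"
      using 1 by (rule has_real_derivative_powr)
    moreover have "eventually (\<lambda>y. y powr p = \<bar>y\<bar> powr p) (nhds x)"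
      using eventually_nhds_in_open[of "{0<..}" x] 1 by (auto elim: eventually_mono)
    ultimately show ?thesis using 1 by (subst DERIV_cong_ev[OF refl _ refl, symmetric]) auto
  next
    case 2
    have "((\<lambda>x. (- x) powr p) has_real_derivative p * (- x) powr (p - 1) * (- 1)) (at x)"
      using 2 by (auto intro!: derivative_eq_intros)
    moreover have "eventually (\<lambda>y. (- y) powr p = \<bar>y\<bar> powr p) (nhds x)"
      using eventually_nhds_in_open[of "{..<0}" x] 2 by (auto elim: eventually_mono)
    ultimately show ?thesis using 2
      by (subst DERIV_cong_ev[OF refl _ refl, symmetric, where f = "\<lambda>x. (- x) powr p"]) auto
  next
    case 3
    have "((\<lambda>h::real. \<bar>h\<bar> powr (p - 1)) \<longlongrightarrow> 0) (at 0)"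
      using assms by (auto intro!: tendsto_eq_intros)
    moreover have "\<bar>(\<bar>0 + h\<bar> powr p - \<bar>0\<bar> powr p) / h\<bar> = \<bar>h\<bar> powr (p - 1)" for h :: real
      by (cases "h = 0") (auto simp: abs_mult powr_diff)
    ultimately have "((\<lambda>h::real. (\<bar>0 + h\<bar> powr p - \<bar>0\<bar> powr p) / h) \<longlongrightarrow> 0) (at 0)"
      by (subst tendsto_rabs_zero_iff[symmetric]) simp
    then show ?thesis using 3 by (simp add: DERIV_def)
  qed
qed

lemma Beta_pos: "0 < a \<Longrightarrow> 0 < b \<Longrightarrow> 0 < Beta a (b::real)"
  by (simp add: Beta_def)

definition incomplete_Beta :: "real \<Rightarrow> real \<Rightarrow> real \<Rightarrow> real" where
  "incomplete_Beta a b x = integral {0..x} (\<lambda>t. t powr (a - 1) * (1 - t) powr (b - 1))"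

lemma incomplete_Beta_0: "incomplete_Beta a b 0 = 0"
  by (simp add: incomplete_Beta_def)

lemma
  fixes a b :: real
  assumes a: "0 < a" and b: "0 < b"
  shows incomplete_Beta_1: "incomplete_Beta a b 1 = Beta a b"
    and continuous_on_incomplete_Beta: "continuous_on {0..1} (incomplete_Beta a b)"
    and DERIV_incomplete_Beta: "\<And>x. 0 < x \<Longrightarrow> x < 1 \<Longrightarrow>
      (incomplete_Beta a b has_real_derivative x powr (a - 1) * (1 - x) powr (b - 1)) (at x)"
proof -
  let ?d = "\<lambda>t::real. t powr (a - 1) * (1 - t) powr (b - 1)"
  note has = has_integral_Beta_real[OF a b]
  then have int: "?d integrable_on {0..1}" by blast
  show "incomplete_Beta a b 1 = Beta a b"
    using has by (simp add: incomplete_Beta_def integral_unique)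
  show "continuous_on {0..1} (incomplete_Beta a b)"
    unfolding incomplete_Beta_def[abs_def] by (rule indefinite_integral_continuous_1[OF int])
  show "(incomplete_Beta a b has_real_derivative ?d x) (at x)" if "0 < x" "x < 1" for x
  proof -
    have "continuous (at x within {0..1} - {}) ?d"
      using that by (intro continuous_intros) auto
    from integral_has_vector_derivative_continuous_at[OF int _ _ this]
    show ?thesis unfolding incomplete_Beta_def[abs_def]
      using that by (simp add: has_real_derivative_iff_has_vector_derivative at_within_Icc_at)
  qed
qed

text \<open>The function $\theta$ is the decreasing solution of the differential equation, which says that
  the mass is the normalised incomplete Beta integral over $(\theta, 1)$. It is obtained as an inverse
  function, and it is only used for masses strictly between 0 and 1, since the right-hand side of
  the equation may be singular at the end points.\<close>

lemma incomplete_Beta_inverse: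
  fixes a b :: real
  assumes a: "0 < a" and b: "0 < b"
  obtains \<theta> :: "real \<Rightarrow> real" where
    "\<And>m. 0 < m \<Longrightarrow> m < 1 \<Longrightarrow> 0 < \<theta> m \<and> \<theta> m < 1 \<and>
      (\<theta> has_real_derivative - Beta a b * \<theta> m powr (1 - a) * (1 - \<theta> m) powr (1 - b)) (at m)"
proof -
  define d where "d = (\<lambda>t::real. t powr (a - 1) * (1 - t) powr (b - 1))"
  define F where "F = (\<lambda>x. 1 - incomplete_Beta a b x / Beta a b)"
  note B = Beta_pos[OF a b]
  have F0: "F 0 = 1" and F1: "F 1 = 0"
    using B by (simp_all add: F_def incomplete_Beta_0 incomplete_Beta_1[OF a b])
  have contF: "continuous_on {0..1} F"
    unfolding F_def using B by (intro continuous_intros continuous_on_incomplete_Beta[OF a b]) auto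
  have Fder: "(F has_real_derivative - d x / Beta a b) (at x)" if "0 < x" "x < 1" for x
    unfolding F_def d_def using B DERIV_incomplete_Beta[OF a b that] by (auto intro!: derivative_eq_intros)
  have d_pos: "d x > 0" if "0 < x" "x < 1" for x
    using that by (simp add: d_def)
  have F_anti: "F y < F x" if "0 \<le> x" "x < y" "y \<le> 1" for x y
  proof (rule DERIV_neg_imp_decreasing_open[OF that(2)])
    show "\<exists>c. (F has_real_derivative c) (at z) \<and> c < 0" if "x < z" "z < y" for z
      using Fder[of z] d_pos[of z] B that \<open>0 \<le> x\<close> \<open>y \<le> 1\<close> by (intro exI[of _ "- d z / Beta a b"]) auto
    show "continuous_on {x..y} F"
      using contF by (rule continuous_on_subset) (use that in auto)
  qed
  have F_inj: "x = y" if "F x = F y" "0 < x" "x < 1" "0 < y" "y < 1" for x y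
    using F_anti[of x y] F_anti[of y x] that by (cases x y rule: linorder_cases) auto
  define \<theta> where "\<theta> = (\<lambda>m. SOME x. 0 < x \<and> x < 1 \<and> F x = m)"
  have \<theta>: "0 < \<theta> m \<and> \<theta> m < 1 \<and> F (\<theta> m) = m" if m: "0 < m" "m < 1" for m
  proof -
    obtain x where x: "0 \<le> x" "x \<le> 1" "F x = m"
      using IVT2'[of F 1 m 0] F0 F1 contF m by (auto simp: less_imp_le)
    then have "x \<noteq> 0" "x \<noteq> 1" using F0 F1 m by auto
    with x have "0 < x \<and> x < 1 \<and> F x = m" by linarith
    then have "\<exists>x. 0 < x \<and> x < 1 \<and> F x = m" by blast
    then show ?thesis unfolding \<theta>_def by (rule someI_ex)
  qed
  have \<theta>F: "\<theta> (F x) = x" if "0 < x" "x < 1" for x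
  proof -
    have "0 < F x" "F x < 1" using F_anti[of x 1] F_anti[of 0 x] F0 F1 that by auto
    from \<theta>[OF this] show ?thesis using F_inj[of "\<theta> (F x)" x] that by auto
  qed
  show thesis
  proof
    fix m :: real assume m: "0 < m" "m < 1"
    define x where "x = \<theta> m"
    have x: "0 < x" "x < 1" "F x = m" using \<theta>[OF m] by (auto simp: x_def)
    have "isCont \<theta> (F x)"
    proof (rule isCont_inverse_function2[of "x / 2" x "(x + 1) / 2"])
      show "\<theta> (F z) = z" if "x / 2 \<le> z" "z \<le> (x + 1) / 2" for z
        using that x by (intro \<theta>F) auto
      show "isCont F z" if "x / 2 \<le> z" "z \<le> (x + 1) / 2" for z
        using that x by (intro DERIV_isCont[OF Fder]) auto
    qed (use x in auto)
    then have "(\<theta> has_real_derivative inverse (- d x / Beta a b)) (at m)"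
      using m x \<theta> Fder[of x] d_pos[of x] B
      by (intro DERIV_inverse_function[where f = F and a = 0 and b = 1]) (auto simp: x_def)
    moreover have "inverse (- d x / Beta a b) = - Beta a b * x powr (1 - a) * (1 - x) powr (1 - b)"
      using x by (simp add: d_def divide_simps powr_diff)
    ultimately show "0 < \<theta> m \<and> \<theta> m < 1 \<and>
        (\<theta> has_real_derivative - Beta a b * \<theta> m powr (1 - a) * (1 - \<theta> m) powr (1 - b)) (at m)"
      using x by (simp add: x_def)
  qed
qed

section \<open>The sharp one-dimensional inequality of Bliss\<close>

text \<open>The largest $C$ with $J(v) \ge C\,I(v)^{p/q}$ in the notation of the introduction.\<close>

definition Bliss_const :: "real \<Rightarrow> real \<Rightarrow> real" where
  "Bliss_const p q = (p - 1) * (q / p) powr (p / q) *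
     (q / (q - p) * Beta (q * (p - 1) / (q - p)) (q / (q - p))) powr ((q - p) / q)"

text \<open>The two terms on the right are what remains of $|v'|^p$ in the calibration argument, where $\eta$
  is $1-\theta$ and $c$ is the derivative of the mass with respect to
  $\int |v|^q s^{-1-q(p-1)/p}\,ds$. The weights of the two means are $p/q$ and $(q-p)/q$: with this
  choice the exponents of $\theta$ and $\eta$ add up to zero, and those of $V$ and $s$ to
  the exponents in the integrand of the constraint.\<close>

lemma Bliss_pointwise:
  fixes p q s V \<theta> \<eta> c :: real
  defines "a \<equiv> q * (p - 1) / (q - p)" and "b \<equiv> q / (q - p)"
  assumes p: "1 < p" "p < q" and s: "0 < s" and V: "0 < V" and \<theta>: "0 < \<theta>" "0 < \<eta>" and c: "0 < c"
  shows "Bliss_const p q * c powr ((q - p) / q) * (V powr q * s powr (- 1 - q * (p - 1) / p)) \<le>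
    (p - 1) * (V / s) powr p * \<theta> powr (p - 1) * \<eta> +
    c * (p - 1) * Beta a b * V powr (p + q) * s powr (- (p - 1) - 1 - q * (p - 1) / p) *
      \<theta> powr (p - 1 - a) * \<eta> powr (1 - b)"
    (is "?L \<le> ?X + ?Y")
proof -
  define l where "l = p / q"
  have l: "0 < l" "l < 1" "1 - l = (q - p) / q" using p by (auto simp: l_def field_simps)
  have ab: "0 < a" "0 < b" using p by (auto simp: a_def b_def)
  then have Bp: "0 < Beta a b" by (simp add: Beta_def)
  define k where "k = q * (p - 1) / p"
  have exps: "p * l + (p + q) * (1 - l) = q" 
     "- p * l + (- (p - 1) - 1 - k) * (1 - l) = - 1 - k"
     "(p - 1) * l + (p - 1 - a) * (1 - l) = 0"
     "l + (1 - b) * (1 - l) = 0"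
    using p by (auto simp: l_def k_def a_def b_def field_simps)
  have X: "?X / l = exp (ln (p - 1) + ln (q / p) + p * ln V - p * ln s + (p - 1) * ln \<theta> + ln \<eta>)"
  proof -
    have "(V / s) powr p = exp (p * ln V - p * ln s)"
      using s V by (simp add: powr_def ln_div algebra_simps)
    then show ?thesis using p s V \<theta> by (simp add: exp_add exp_diff powr_def l_def mult_ac)
  qed
  have Y: "?Y / (1 - l) = exp (ln c + ln (p - 1) + ln (q / (q - p) * Beta a b) + (p + q) * ln V +
       (- (p - 1) - 1 - k) * ln s + (p - 1 - a) * ln \<theta> + (1 - b) * ln \<eta>)"
    using p s V \<theta> c Bp ab unfolding exp_add l(3) by (simp add: powr_def k_def)
  have L: "?L = exp (ln (p - 1) + l * ln (q / p) + (1 - l) * ln (q / (q - p) * Beta a b) + (1 - l) * ln c +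
       q * ln V + (- 1 - k) * ln s)"
    using p s V \<theta> c Bp ab unfolding exp_add Bliss_const_def a_def[symmetric] b_def[symmetric] l_def[symmetric] l(3)[symmetric]
    by (simp add: powr_def k_def)
  have "(?X / l) powr l * (?Y / (1 - l)) powr (1 - l) = exp (
     l * (ln (p - 1) + ln (q / p) + p * ln V - p * ln s + (p - 1) * ln \<theta> + ln \<eta>) +
     (1 - l) * (ln c + ln (p - 1) + ln (q / (q - p) * Beta a b) + (p + q) * ln V +
       (- (p - 1) - 1 - k) * ln s + (p - 1 - a) * ln \<theta> + (1 - b) * ln \<eta>))"
    unfolding X Y by (simp only: powr_def exp_not_eq_zero if_False ln_exp mult_exp_exp)
  also have "\<dots> = exp (ln (p - 1) + l * ln (q / p) + (1 - l) * ln (q / (q - p) * Beta a b) + (1 - l) * ln c +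
       (p * l + (p + q) * (1 - l)) * ln V + (- p * l + (- (p - 1) - 1 - k) * (1 - l)) * ln s
       + ((p - 1) * l + (p - 1 - a) * (1 - l)) * ln \<theta> + (l + (1 - b) * (1 - l)) * ln \<eta>)"
    by (rule arg_cong[where f = exp]) (simp only: ring_distribs, simp)
  also have "\<dots> = ?L" unfolding exps L by simp
  finally have "?L = (?X / l) powr l * (?Y / (1 - l)) powr (1 - l)" by simp
  also have "\<dots> \<le> ?X + ?Y"
    using p s V \<theta> c Bp l(1,2) by (intro weighted_am_gm) auto
  finally show ?thesis .
qed

text \<open>A statement about compact intervals is enough, because test functions have a profile that
  vanishes near 0 and the right end point can then be sent to infinity. The proof shows that
  $J - Z - C\,I$ is nondecreasing, where $J$ and $I$ are the two integrals up to $s$ and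
  $Z = |v|^p s^{1-p}\theta(m)^{p-1}$.\<close>

theorem Bliss_inequality:
  fixes p q s\<^sub>0 S :: real and v v' :: "real \<Rightarrow> real"
  assumes p: "1 < p" "p < q" and S: "0 < s\<^sub>0" "s\<^sub>0 < S"
    and v: "\<And>s. s\<^sub>0 \<le> s \<Longrightarrow> s \<le> S \<Longrightarrow> (v has_real_derivative v' s) (at s)"
    and v': "continuous_on {s\<^sub>0..S} v'" and v0: "v s\<^sub>0 = 0"
  shows "Bliss_const p q *
      integral {s\<^sub>0..S} (\<lambda>s. \<bar>v s\<bar> powr q * s powr (- 1 - q * (p - 1) / p)) powr (p / q)
    \<le> integral {s\<^sub>0..S} (\<lambda>s. \<bar>v' s\<bar> powr p)"
proof -
  define f where "f = (\<lambda>s. \<bar>v s\<bar> powr q * s powr (- 1 - q * (p - 1) / p))"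
  define I where "I = (\<lambda>s. integral {s\<^sub>0..s} f)"
  define J where "J = (\<lambda>s. integral {s\<^sub>0..s} (\<lambda>s. \<bar>v' s\<bar> powr p))"
  have v_cont: "continuous_on {s\<^sub>0..S} v"
    using v by (intro DERIV_continuous_on) (auto intro: has_field_derivative_at_within)
  have f_cont: "continuous_on {s\<^sub>0..S} f"
    unfolding f_def using v_cont p S by (intro continuous_intros continuous_on_powr') auto
  have g_cont: "continuous_on {s\<^sub>0..S} (\<lambda>s. \<bar>v' s\<bar> powr p)"
    using v' p by (intro continuous_intros continuous_on_powr') auto
  have f_nonneg: "f s \<ge> 0" for s by (simp add: f_def)
  have f_int: "f integrable_on {s\<^sub>0..s}" if "s \<le> S" for s
    using that by (intro integrable_continuous_real continuous_on_subset[OF f_cont]) auto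
  have I_cont: "continuous_on {s\<^sub>0..S} I" and J_cont: "continuous_on {s\<^sub>0..S} J"
    unfolding I_def J_def by (intro indefinite_integral_continuous_1 integrable_continuous_real f_cont g_cont)+
  have I_der: "(I has_real_derivative f s) (at s)" if "s\<^sub>0 < s" "s < S" for s
    using integral_has_vector_derivative[OF f_cont, of s] that
    by (simp add: I_def has_real_derivative_iff_has_vector_derivative at_within_Icc_at)
  have J_der: "(J has_real_derivative \<bar>v' s\<bar> powr p) (at s)" if "s\<^sub>0 < s" "s < S" for s
    using integral_has_vector_derivative[OF g_cont, of s] that
    by (simp add: J_def has_real_derivative_iff_has_vector_derivative at_within_Icc_at)
  have I_nonneg: "0 \<le> I s" for s
    unfolding I_def by (cases "f integrable_on {s\<^sub>0..s}")
      (auto intro!: integral_nonneg f_nonneg simp: not_integrable_integral)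
  have I_mono: "I s \<le> I S" if "s \<le> S" for s
    unfolding I_def using that f_int by (intro integral_subset_le) (auto simp: f_nonneg)
  have J_nonneg: "0 \<le> J S"
    unfolding J_def by (intro integral_nonneg integrable_continuous_real g_cont) auto
  show ?thesis
  proof (cases "I S = 0")
    case True
    then show ?thesis using J_nonneg by (simp add: I_def J_def f_def)
  next
    case False
    with I_nonneg[of S] have IS: "I S > 0" by simp
    define a where "a = q * (p - 1) / (q - p)"
    define b where "b = q / (q - p)"
    have ab: "0 < a" "0 < b" using p by (auto simp: a_def b_def)
    obtain \<theta> where \<theta>: "\<And>m. 0 < m \<Longrightarrow> m < 1 \<Longrightarrow> 0 < \<theta> m \<and> \<theta> m < 1 \<and>
        (\<theta> has_real_derivative - Beta a b * \<theta> m powr (1 - a) * (1 - \<theta> m) powr (1 - b)) (at m)"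
      using incomplete_Beta_inverse[OF ab] by blast
    have approx: "Bliss_const p q * ((1 - 2 * e) / I S) powr ((q - p) / q) * I S \<le> J S"
      if e: "0 < e" "e < 1 / 2" for e
    proof -
      define c where "c = (1 - 2 * e) / I S"
      have c: "0 < c" "c * I S = 1 - 2 * e" using e IS by (auto simp: c_def)
      \<comment> \<open>The slack \<open>e\<close> keeps the mass away from 0 and 1, where \<open>\<theta>\<close> need not be differentiable.\<close>
      define m where "m = (\<lambda>s. e + c * I s)"
      have m: "0 < m s \<and> m s < 1" if "s \<le> S" for s
      proof -
        have "0 \<le> c * I s" "c * I s \<le> c * I S"
          using c(1) I_nonneg[of s] mult_left_mono[OF I_mono[OF that]] by simp_all
        then show ?thesis using c e unfolding m_def by linarith
      qed
      define Z where "Z = (\<lambda>s. \<bar>v s\<bar> powr p * s powr (- (p - 1)) * \<theta> (m s) powr (p - 1))"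
      define C where "C = Bliss_const p q * c powr ((q - p) / q)"
      \<comment> \<open>The term \<open>Z\<close> vanishes at the left end point and may be dropped at the right one.\<close>
      have "(J s\<^sub>0 - Z s\<^sub>0 - C * I s\<^sub>0) \<le> (J S - Z S - C * I S)"
      proof (rule DERIV_nonneg_imp_increasing_open[OF less_imp_le[OF S(2)]])
        have "continuous_on {0<..<1} \<theta>"
          using \<theta> by (intro continuous_at_imp_continuous_on ballI) (meson DERIV_isCont greaterThanLessThan_iff)
        moreover have "continuous_on {s\<^sub>0..S} m"
          unfolding m_def by (intro continuous_intros I_cont)
        ultimately have "continuous_on {s\<^sub>0..S} (\<lambda>s. \<theta> (m s))"
          by (rule continuous_on_compose2) (use m in auto)
        then show "continuous_on {s\<^sub>0..S} (\<lambda>s. J s - Z s - C * I s)"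
          unfolding Z_def using v_cont p S m \<theta>
          by (intro continuous_intros I_cont J_cont continuous_on_powr') (auto simp: less_imp_le)
      next
        fix s assume s: "s\<^sub>0 < s" "s < S"
        then have s0: "0 < s" using S by simp
        define V where "V = \<bar>v s\<bar>"
        define T where "T = \<theta> (m s)"
        have T: "0 < T" "T < 1" using \<theta> m[of s] s by (auto simp: T_def)
        define Z' where "Z' = p * V powr (p - 1) * sgn (v s) * v' s * s powr (- (p - 1)) * T powr (p - 1)
          + V powr p * (- (p - 1) * s powr (- (p - 1) - 1)) * T powr (p - 1)
          + V powr p * s powr (- (p - 1)) * ((p - 1) * T powr (p - 1 - 1) *
              (- Beta a b * T powr (1 - a) * (1 - T) powr (1 - b) * (c * f s)))"
        have dV: "((\<lambda>s. \<bar>v s\<bar> powr p) has_real_derivative p * V powr (p - 1) * sgn (v s) * v' s) (at s)"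
          using DERIV_chain2[OF DERIV_abs_powr[OF p(1)] v[of s]] s by (simp add: V_def)
        have dm: "(m has_real_derivative c * f s) (at s)"
          unfolding m_def using I_der[OF s] by (auto intro!: derivative_eq_intros)
        have dT: "((\<lambda>s. \<theta> (m s)) has_real_derivative
            - Beta a b * T powr (1 - a) * (1 - T) powr (1 - b) * (c * f s)) (at s)"
          using \<theta>[of "m s"] m[of s] s unfolding T_def by (intro DERIV_chain2[OF _ dm]) auto
        have dT': "((\<lambda>s. \<theta> (m s) powr (p - 1)) has_real_derivative (p - 1) * T powr (p - 1 - 1) *
            (- Beta a b * T powr (1 - a) * (1 - T) powr (1 - b) * (c * f s))) (at s)"
          using T unfolding T_def
          by (intro DERIV_chain2[OF has_real_derivative_powr dT[unfolded T_def]]) auto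
        have dZ: "(Z has_real_derivative Z') (at s)"
          unfolding Z_def Z'_def
          apply (rule DERIV_cong)
          apply (rule DERIV_mult[OF DERIV_mult[OF dV has_real_derivative_powr[OF s0]] dT'])
          apply (simp add: V_def T_def algebra_simps)
          done
        have "Z' + C * f s \<le> \<bar>v' s\<bar> powr p"
        proof (cases "V = 0")
          case True
          then show ?thesis using p by (simp add: Z'_def f_def V_def)
        next
          case False
          then have V: "V > 0" by (simp add: V_def)
          \<comment> \<open>The slope that the extremal through this point has for the same mass.\<close>
          define P where "P = T * V / s"
          have P: "P powr (p - 1) = V powr (p - 1) * s powr (- (p - 1)) * T powr (p - 1)"
            "P powr p = T * ((V / s) powr p * T powr (p - 1))"
            using T V s0 by (simp_all add: P_def powr_mult powr_divide powr_minus powr_diff divide_simps)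
          have fs: "f s = V powr q * s powr (- 1 - q * (p - 1) / p)" by (simp add: f_def V_def)
          have third: "V powr p * s powr (- (p - 1)) * ((p - 1) * T powr (p - 1 - 1) *
              (- Beta a b * T powr (1 - a) * (1 - T) powr (1 - b) * (c * f s))) =
              - (c * (p - 1) * Beta a b * V powr (p + q) * s powr (- (p - 1) - 1 - q * (p - 1) / p) *
                 T powr (p - 1 - a) * (1 - T) powr (1 - b))"
          proof -
            have "s powr (- (p - 1) - 1 - q * (p - 1) / p) = s powr (- (p - 1)) * s powr (- 1 - q * (p - 1) / p)"
              "T powr (p - 1 - a) = T powr (p - 1 - 1) * T powr (1 - a)"
              "V powr (p + q) = V powr p * V powr q"
              by (simp_all flip: powr_add) (simp_all add: algebra_simps)
            then show ?thesis unfolding fs by simp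
          qed
          have second: "V powr p * (- (p - 1) * s powr (- (p - 1) - 1)) * T powr (p - 1)
              = - ((p - 1) * (V / s) powr p * T powr (p - 1))"
              using V s0 by (simp add: powr_divide powr_minus divide_simps) (simp add: algebra_simps)
          \<comment> \<open>The first term combines \<open>second\<close> with the constant of the tangent, the second one is \<open>third\<close>.\<close>
          have "C * f s \<le> (p - 1) * (V / s) powr p * T powr (p - 1) * (1 - T) +
              c * (p - 1) * Beta a b * V powr (p + q) * s powr (- (p - 1) - 1 - q * (p - 1) / p) *
                T powr (p - 1 - a) * (1 - T) powr (1 - b)"
            unfolding C_def fs a_def b_def using Bliss_pointwise[OF p s0 V T(1) _ c(1), of "1 - T"] T
            by simp
          moreover have "p * P powr (p - 1) * (sgn (v s) * v' s) - (p - 1) * P powr p \<le> \<bar>v' s\<bar> powr p"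
            using Young_tangent[OF p(1), of P "sgn (v s) * v' s"] T V s0
            by (simp add: P_def abs_mult V_def sgn_if split: if_splits)
          ultimately show ?thesis unfolding Z'_def third second P by (simp add: algebra_simps)
        qed
        then show "\<exists>y. ((\<lambda>s. J s - Z s - C * I s) has_real_derivative y) (at s) \<and> 0 \<le> y"
          using J_der[OF s] I_der[OF s] dZ
          by (intro exI[of _ "\<bar>v' s\<bar> powr p - Z' - C * f s"]) (auto intro!: derivative_eq_intros)
      qed
      moreover have "J s\<^sub>0 = 0" "I s\<^sub>0 = 0" "Z s\<^sub>0 = 0" "Z S \<ge> 0"
        using p v0 by (simp_all add: J_def I_def Z_def)
      ultimately show ?thesis by (simp add: C_def c_def)
    qed
    have "((\<lambda>e. Bliss_const p q * ((1 - 2 * e) / I S) powr ((q - p) / q) * I S) \<longlongrightarrow>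
        Bliss_const p q * ((1 - 2 * 0) / I S) powr ((q - p) / q) * I S) (at_right 0)"
      using IS by (intro tendsto_intros) auto
    moreover have "eventually (\<lambda>e::real. 0 < e \<and> e < 1 / 2) (at_right 0)"
      using eventually_at_right_less[of 0] eventually_at_right[of 0 "1/2::real"]
      by (auto simp: eventually_at_right_field intro!: exI[of _ "1/2"])
    then have "eventually (\<lambda>e. Bliss_const p q * ((1 - 2 * e) / I S) powr ((q - p) / q) * I S \<le> J S) (at_right 0)"
      by eventually_elim (use approx in auto)
    ultimately have "Bliss_const p q * ((1 - 2 * 0) / I S) powr ((q - p) / q) * I S \<le> J S"
      by (rule tendsto_upperbound) auto
    moreover have "((1 - 2 * 0) / I S) powr ((q - p) / q) * I S = I S powr (p / q)"
    proof -
      have "p / q = 1 - (q - p) / q" using p by (simp add: field_simps)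
      then show ?thesis using IS by (simp add: powr_divide powr_diff)
    qed
    ultimately show ?thesis by (simp add: I_def J_def f_def mult.assoc)
  qed
qed

section \<open>The extremals of the inequality of Bliss\<close>

lemma nn_integral_FTC_greaterThan:
  fixes f F :: "real \<Rightarrow> real" and a A B :: real
  assumes F: "\<And>x. a < x \<Longrightarrow> (F has_real_derivative f x) (at x)"
    and f: "\<And>x. a < x \<Longrightarrow> isCont f x" and f_nonneg: "\<And>x. a < x \<Longrightarrow> 0 \<le> f x"
    and A: "(F \<longlongrightarrow> A) (at_right a)" and B: "(F \<longlongrightarrow> B) at_top"
  shows "(\<integral>\<^sup>+ x. ennreal (f x) * indicator {a<..} x \<partial>lborel) = ennreal (B - A)"
proof -
  have lims: "((F \<circ> real_of_ereal) \<longlongrightarrow> A) (at_right (ereal a))"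
    "((F \<circ> real_of_ereal) \<longlongrightarrow> B) (at_left \<infinity>)"
    using A B by (simp_all add: ereal_tendsto_simps)
  have ae: "AE x in lborel. ereal a < ereal x \<longrightarrow> ereal x < \<infinity> \<longrightarrow> 0 \<le> f x"
    using f_nonneg by auto
  note FTC = interval_integral_FTC_nonneg[of "ereal a" \<infinity> F f, OF _ F f ae lims]
  have eq: "einterval (ereal a) \<infinity> = {a<..}"
    by (auto simp: einterval_def)
  have int: "integrable lborel (\<lambda>x. indicator {a<..} x *\<^sub>R f x)"
    using FTC(1) unfolding eq set_integrable_def by simp
  have "(\<integral>\<^sup>+ x. ennreal (f x) * indicator {a<..} x \<partial>lborel) =
      (\<integral>\<^sup>+ x. ennreal (indicator {a<..} x *\<^sub>R f x) \<partial>lborel)"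
    by (intro nn_integral_cong) (auto simp: indicator_def)
  also have "\<dots> = ennreal (LINT x|lborel. indicator {a<..} x *\<^sub>R f x)"
    using f_nonneg by (intro nn_integral_eq_integral int) (auto simp: indicator_def)
  also have "(LINT x|lborel. indicator {a<..} x *\<^sub>R f x) = B - A"
    using FTC(2) by (simp add: interval_lebesgue_integral_def eq set_lebesgue_integral_def)
  finally show ?thesis .
qed

definition Bliss_extremal :: "real \<Rightarrow> real \<Rightarrow> real \<Rightarrow> real \<Rightarrow> real" where
  "Bliss_extremal r a b s = s * (a * s powr r + b) powr (- 1 / r)"

definition Bliss_extremal_deriv :: "real \<Rightarrow> real \<Rightarrow> real \<Rightarrow> real \<Rightarrow> real" where
  "Bliss_extremal_deriv r a b s = b * (a * s powr r + b) powr (- 1 / r - 1)"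

lemma Bliss_base_pos: "0 < a \<Longrightarrow> 0 < b \<Longrightarrow> 0 < a * s powr r + (b::real)"
  by (simp add: add_nonneg_pos)

lemma DERIV_Bliss_extremal:
  assumes "0 < r" "0 < a" "0 < b" "0 < s"
  shows "(Bliss_extremal r a b has_real_derivative Bliss_extremal_deriv r a b s) (at s)"
proof -
  define M where "M = a * s powr r + b"
  have M: "0 < M" using Bliss_base_pos[OF assms(2,3)] by (simp add: M_def)
  have "((\<lambda>s. a * s powr r + b) has_real_derivative a * (r * s powr (r - 1))) (at s)"
    using assms by (auto intro!: derivative_eq_intros)
  from DERIV_chain2[OF has_real_derivative_powr this, of "- 1 / r"] M
  have "((\<lambda>s. (a * s powr r + b) powr (- 1 / r)) has_real_derivative
      - 1 / r * M powr (- 1 / r - 1) * (a * (r * s powr (r - 1)))) (at s)"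
    by (simp add: M_def)
  from DERIV_mult[OF DERIV_ident this]
  have "(Bliss_extremal r a b has_real_derivative
      M powr (- 1 / r) - M powr (- 1 / r - 1) * (a * (s powr (r - 1) * s))) (at s)"
    unfolding Bliss_extremal_def[abs_def] by (rule DERIV_cong) (use assms in \<open>simp add: M_def field_simps\<close>)
  moreover have "s powr (r - 1) * s = s powr r"
    using assms by (simp add: powr_diff)
  moreover have "M powr (- 1 / r) = M powr (- 1 / r - 1) * M"
    using M by (simp add: powr_diff)
  ultimately show ?thesis
    by (simp add: Bliss_extremal_deriv_def M_def[symmetric]) (simp add: M_def algebra_simps)
qed

text \<open>The substitution $\theta = b/(a s^r + b)$ satisfies $\theta' = -r\theta(1-\theta)/s$ and turns
  the integral into the Beta integral over $(0,1)$.\<close>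

lemma nn_integral_Beta_rational:
  fixes r a b x y :: real
  assumes r: "0 < r" and ab: "0 < a" "0 < b" and xy: "0 < x" "0 < y"
  defines "\<theta> \<equiv> \<lambda>s. b / (a * s powr r + b)"
  shows "(\<integral>\<^sup>+ s. ennreal (\<theta> s powr x * (1 - \<theta> s) powr y * r / s) * indicator {0<..} s \<partial>lborel) =
    ennreal (Beta x y)"
proof -
  define F where "F = (\<lambda>s. - incomplete_Beta x y (\<theta> s))"
  have \<theta>: "0 < \<theta> s" "\<theta> s < 1" if "0 < s" for s
  proof -
    have "0 < a * s powr r" using ab that by simp
    then show "0 < \<theta> s" "\<theta> s < 1"
      using ab Bliss_base_pos[OF ab, of s r] unfolding \<theta>_def by (simp_all only: divide_pos_pos divide_less_eq_1_pos)
  qed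
  have d\<theta>: "(\<theta> has_real_derivative - (r * \<theta> s * (1 - \<theta> s) / s)) (at s)" if s: "0 < s" for s
  proof -
    define M where "M = a * s powr r + b"
    have M: "M \<noteq> 0" using Bliss_base_pos[OF ab, of s r] by (simp add: M_def)
    have dM: "((\<lambda>s. a * s powr r + b) has_real_derivative a * (r * s powr (r - 1))) (at s)"
      using s by (auto intro!: derivative_eq_intros)
    have "(\<theta> has_real_derivative (0 * M - b * (a * (r * s powr (r - 1)))) / (M * M)) (at s)"
      unfolding \<theta>_def M_def by (rule DERIV_divide[OF DERIV_const dM M[unfolded M_def]])
    moreover have "1 - \<theta> s = a * (s powr (r - 1) * s) / M"
    proof -
      have "1 - \<theta> s = (M - b) / M"
        using M by (simp add: \<theta>_def M_def[symmetric] diff_divide_distrib)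
      moreover have "s powr (r - 1) * s = s powr r" using s by (simp add: powr_diff)
      ultimately show ?thesis by (simp add: M_def)
    qed
    then have "- (r * \<theta> s * (1 - \<theta> s) / s) = - (r * (b / M) * (a * (s powr (r - 1) * s) / M) / s)"
      by (simp only: \<theta>_def M_def)
    then have "- (r * \<theta> s * (1 - \<theta> s) / s) = (0 * M - b * (a * (r * s powr (r - 1)))) / (M * M)"
      using s by simp
    ultimately show ?thesis by simp
  qed
  have lim0: "(\<theta> \<longlongrightarrow> 1) (at_right 0)"
  proof -
    have "((\<lambda>s. s powr r) \<longlongrightarrow> 0) (at_right 0)"
      by (rule tendsto_zero_powrI[OF tendsto_ident_at tendsto_const])
        (use r in \<open>auto intro: eventually_mono[OF eventually_at_right_less]\<close>)
    then have "(\<theta> \<longlongrightarrow> b / (a * 0 + b)) (at_right 0)"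
      unfolding \<theta>_def using ab by (intro tendsto_intros) auto
    then show ?thesis using ab by simp
  qed
  have lim1: "(\<theta> \<longlongrightarrow> 0) at_top"
  proof -
    have "((\<lambda>s::real. s powr (- r)) \<longlongrightarrow> 0) at_top"
      using r by (intro tendsto_neg_powr filterlim_ident) auto
    then have "((\<lambda>s. b * s powr (- r) / (a + b * s powr (- r))) \<longlongrightarrow> b * 0 / (a + b * 0)) at_top"
      using ab by (intro tendsto_intros) auto
    moreover have "eventually (\<lambda>s. b * s powr (- r) / (a + b * s powr (- r)) = \<theta> s) at_top"
      using eventually_gt_at_top[of 0]
      by eventually_elim (use ab in \<open>auto simp: \<theta>_def powr_minus divide_simps add_nonneg_eq_0_iff\<close>)
    ultimately show ?thesis using Lim_transform_eventually by force
  qed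
  have "(\<integral>\<^sup>+ s. ennreal (\<theta> s powr x * (1 - \<theta> s) powr y * r / s) * indicator {0<..} s \<partial>lborel) =
      ennreal (- incomplete_Beta x y 0 - (- incomplete_Beta x y 1))"
  proof (rule nn_integral_FTC_greaterThan[where F = F])
    fix s :: real assume s: "0 < s"
    have "(F has_real_derivative - (\<theta> s powr (x - 1) * (1 - \<theta> s) powr (y - 1) *
        - (r * \<theta> s * (1 - \<theta> s) / s))) (at s)"
      unfolding F_def
      by (intro DERIV_minus DERIV_chain2[OF DERIV_incomplete_Beta[OF xy] d\<theta>] \<theta> s)
    then show "(F has_real_derivative \<theta> s powr x * (1 - \<theta> s) powr y * r / s) (at s)"
      by (rule DERIV_cong) (use \<theta>[OF s] in \<open>simp add: powr_diff\<close>)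
    show "isCont (\<lambda>s. \<theta> s powr x * (1 - \<theta> s) powr y * r / s) s"
      using \<theta>[OF s] s DERIV_isCont[OF d\<theta>[OF s]] by (intro continuous_intros) auto
    show "0 \<le> \<theta> s powr x * (1 - \<theta> s) powr y * r / s"
      using s r by simp
  next
    show "(F \<longlongrightarrow> - incomplete_Beta x y 1) (at_right 0)"
      unfolding F_def
      by (intro tendsto_minus continuous_on_tendsto_compose[OF continuous_on_incomplete_Beta[OF xy] lim0])
        (use \<theta> in \<open>auto intro!: eventually_mono[OF eventually_at_right_less[of 0]] simp: less_imp_le\<close>)
    show "(F \<longlongrightarrow> - incomplete_Beta x y 0) at_top"
      unfolding F_def
      by (intro tendsto_minus continuous_on_tendsto_compose[OF continuous_on_incomplete_Beta[OF xy] lim1])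
        (use \<theta> in \<open>auto intro!: eventually_mono[OF eventually_gt_at_top[of 0]] simp: less_imp_le\<close>)
  qed
  then show ?thesis by (simp add: incomplete_Beta_0 incomplete_Beta_1[OF xy])
qed

text \<open>With $\theta = b/(a s^r + b)$, which is $s v'/v$ for the extremal $v$, the integrands are
  multiples of $\theta^x(1-\theta)^y r/s$ and $\theta^{x+1}(1-\theta)^{y-1} r/s$ for
  $x = q(p-1)/(q-p)$ and $y = q/(q-p)$. The quotient of the two Beta integrals is $x/(y-1)$, and
  the powers of $a$ and $b$ balance, so that the second integral is the value that
  equality in the inequality of Bliss requires.\<close>

lemma Bliss_extremal_integrals:
  fixes p q a b :: real
  assumes p: "1 < p" "p < q" and ab: "0 < a" "0 < b"
  defines "r \<equiv> (q - p) / p"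
  obtains I where "0 < I"
    "(\<integral>\<^sup>+ s. ennreal (Bliss_extremal r a b s powr q * s powr (- 1 - q * (p - 1) / p)) *
       indicator {0<..} s \<partial>lborel) = ennreal I"
    "(\<integral>\<^sup>+ s. ennreal (Bliss_extremal_deriv r a b s powr p) * indicator {0<..} s \<partial>lborel) =
       ennreal (Bliss_const p q * I powr (p / q))"
proof -
  have r: "0 < r" using p by (simp add: r_def)
  define x where "x = q * (p - 1) / (q - p)"
  define y where "y = q / (q - p)"
  have y1: "y - 1 = p / (q - p)" using p by (simp add: y_def field_simps)
  have xy: "0 < x" "0 < y" "0 < y - 1" using p unfolding y1 by (auto simp: x_def y_def)
  define \<theta> where "\<theta> = (\<lambda>s. b / (a * s powr r + b))"
  define Bt where "Bt = Beta x y"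
  have Bt: "0 < Bt" using Beta_pos xy by (simp add: Bt_def)
  define C1 where "C1 = exp (- x * ln b - y * ln a - ln r)"
  define C2 where "C2 = exp ((p - x - 1) * ln b - (y - 1) * ln a - ln r)"
  have expo: "y * r - 1 = r" "(y - 1) * r = 1" "x + y = q / r" "p * (1 / r + 1) = x + y" 
      "q / p - 1 = r" "q / p = y * r"
  proof -
    have nz: "q - p \<noteq> 0" "p \<noteq> 0" "q \<noteq> 0" using p by auto
    show 1: "q / p = y * r" unfolding y_def r_def using nz by simp
    show 2: "q / p - 1 = r" unfolding r_def using nz by (simp add: diff_divide_distrib)
    show "y * r - 1 = r" using 1 2 by simp
    show "(y - 1) * r = 1" unfolding y1 r_def using nz by simp
    have "q / r = q * p / (q - p)" by (simp add: r_def)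
    moreover have "x + y = q * p / (q - p)"
      by (simp add: x_def y_def add_divide_distrib[symmetric] algebra_simps)
    ultimately show 3: "x + y = q / r" by simp
    have "1 / r + 1 = q / (q - p)" using nz by (simp add: r_def divide_simps)
    then show "p * (1 / r + 1) = x + y" using \<open>x + y = q * p / (q - p)\<close> by simp
  qed
  have logs: "ln (\<theta> s) = ln b - ln (a * s powr r + b)" "0 < \<theta> s" "0 < 1 - \<theta> s"
    "ln (1 - \<theta> s) = ln a + r * ln s - ln (a * s powr r + b)" if s: "0 < s" for s
  proof -
    define M where "M = a * s powr r + b"
    have M: "0 < M" using Bliss_base_pos[OF ab] by (simp add: M_def)
    have \<theta>: "\<theta> s = b / M" by (simp add: \<theta>_def M_def)
    have "1 - \<theta> s = (M - b) / M" unfolding \<theta> using M by (simp add: diff_divide_distrib)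
    then have \<theta>': "1 - \<theta> s = a * s powr r / M" by (simp add: M_def)
    show "0 < \<theta> s" "0 < 1 - \<theta> s"
      unfolding \<theta>' unfolding \<theta> using M ab s by simp_all
    show "ln (\<theta> s) = ln b - ln (a * s powr r + b)"
      unfolding \<theta> M_def[symmetric] using M ab by (simp add: ln_div)
    show "ln (1 - \<theta> s) = ln a + r * ln s - ln (a * s powr r + b)"
      unfolding \<theta>' M_def[symmetric] using M ab s by (simp add: ln_div ln_mult ln_powr)
  qed
  have e1: "Bliss_extremal r a b s powr q * s powr (- 1 - q * (p - 1) / p) =
      C1 * (\<theta> s powr x * (1 - \<theta> s) powr y * r / s)" if s: "0 < s" for s
  proof -
    define M where "M = a * s powr r + b"
    have M: "0 < M" using Bliss_base_pos[OF ab] by (simp add: M_def)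
    note L = logs[OF s, folded M_def]
    have "Bliss_extremal r a b s = exp (ln s - ln M / r)"
      unfolding Bliss_extremal_def M_def[symmetric] using M s
      by (simp add: powr_def exp_diff exp_minus divide_inverse)
    then have "Bliss_extremal r a b s powr q * s powr (- 1 - q * (p - 1) / p) =
        exp (q * (ln s - ln M / r) + (- 1 - q * (p - 1) / p) * ln s)"
      using s by (simp add: powr_def exp_add)
    also have "q * (ln s - ln M / r) + (- 1 - q * (p - 1) / p) * ln s = (q / p - 1) * ln s - q / r * ln M"
    proof -
      have "q * (p - 1) / p = q - q / p"
        using p by (simp add: right_diff_distrib diff_divide_distrib)
      then show ?thesis by (simp only:) (simp add: algebra_simps)
    qed
    also have "\<dots> = (y * r - 1) * ln s - (x + y) * ln M"
      by (simp only: expo)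
    also have "\<dots> = (- x * ln b - y * ln a - ln r) + (x * (ln b - ln M) + y * (ln a + r * ln s - ln M) + ln r - ln s)"
      by (simp add: algebra_simps)
    also have "exp \<dots> = C1 * (\<theta> s powr x * (1 - \<theta> s) powr y * r / s)"
      using L s r unfolding exp_add C1_def[symmetric] by (simp add: powr_def exp_diff exp_add)
    finally show ?thesis .
  qed
  have e2: "Bliss_extremal_deriv r a b s powr p =
      C2 * (\<theta> s powr (x + 1) * (1 - \<theta> s) powr (y - 1) * r / s)" if s: "0 < s" for s
  proof -
    define M where "M = a * s powr r + b"
    have M: "0 < M" using Bliss_base_pos[OF ab] by (simp add: M_def)
    note L = logs[OF s, folded M_def]
    have "Bliss_extremal_deriv r a b s = exp (ln b - (1 / r + 1) * ln M)"
    proof -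
      have "M powr (- 1 / r - 1) = exp (- ((1 / r + 1) * ln M))"
        using M by (simp add: powr_def algebra_simps)
      then show ?thesis
        unfolding Bliss_extremal_deriv_def M_def[symmetric] using ab by (simp add: exp_diff exp_minus divide_inverse)
    qed
    then have "Bliss_extremal_deriv r a b s powr p = exp (p * (ln b - (1 / r + 1) * ln M))"
      by (simp add: powr_def)
    also have "p * (ln b - (1 / r + 1) * ln M) = p * ln b - (p * (1 / r + 1)) * ln M + ((y - 1) * r - 1) * ln s"
      unfolding expo(2) by (simp add: algebra_simps)
    also have "\<dots> = ((p - x - 1) * ln b - (y - 1) * ln a - ln r) +
        ((x + 1) * (ln b - ln M) + (y - 1) * (ln a + r * ln s - ln M) + ln r - ln s)"
      unfolding expo(4) by (simp add: algebra_simps)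
    also have "exp \<dots> = C2 * (\<theta> s powr (x + 1) * (1 - \<theta> s) powr (y - 1) * r / s)"
      using L s r unfolding exp_add C2_def[symmetric] by (simp add: powr_def exp_diff exp_add)
    finally show ?thesis .
  qed
  show thesis
  proof (rule that[of "C1 * Bt"])
    show "0 < C1 * Bt" using Bt by (simp add: C1_def)
    have "(\<integral>\<^sup>+ s. ennreal (Bliss_extremal r a b s powr q * s powr (- 1 - q * (p - 1) / p)) *
       indicator {0<..} s \<partial>lborel) =
       (\<integral>\<^sup>+ s. ennreal C1 * (ennreal (\<theta> s powr x * (1 - \<theta> s) powr y * r / s) * indicator {0<..} s) \<partial>lborel)"
      by (intro nn_integral_cong) (auto simp: indicator_def e1 ennreal_mult'[symmetric] C1_def)
    also have "\<dots> = ennreal C1 * ennreal Bt"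
      unfolding \<theta>_def Bt_def using nn_integral_Beta_rational[OF r ab xy(1,2)]
      by (subst nn_integral_cmult) auto
    finally show "(\<integral>\<^sup>+ s. ennreal (Bliss_extremal r a b s powr q * s powr (- 1 - q * (p - 1) / p)) *
       indicator {0<..} s \<partial>lborel) = ennreal (C1 * Bt)"
      using Bt by (simp add: ennreal_mult' C1_def)
    have x1: "0 < x + 1" using xy by simp
    have "(\<integral>\<^sup>+ s. ennreal (Bliss_extremal_deriv r a b s powr p) * indicator {0<..} s \<partial>lborel) =
       (\<integral>\<^sup>+ s. ennreal C2 * (ennreal (\<theta> s powr (x + 1) * (1 - \<theta> s) powr (y - 1) * r / s) * indicator {0<..} s) \<partial>lborel)"
      by (intro nn_integral_cong) (auto simp: indicator_def e2 ennreal_mult'[symmetric] C2_def)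
    also have "\<dots> = ennreal C2 * ennreal (Beta (x + 1) (y - 1))"
      unfolding \<theta>_def using nn_integral_Beta_rational[OF r ab x1 xy(3)]
      by (subst nn_integral_cmult) auto
    also have "\<dots> = ennreal (C2 * Beta (x + 1) (y - 1))"
      by (simp add: ennreal_mult' C2_def)
    also have "C2 * Beta (x + 1) (y - 1) = Bliss_const p q * (C1 * Bt) powr (p / q)"
    proof -
      have G: "Gamma (x + 1) = x * Gamma x" "Gamma y = (y - 1) * Gamma (y - 1)"
        using Gamma_plus1[of x] Gamma_plus1[of "y - 1"] xy nonpos_Ints_nonpos[of x] nonpos_Ints_nonpos[of "y - 1"]
        by force+
      have "Beta (x + 1) (y - 1) = x / (y - 1) * Bt"
        unfolding Bt_def Beta_def using G xy by simp
      also have "x / (y - 1) = q * (p - 1) / p" unfolding y1 x_def using p by simp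
      finally have "C2 * Beta (x + 1) (y - 1) = exp ((p - x - 1) * ln b - (y - 1) * ln a - ln r + ln (q * (p - 1) / p) + ln Bt)"
        using p Bt by (simp add: C2_def exp_add exp_diff)
      also have "(p - x - 1) * ln b - (y - 1) * ln a - ln r + ln (q * (p - 1) / p) + ln Bt =
        ln (p - 1) + p / q * ln (q / p) + (q - p) / q * (ln (q / (q - p)) + ln Bt)
          + p / q * (- x * ln b - y * ln a - ln r + ln Bt)"
      proof -
        have "p - x - 1 = - (p / q) * x" "y - 1 = p / q * y" "(q - p) / q = 1 - p / q"
          using p by (simp_all add: x_def y_def field_simps)
        note e = this
        have l: "ln (q * (p - 1) / p) = ln q + ln (p - 1) - ln p" "ln (q / p) = ln q - ln p"
          "ln (q / (q - p)) = ln q - ln (q - p)" "ln r = ln (q - p) - ln p"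
          using p by (simp_all add: r_def ln_div ln_mult)
        show ?thesis unfolding e l by (simp add: algebra_simps)
      qed
      also have "exp \<dots> = Bliss_const p q * (C1 * Bt) powr (p / q)"
        using p Bt xy by (simp add: Bliss_const_def powr_def exp_add x_def[symmetric] y_def[symmetric] Bt_def[symmetric] ln_mult C1_def)
      finally show ?thesis .
    qed
    finally show "(\<integral>\<^sup>+ s. ennreal (Bliss_extremal_deriv r a b s powr p) * indicator {0<..} s \<partial>lborel) =
       ennreal (Bliss_const p q * (C1 * Bt) powr (p / q))" .
  qed
qed

section \<open>Reduction of radial integrals to the half-line\<close>

text \<open>The images under $x \mapsto \sigma(|x|)$ of Lebesgue measure on the ball and the measure with the
  density on the right have the same tails: apart from the origin, the points with $\sigma(|x|) > t > 0$
  form the ball of radius $\rho(t)$, and the density is the derivative of $-V\rho^N$, where $V$ is the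
  volume of the unit ball.\<close>

lemma nn_integral_radial_substitution:
  fixes \<rho> \<sigma> \<delta> :: "real \<Rightarrow> real" and k :: "real \<Rightarrow> ennreal" and R :: real
  assumes R: "0 < R"
    and der: "\<And>s. 0 < s \<Longrightarrow> (\<rho> has_real_derivative - \<delta> s) (at s)"
    and \<delta>: "\<And>s. 0 < s \<Longrightarrow> isCont \<delta> s" "\<And>s. 0 < s \<Longrightarrow> 0 \<le> \<delta> s"
    and lim: "(\<rho> \<longlongrightarrow> R) (at_right 0)" "(\<rho> \<longlongrightarrow> 0) at_top"
    and \<rho>: "\<And>s. 0 < s \<Longrightarrow> 0 < \<rho> s \<and> \<rho> s < R"
    and \<sigma>: "\<And>r. 0 < r \<Longrightarrow> r < R \<Longrightarrow> 0 < \<sigma> r"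
    and less: "\<And>r t. 0 < r \<Longrightarrow> r < R \<Longrightarrow> 0 < t \<Longrightarrow> t < \<sigma> r \<longleftrightarrow> r < \<rho> t"
    and meas[measurable]: "\<sigma> \<in> borel_measurable borel" "k \<in> borel_measurable borel" 
       "\<delta> \<in> borel_measurable borel" "\<rho> \<in> borel_measurable borel"
  shows "(\<integral>\<^sup>+ x. k (\<sigma> (norm x)) \<partial>lebesgue_on (ball (0::'a::euclidean_space) R)) =
    (\<integral>\<^sup>+ s. ennreal (DIM('a) * unit_ball_vol DIM('a) * \<rho> s ^ (DIM('a) - 1) * \<delta> s) *
       k s * indicator {0<..} s \<partial>lborel)"
proof -
  define n where "n = DIM('a)"
  have n: "n > 0" by (simp add: n_def)
  define V where "V = unit_ball_vol (real n)"
  have V: "V > 0" by (simp add: V_def)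
  define d where "d = (\<lambda>s. real n * V * \<rho> s ^ (n - 1) * \<delta> s)"
  have d_meas[measurable]: "d \<in> borel_measurable borel" unfolding d_def by measurable
  define M where "M = distr (lebesgue_on (ball (0::'a) R)) borel (\<lambda>x. \<sigma> (norm x))"
  define M' where "M' = density lborel (\<lambda>s. ennreal (d s) * indicator {0<..} s)"
  have ball_meas: "emeasure lebesgue (ball (0::'a) r) = ennreal (V * r ^ n)" if "0 \<le> r" for r
    using emeasure_ball[OF that, of "0::'a"] by (simp add: V_def n_def)
  have norm_meas[measurable]: "(\<lambda>x::'a. \<sigma> (norm x)) \<in> borel_measurable (lebesgue_on (ball 0 R))"
    by (intro measurable_restrict_space1 measurable_completion) measurable
  have M_tail: "emeasure M {t<..} = ennreal (V * (if t \<le> 0 then R else \<rho> t) ^ n)" for t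
  proof -
    define r where "r = (if t \<le> 0 then R else \<rho> t)"
    have r: "0 < r" "r \<le> R" using R \<rho>[of t] by (auto simp: r_def)
    let ?S = "(\<lambda>x::'a. \<sigma> (norm x)) -` {t<..} \<inter> ball 0 R"
    have iff: "t < \<sigma> u \<longleftrightarrow> u < r" if "0 < u" "u < R" for u
      using \<sigma>[OF that] less[OF that, of t] that by (auto simp: r_def)
    have S: "?S \<in> sets lebesgue"
      using measurable_sets[OF norm_meas, of "{t<..}"]
      by (simp add: space_restrict_space sets_restrict_space_iff)
    have "emeasure M {t<..} = emeasure (lebesgue_on (ball (0::'a) R)) ?S"
      unfolding M_def by (subst emeasure_distr) (simp_all add: space_restrict_space)
    also have "\<dots> = emeasure lebesgue ?S"
      by (intro emeasure_restrict_space) auto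
    also have "\<dots> = emeasure lebesgue (ball (0::'a) r)"
    proof (rule emeasure_eq_AE)
      \<comment> \<open>The value of \<open>\<sigma>\<close> at 0 is arbitrary, so the origin has to be excluded.\<close>
      have "AE x in lebesgue. (x::'a) \<noteq> 0"
        by (rule AE_I'[of "{0}"]) (auto intro: null_sets_completionI)
      then show "AE x in lebesgue. x \<in> ?S \<longleftrightarrow> x \<in> ball (0::'a) r"
      proof eventually_elim
        case (elim x)
        then show ?case using iff[of "norm x"] r by auto
      qed
    qed (use S in auto)
    finally show ?thesis using ball_meas[of r] r by (simp add: r_def)
  qed
  have M'_tail: "emeasure M' {t<..} = ennreal (V * (if t \<le> 0 then R else \<rho> t) ^ n)" for t
  proof -
    define a where "a = max t 0"
    have "emeasure M' {t<..} = (\<integral>\<^sup>+ s. ennreal (d s) * indicator {a<..} s \<partial>lborel)"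
      unfolding M'_def by (subst emeasure_density) (auto intro!: nn_integral_cong simp: a_def indicator_def)
    also have "\<dots> = ennreal (0 - (- V * (if t \<le> 0 then R else \<rho> t) ^ n))"
    proof (rule nn_integral_FTC_greaterThan[where F = "\<lambda>s. - V * \<rho> s ^ n"])
      fix s assume "a < s"
      then have s: "0 < s" by (simp add: a_def)
      show "((\<lambda>s. - V * \<rho> s ^ n) has_real_derivative d s) (at s)"
        using der[OF s] by (auto intro!: derivative_eq_intros simp: d_def)
      show "isCont d s" unfolding d_def using \<delta>(1)[OF s] DERIV_isCont[OF der[OF s]]
        by (intro continuous_intros) auto
      show "0 \<le> d s" unfolding d_def using \<delta>(2)[OF s] \<rho>[OF s] V by auto
    next
      have "(\<rho> \<longlongrightarrow> (if t \<le> 0 then R else \<rho> t)) (at_right a)"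
        using lim(1) DERIV_isCont[OF der[of t]] filterlim_at_split[of \<rho> "nhds (\<rho> t)" t]
        by (auto simp: a_def isCont_def)
      then show "((\<lambda>s. - V * \<rho> s ^ n) \<longlongrightarrow> - V * (if t \<le> 0 then R else \<rho> t) ^ n) (at_right a)"
        by (intro tendsto_intros)
      have "((\<lambda>s. - V * \<rho> s ^ n) \<longlongrightarrow> - V * 0 ^ n) at_top"
        by (intro tendsto_intros lim)
      then show "((\<lambda>s. - V * \<rho> s ^ n) \<longlongrightarrow> 0) at_top" using n by (simp add: zero_power)
    qed
    finally show ?thesis by simp
  qed
  have "M = M'"
    by (rule measure_eqI_lessThan) (auto simp: M_tail M'_tail, auto simp: M_def M'_def)
  have "(\<integral>\<^sup>+ x. k (\<sigma> (norm x)) \<partial>lebesgue_on (ball (0::'a) R)) = (\<integral>\<^sup>+ s. k s \<partial>M)"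
    unfolding M_def by (subst nn_integral_distr) auto
  also have "\<dots> = (\<integral>\<^sup>+ s. ennreal (d s) * indicator {0<..} s * k s \<partial>lborel)"
    unfolding \<open>M = M'\<close> M'_def by (subst nn_integral_density) auto
  also have "\<dots> = (\<integral>\<^sup>+ s. ennreal (d s) * k s * indicator {0<..} s \<partial>lborel)"
    by (intro nn_integral_cong) (auto simp: mult_ac)
  finally show ?thesis by (simp add: d_def n_def V_def)
qed

text \<open>The number $N$ is tied to the dimension of the space only in the lemmas on integrals over the ball;
  everything about the change of variables happens on the half-line.\<close>

locale radial_weights =
  fixes p q \<alpha> \<beta> \<gamma> R N :: real
  assumes R: "0 < R" and p: "1 < p" and pq: "p < q" and N: "0 < N"
    and \<alpha>: "\<alpha> < N" and \<beta>: "1 < \<beta>" and \<gamma>_def: "\<gamma> = (N - \<alpha>) / (\<beta> - 1)"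
begin

definition \<kappa> :: real where "\<kappa> = (\<beta> - 1) / (p - 1)"

text \<open>The radius at the coordinate $s$, the inverse of the coordinate \<open>coord\<close> below; \<open>radius_speed\<close>
  is the negative of its derivative.\<close>

definition radius :: "real \<Rightarrow> real" where
  "radius s = R * (1 + s powr (1 / \<kappa>)) powr (- 1 / \<gamma>)"

definition coord :: "real \<Rightarrow> real" where
  "coord r = ((r / R) powr (- \<gamma>) - 1) powr \<kappa>"

definition radius_speed :: "real \<Rightarrow> real" where
  "radius_speed s = R / (\<gamma> * \<kappa>) * (1 + s powr (1 / \<kappa>)) powr (- 1 / \<gamma> - 1) * s powr (1 / \<kappa> - 1)"

text \<open>The constants that relate the integrals over the ball to those over the half-line.\<close>

definition energy_factor :: real where
  "energy_factor = N * unit_ball_vol N * R powr (N - \<alpha>) * ((N - \<alpha>) / (p - 1)) powr (p - 1)"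

definition constraint_factor :: real where
  "constraint_factor = N * unit_ball_vol N * R powr (q / p * (N - \<alpha>)) * ((p - 1) / (N - \<alpha>))"

lemma \<gamma>_pos: "0 < \<gamma>" and \<kappa>_pos: "0 < \<kappa>"
  using \<alpha> \<beta> p by (auto simp: \<gamma>_def \<kappa>_def)

lemma \<gamma>\<kappa>_nonzero[simp]: "\<gamma> \<noteq> 0" "\<kappa> \<noteq> 0"
  using \<gamma>_pos \<kappa>_pos by simp_all

lemma \<gamma>\<kappa>: "\<gamma> * \<kappa> = (N - \<alpha>) / (p - 1)"
  using \<beta> by (simp add: \<gamma>_def \<kappa>_def)

lemma factors_pos: "0 < energy_factor" "0 < constraint_factor"
  using N \<alpha> p R by (auto simp: energy_factor_def constraint_factor_def)

lemma radius_measurable[measurable]: "radius \<in> borel_measurable borel"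
  and coord_measurable[measurable]: "coord \<in> borel_measurable borel"
  and radius_speed_measurable[measurable]: "radius_speed \<in> borel_measurable borel"
  unfolding radius_def[abs_def] coord_def[abs_def] radius_speed_def[abs_def] by measurable

lemma one_plus_powr_pos: "0 < 1 + s powr (x::real)"
  by (simp add: add_pos_nonneg)

lemma DERIV_radius:
  assumes "0 < s"
  shows "(radius has_real_derivative - radius_speed s) (at s)"
proof -
  have 1: "1 + s powr (1 / \<kappa>) > 0" by (simp add: add_pos_nonneg)
  show ?thesis
    unfolding radius_def[abs_def] radius_speed_def
    by (rule DERIV_cong, (rule derivative_eq_intros DERIV_cmult | use assms 1 in simp)+)
qed

lemma radius_speed_pos: "0 < s \<Longrightarrow> 0 < radius_speed s"
  unfolding radius_speed_def using R \<gamma>_pos \<kappa>_pos one_plus_powr_pos[of s "1 / \<kappa>"]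
  by (intro mult_pos_pos divide_pos_pos) auto

lemma isCont_radius_speed: "0 < s \<Longrightarrow> isCont radius_speed s"
  unfolding radius_speed_def[abs_def] using \<gamma>_pos \<kappa>_pos
  by (intro continuous_intros) (auto simp: add_nonneg_eq_0_iff)

lemma radius_strict_antimono: "0 < s \<Longrightarrow> s < t \<Longrightarrow> radius t < radius s"
  by (rule DERIV_neg_imp_decreasing[of s t radius], assumption)
    (metis DERIV_radius radius_speed_pos less_le_trans neg_less_0_iff_less)

lemma radius_bounds: "0 < s \<Longrightarrow> 0 < radius s \<and> radius s < R"
  using R \<gamma>_pos one_plus_powr_pos[of s "1 / \<kappa>"] powr_less_mono2_neg[of "- 1 / \<gamma>" 1 "1 + s powr (1 / \<kappa>)"]
  by (auto simp: radius_def)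

lemma radius_at_0: "(radius \<longlongrightarrow> R) (at_right 0)"
proof -
  have "((\<lambda>s. s powr (1 / \<kappa>)) \<longlongrightarrow> 0) (at_right 0)"
    by (rule tendsto_zero_powrI[OF tendsto_ident_at tendsto_const])
      (use \<kappa>_pos in \<open>auto intro: eventually_mono[OF eventually_at_right_less]\<close>)
  then have "((\<lambda>s. R * (1 + s powr (1 / \<kappa>)) powr (- 1 / \<gamma>)) \<longlongrightarrow> R * (1 + 0) powr (- 1 / \<gamma>)) (at_right 0)"
    by (intro tendsto_intros) auto
  then show ?thesis by (simp add: radius_def[abs_def])
qed

lemma radius_at_top: "(radius \<longlongrightarrow> 0) at_top"
proof -
  have "filterlim (\<lambda>s::real. s powr (1 / \<kappa>)) at_top at_top"
  proof (rule filterlim_cong[THEN iffD1, OF refl refl])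
    show "filterlim (\<lambda>s::real. exp (1 / \<kappa> * ln s)) at_top at_top"
      using \<kappa>_pos
      by (intro filterlim_compose[OF exp_at_top] filterlim_tendsto_pos_mult_at_top[OF tendsto_const _ ln_at_top]) auto
    show "eventually (\<lambda>s. exp (1 / \<kappa> * ln s) = s powr (1 / \<kappa>)) at_top"
      using eventually_gt_at_top[of "0::real"] by eventually_elim (simp add: powr_def)
  qed
  then have "filterlim (\<lambda>s::real. 1 + s powr (1 / \<kappa>)) at_top at_top"
    by (intro filterlim_tendsto_add_at_top[OF tendsto_const])
  then have "((\<lambda>s. (1 + s powr (1 / \<kappa>)) powr (- 1 / \<gamma>)) \<longlongrightarrow> 0) at_top"
    using \<gamma>_pos by (intro tendsto_neg_powr) auto
  then have "((\<lambda>s. R * (1 + s powr (1 / \<kappa>)) powr (- 1 / \<gamma>)) \<longlongrightarrow> R * 0) at_top"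
    by (intro tendsto_intros)
  then show ?thesis by (simp add: radius_def[abs_def])
qed

lemma coord_base: "0 < r \<Longrightarrow> r < R \<Longrightarrow> 1 < (r / R) powr (- \<gamma>)"
  using \<gamma>_pos R powr_less_mono2_neg[of "- \<gamma>" "r / R" 1] by simp

lemma coord_pos: "0 < r \<Longrightarrow> r < R \<Longrightarrow> 0 < coord r"
  using coord_base[of r] by (simp add: coord_def)

lemma radius_coord: "0 < r \<Longrightarrow> r < R \<Longrightarrow> radius (coord r) = r"
  using coord_base[of r] \<gamma>_pos \<kappa>_pos R by (simp add: radius_def coord_def powr_powr less_imp_neq[THEN not_sym])

lemma less_coord_iff:
  assumes "0 < r" "r < R" "0 < t"
  shows "t < coord r \<longleftrightarrow> r < radius t"
  using radius_strict_antimono[of t "coord r"] radius_strict_antimono[of "coord r" t] radius_coord[OF assms(1,2)]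
    coord_pos[OF assms(1,2)] assms by (cases t "coord r" rule: linorder_cases) auto

text \<open>Every factor in the weights is a product of powers of $R$, $s$ and $1 + s^{1/\kappa}$; in logarithms
  the cancellations below are linear identities.\<close>

lemma weight_logs:
  assumes s: "0 < s"
  defines "L \<equiv> ln (1 + s powr (1 / \<kappa>))"
  shows "radius s = exp (ln R - L / \<gamma>)" "1 - (radius s / R) powr \<gamma> = exp (ln s / \<kappa> - L)"
    "radius_speed s = exp (ln R - ln (\<gamma> * \<kappa>) + (- 1 / \<gamma> - 1) * L + (1 / \<kappa> - 1) * ln s)"
proof -
  have 1: "1 + s powr (1 / \<kappa>) > 0" by (simp add: add_pos_nonneg)
  have 2: "exp L = 1 + s powr (1 / \<kappa>)" using 1 by (simp add: L_def)
  show r: "radius s = exp (ln R - L / \<gamma>)"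
  proof -
    have "(1 + s powr (1 / \<kappa>)) powr (- 1 / \<gamma>) = exp (- L / \<gamma>)"
      using 1 by (simp add: powr_def[of "1 + s powr (1 / \<kappa>)"] L_def)
    moreover have "ln R - L / \<gamma> = ln R + - L / \<gamma>" by simp
    ultimately show ?thesis using R by (simp only: radius_def exp_add exp_ln)
  qed
  have "radius s / R = exp (- L / \<gamma>)"
    unfolding r using R by (simp add: exp_diff exp_minus divide_inverse)
  then have "(radius s / R) powr \<gamma> = exp (- L)"
    by (simp add: powr_def)
  then have "1 - (radius s / R) powr \<gamma> = (exp L - 1) / exp L"
    by (simp add: exp_minus field_simps)
  also have "\<dots> = exp (ln s / \<kappa> - L)"
    using s unfolding 2 exp_diff by (simp add: powr_def)
  finally show "1 - (radius s / R) powr \<gamma> = exp (ln s / \<kappa> - L)" .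
  have "\<gamma> * \<kappa> > 0" using \<gamma>_pos \<kappa>_pos by simp
  then show "radius_speed s = exp (ln R - ln (\<gamma> * \<kappa>) + (- 1 / \<gamma> - 1) * L + (1 / \<kappa> - 1) * ln s)"
    using R 1 s unfolding exp_add exp_diff radius_speed_def powr_def L_def by simp
qed

text \<open>The exponent of $1 + s^{1/\kappa}$ vanishes because $(N-\alpha)/\gamma = \beta-1$, and that of $s$
  because $(\beta-1)/\kappa = p-1$. The factor $|\rho'|^p$ for the radius $\rho$ is the one that the
  chain rule produces.\<close>

lemma energy_weight:
  assumes s: "0 < s" and n: "N = real n"
  shows "N * unit_ball_vol N * radius s ^ (n - 1) * radius_speed s /
    (radius s powr (\<alpha> - p) * (1 - (radius s / R) powr \<gamma>) powr (\<beta> - p)) = energy_factor * radius_speed s powr p"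
proof -
  define L where "L = ln (1 + s powr (1 / \<kappa>))"
  define l where "l = ln s"
  define K where "K = ln (\<gamma> * \<kappa>)"
  note W = weight_logs[OF s, folded L_def l_def K_def]
  have gk: "0 < \<gamma> * \<kappa>" using \<gamma>_pos \<kappa>_pos by simp
  have nn: "real (n - 1) = N - 1" using n N by (simp add: of_nat_diff)
  have c: "energy_factor = N * unit_ball_vol N * exp ((N - \<alpha>) * ln R + (p - 1) * K)"
    using R gk by (simp add: energy_factor_def \<gamma>\<kappa>[symmetric] powr_def exp_add K_def)
  have "(N - 1) * (ln R - L / \<gamma>) + (ln R - K + (- 1 / \<gamma> - 1) * L + (1 / \<kappa> - 1) * l)
        - ((\<alpha> - p) * (ln R - L / \<gamma>) + (\<beta> - p) * (l / \<kappa> - L)) =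
      (N - \<alpha>) * ln R + (p - 1) * K + p * (ln R - K + (- 1 / \<gamma> - 1) * L + (1 / \<kappa> - 1) * l)"
  proof -
    have "(N - \<alpha>) / \<gamma> = \<beta> - 1" "(\<beta> - 1) / \<kappa> = p - 1"
      using \<alpha> \<beta> p by (simp_all add: \<gamma>_def \<kappa>_def)
    then have "(N - \<alpha>) / \<gamma> * L = (\<beta> - 1) * L" "(\<beta> - 1) / \<kappa> * l = (p - 1) * l" by simp_all
    then show ?thesis by (simp add: algebra_simps diff_divide_distrib add_divide_distrib)
  qed
  then have "exp ((N - 1) * (ln R - L / \<gamma>)) * exp (ln R - K + (- 1 / \<gamma> - 1) * L + (1 / \<kappa> - 1) * l)
        / (exp ((\<alpha> - p) * (ln R - L / \<gamma>)) * exp ((\<beta> - p) * (l / \<kappa> - L))) =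
      exp ((N - \<alpha>) * ln R + (p - 1) * K) * exp (p * (ln R - K + (- 1 / \<gamma> - 1) * L + (1 / \<kappa> - 1) * l))"
    by (simp only: mult_exp_exp exp_diff[symmetric])
  moreover have "radius s ^ (n - 1) = exp ((N - 1) * (ln R - L / \<gamma>))"
    unfolding W(1) nn[symmetric] by (simp only: exp_of_nat_mult)
  moreover have "radius s powr (\<alpha> - p) = exp ((\<alpha> - p) * (ln R - L / \<gamma>))"
    "radius_speed s powr p = exp (p * (ln R - K + (- 1 / \<gamma> - 1) * L + (1 / \<kappa> - 1) * l))"
    unfolding W by (simp_all only: powr_def exp_not_eq_zero if_False ln_exp)
  moreover have "(1 - (radius s / R) powr \<gamma>) powr (\<beta> - p) = exp ((\<beta> - p) * (l / \<kappa> - L))"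
    unfolding W(2) by (simp only: powr_def exp_not_eq_zero if_False ln_exp)
  ultimately show ?thesis unfolding W(3) c
    by (simp add: mult.assoc times_divide_eq_right[symmetric] del: times_divide_eq_right)
qed

text \<open>Here too the exponent of $1 + s^{1/\kappa}$ vanishes, by the same two relations.\<close>

lemma constraint_weight:
  assumes s: "0 < s" and n: "N = real n"
  shows "N * unit_ball_vol N * radius s ^ (n - 1) * radius_speed s /
    (radius s powr (N - q / p * (N - \<alpha>)) * (1 - (radius s / R) powr \<gamma>) powr (1 + (\<beta> - 1) / p * q))
    = constraint_factor * s powr (- 1 - q * (p - 1) / p)"
proof -
  define L where "L = ln (1 + s powr (1 / \<kappa>))"
  define l where "l = ln s"
  define K where "K = ln (\<gamma> * \<kappa>)"
  note W = weight_logs[OF s, folded L_def l_def K_def]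
  have gk: "0 < \<gamma> * \<kappa>" using \<gamma>_pos \<kappa>_pos by simp
  have nn: "real (n - 1) = N - 1" using n N by (simp add: of_nat_diff)
  have c: "constraint_factor = N * unit_ball_vol N * exp (q / p * (N - \<alpha>) * ln R - K)"
    using R gk \<gamma>\<kappa> \<alpha> p by (simp add: constraint_factor_def powr_def exp_diff K_def)
  have "(N - 1) * (ln R - L / \<gamma>) + (ln R - K + (- 1 / \<gamma> - 1) * L + (1 / \<kappa> - 1) * l)
        - ((N - q / p * (N - \<alpha>)) * (ln R - L / \<gamma>) + (1 + (\<beta> - 1) / p * q) * (l / \<kappa> - L)) =
      q / p * (N - \<alpha>) * ln R - K + (- 1 - q * (p - 1) / p) * l"
  proof -
    have e: "(N - \<alpha>) / \<gamma> = \<beta> - 1" "(\<beta> - 1) / \<kappa> = p - 1"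
      using \<alpha> \<beta> p by (simp_all add: \<gamma>_def \<kappa>_def)
    have "q / p * (N - \<alpha>) * L / \<gamma> = q / p * ((N - \<alpha>) / \<gamma>) * L"
      "(\<beta> - 1) / p * q * (l / \<kappa>) = q / p * ((\<beta> - 1) / \<kappa>) * l" by simp_all
    then have "q / p * (N - \<alpha>) * L / \<gamma> = q / p * (\<beta> - 1) * L"
      "(\<beta> - 1) / p * q * (l / \<kappa>) = q / p * (p - 1) * l" unfolding e by simp_all
    then show ?thesis
      by (simp add: algebra_simps diff_divide_distrib add_divide_distrib)
  qed
  then have "exp ((N - 1) * (ln R - L / \<gamma>)) * exp (ln R - K + (- 1 / \<gamma> - 1) * L + (1 / \<kappa> - 1) * l)
        / (exp ((N - q / p * (N - \<alpha>)) * (ln R - L / \<gamma>)) * exp ((1 + (\<beta> - 1) / p * q) * (l / \<kappa> - L))) =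
      exp (q / p * (N - \<alpha>) * ln R - K) * exp ((- 1 - q * (p - 1) / p) * l)"
    by (simp only: mult_exp_exp exp_diff[symmetric])
  moreover have "radius s ^ (n - 1) = exp ((N - 1) * (ln R - L / \<gamma>))"
    unfolding W(1) nn[symmetric] by (simp only: exp_of_nat_mult)
  moreover have "radius s powr (N - q / p * (N - \<alpha>)) = exp ((N - q / p * (N - \<alpha>)) * (ln R - L / \<gamma>))"
    unfolding W(1) by (simp only: powr_def exp_not_eq_zero if_False ln_exp)
  moreover have "(1 - (radius s / R) powr \<gamma>) powr (1 + (\<beta> - 1) / p * q) = exp ((1 + (\<beta> - 1) / p * q) * (l / \<kappa> - L))"
    unfolding W(2) by (simp only: powr_def exp_not_eq_zero if_False ln_exp)
  moreover have "s powr (- 1 - q * (p - 1) / p) = exp ((- 1 - q * (p - 1) / p) * l)"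
    using s by (simp add: powr_def l_def)
  ultimately show ?thesis unfolding W(3) c
    by (simp add: mult.assoc times_divide_eq_right[symmetric] del: times_divide_eq_right)
qed

lemma AE_punctured_ball:
  "AE x in lebesgue_on (ball (0::'a::euclidean_space) R). x \<noteq> 0 \<and> norm x < R"
proof -
  have "AE x in lebesgue. (x::'a) \<noteq> 0"
    by (rule AE_I'[of "{0}"]) (auto intro: null_sets_completionI)
  then show ?thesis
    by (subst AE_restrict_space_iff) auto
qed

lemma nn_integral_coord:
  fixes k :: "real \<Rightarrow> ennreal"
  assumes n: "N = real DIM('a)" and [measurable]: "k \<in> borel_measurable borel"
  shows "(\<integral>\<^sup>+ x. k (coord (norm x)) \<partial>lebesgue_on (ball (0::'a::euclidean_space) R)) =
    (\<integral>\<^sup>+ s. ennreal (N * unit_ball_vol N * radius s ^ (DIM('a) - 1) * radius_speed s) *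
       k s * indicator {0<..} s \<partial>lborel)"
  unfolding n
  by (rule nn_integral_radial_substitution[where \<rho> = radius and \<delta> = radius_speed])
     (use R DERIV_radius isCont_radius_speed radius_speed_pos radius_at_0 radius_at_top radius_bounds coord_pos less_coord_iff
      in \<open>auto simp: less_imp_le\<close>)

lemma radial_energy:
  fixes w :: "real \<Rightarrow> real"
  assumes n: "N = real DIM('a)" and [measurable]: "w \<in> borel_measurable borel"
    and w: "\<And>s. 0 < s \<Longrightarrow> 0 \<le> w s"
  shows "(\<integral>\<^sup>+ x. ennreal ((w (coord (norm x)) / radius_speed (coord (norm x))) powr p /
        (norm x powr (\<alpha> - p) * (1 - (norm x / R) powr \<gamma>) powr (\<beta> - p)))
      \<partial>lebesgue_on (ball (0::'a::euclidean_space) R)) =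
    ennreal energy_factor * (\<integral>\<^sup>+ s. ennreal (w s powr p) * indicator {0<..} s \<partial>lborel)"
    (is "(\<integral>\<^sup>+ x. ?f x \<partial>_) = _")
proof -
  define k where "k = (\<lambda>s. ennreal ((w s / radius_speed s) powr p /
        (radius s powr (\<alpha> - p) * (1 - (radius s / R) powr \<gamma>) powr (\<beta> - p))))"
  have "(\<integral>\<^sup>+ x. ?f x \<partial>lebesgue_on (ball (0::'a) R)) =
      (\<integral>\<^sup>+ x. k (coord (norm x)) \<partial>lebesgue_on (ball (0::'a) R))"
    using AE_punctured_ball by (intro nn_integral_cong_AE) (auto simp: k_def radius_coord)
  also have "\<dots> = (\<integral>\<^sup>+ s. ennreal (N * unit_ball_vol N * radius s ^ (DIM('a) - 1) * radius_speed s) *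
       k s * indicator {0<..} s \<partial>lborel)"
    by (rule nn_integral_coord[OF n]) (simp add: k_def)
  also have "\<dots> = (\<integral>\<^sup>+ s. ennreal energy_factor * (ennreal (w s powr p) * indicator {0<..} s) \<partial>lborel)"
  proof (intro nn_integral_cong)
    fix s :: real
    show "ennreal (N * unit_ball_vol N * radius s ^ (DIM('a) - 1) * radius_speed s) * k s * indicator {0<..} s =
      ennreal energy_factor * (ennreal (w s powr p) * indicator {0<..} s)"
    proof (cases "0 < s")
      case True
      have "N * unit_ball_vol N * radius s ^ (DIM('a) - 1) * radius_speed s * ((w s / radius_speed s) powr p /
        (radius s powr (\<alpha> - p) * (1 - (radius s / R) powr \<gamma>) powr (\<beta> - p))) =
        N * unit_ball_vol N * radius s ^ (DIM('a) - 1) * radius_speed s /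
        (radius s powr (\<alpha> - p) * (1 - (radius s / R) powr \<gamma>) powr (\<beta> - p)) * (w s / radius_speed s) powr p"
        by simp
      also have "\<dots> = energy_factor * (radius_speed s powr p * (w s / radius_speed s) powr p)"
        using energy_weight[OF True n] by simp
      also have "radius_speed s powr p * (w s / radius_speed s) powr p = w s powr p"
        using radius_speed_pos[OF True] w[OF True] by (simp add: powr_divide)
      finally have *: "N * unit_ball_vol N * radius s ^ (DIM('a) - 1) * radius_speed s * ((w s / radius_speed s) powr p /
        (radius s powr (\<alpha> - p) * (1 - (radius s / R) powr \<gamma>) powr (\<beta> - p))) = energy_factor * w s powr p" .
      have "0 \<le> N * unit_ball_vol N * radius s ^ (DIM('a) - 1) * radius_speed s"
        using N radius_bounds[OF True] radius_speed_pos[OF True] by simp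
      then show ?thesis using True factors_pos unfolding k_def
        by (simp only: ennreal_mult'[symmetric] * mult_1_right greaterThan_iff indicator_simps(1) less_imp_le)
    qed simp
  qed
  also have "\<dots> = ennreal energy_factor * (\<integral>\<^sup>+ s. ennreal (w s powr p) * indicator {0<..} s \<partial>lborel)"
    by (rule nn_integral_cmult) simp
  finally show ?thesis .
qed

lemma radial_constraint:
  fixes h :: "real \<Rightarrow> real" and u :: "'a::euclidean_space \<Rightarrow> real"
  assumes n: "N = real DIM('a)" and [measurable]: "h \<in> borel_measurable borel"
    and u: "\<And>x. x \<noteq> 0 \<Longrightarrow> norm x < R \<Longrightarrow> u x = h (coord (norm x))"
  shows "constraint p q \<alpha> \<beta> \<gamma> R u = ennreal constraint_factor *
    (\<integral>\<^sup>+ s. ennreal (\<bar>h s\<bar> powr q * s powr (- 1 - q * (p - 1) / p)) * indicator {0<..} s \<partial>lborel)"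
proof -
  define k where "k = (\<lambda>s. ennreal (\<bar>h s\<bar> powr q /
     (radius s powr (N - q / p * (N - \<alpha>)) * (1 - (radius s / R) powr \<gamma>) powr (1 + (\<beta> - 1) / p * q))))"
  have "constraint p q \<alpha> \<beta> \<gamma> R u = (\<integral>\<^sup>+ x. k (coord (norm x)) \<partial>lebesgue_on (ball (0::'a) R))"
    unfolding constraint_def using AE_punctured_ball
    by (intro nn_integral_cong_AE) (auto simp: k_def radius_coord u n)
  also have "\<dots> = (\<integral>\<^sup>+ s. ennreal (N * unit_ball_vol N * radius s ^ (DIM('a) - 1) * radius_speed s) *
       k s * indicator {0<..} s \<partial>lborel)"
    by (rule nn_integral_coord[OF n]) (simp add: k_def)
  also have "\<dots> = (\<integral>\<^sup>+ s. ennreal constraint_factor *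
      (ennreal (\<bar>h s\<bar> powr q * s powr (- 1 - q * (p - 1) / p)) * indicator {0<..} s) \<partial>lborel)"
  proof (intro nn_integral_cong)
    fix s :: real
    show "ennreal (N * unit_ball_vol N * radius s ^ (DIM('a) - 1) * radius_speed s) * k s * indicator {0<..} s =
      ennreal constraint_factor * (ennreal (\<bar>h s\<bar> powr q * s powr (- 1 - q * (p - 1) / p)) * indicator {0<..} s)"
    proof (cases "0 < s")
      case True
      have "N * unit_ball_vol N * radius s ^ (DIM('a) - 1) * radius_speed s * (\<bar>h s\<bar> powr q /
        (radius s powr (N - q / p * (N - \<alpha>)) * (1 - (radius s / R) powr \<gamma>) powr (1 + (\<beta> - 1) / p * q))) =
        N * unit_ball_vol N * radius s ^ (DIM('a) - 1) * radius_speed s /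
        (radius s powr (N - q / p * (N - \<alpha>)) * (1 - (radius s / R) powr \<gamma>) powr (1 + (\<beta> - 1) / p * q)) * \<bar>h s\<bar> powr q"
        by simp
      also have "\<dots> = constraint_factor * (\<bar>h s\<bar> powr q * s powr (- 1 - q * (p - 1) / p))"
        unfolding constraint_weight[OF True n] by simp
      finally have *: "N * unit_ball_vol N * radius s ^ (DIM('a) - 1) * radius_speed s * (\<bar>h s\<bar> powr q /
        (radius s powr (N - q / p * (N - \<alpha>)) * (1 - (radius s / R) powr \<gamma>) powr (1 + (\<beta> - 1) / p * q))) =
        constraint_factor * (\<bar>h s\<bar> powr q * s powr (- 1 - q * (p - 1) / p))" .
      have "0 \<le> N * unit_ball_vol N * radius s ^ (DIM('a) - 1) * radius_speed s"
        using N radius_bounds[OF True] radius_speed_pos[OF True] by simp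
      then show ?thesis using True factors_pos unfolding k_def
        by (simp only: ennreal_mult'[symmetric] * mult_1_right greaterThan_iff indicator_simps(1) less_imp_le)
    qed simp
  qed
  also have "\<dots> = ennreal constraint_factor *
    (\<integral>\<^sup>+ s. ennreal (\<bar>h s\<bar> powr q * s powr (- 1 - q * (p - 1) / p)) * indicator {0<..} s \<partial>lborel)"
    by (rule nn_integral_cmult) simp
  finally show ?thesis .
qed

end

section \<open>Differentiable functions of one variable and of the squared norm\<close>

text \<open>The derivatives are two-sided, so for an open set this is the usual notion of a $k$ times
  continuously differentiable function. Smoothness is expressed by a universally quantified $k$.\<close>

fun Ck_on :: "nat \<Rightarrow> real set \<Rightarrow> (real \<Rightarrow> real) \<Rightarrow> bool" where
  "Ck_on 0 A f \<longleftrightarrow> continuous_on A f"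
| "Ck_on (Suc k) A f \<longleftrightarrow>
     (\<exists>f'. (\<forall>x\<in>A. (f has_real_derivative f' x) (at x)) \<and> Ck_on k A f')"

lemma Ck_on_SucE:
  assumes "Ck_on (Suc k) A f"
  obtains f' where "\<forall>x\<in>A. (f has_real_derivative f' x) (at x)" "Ck_on k A f'"
  using assms unfolding Ck_on.simps by blast

lemma Ck_on_SucI:
  "(\<And>x. x \<in> A \<Longrightarrow> (f has_real_derivative f' x) (at x)) \<Longrightarrow> Ck_on k A f' \<Longrightarrow> Ck_on (Suc k) A f"
  unfolding Ck_on.simps by blast

lemma Ck_on_cong:
  assumes "open A" "\<And>x. x \<in> A \<Longrightarrow> f x = g x" "Ck_on k A f"
  shows "Ck_on k A g"
proof (cases k)
  case 0
  then show ?thesis using continuous_on_cong[of A A f g] assms by simp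
next
  case (Suc j)
  with assms(3) obtain f' where f': "\<forall>x\<in>A. (f has_real_derivative f' x) (at x)" "Ck_on j A f'"
    unfolding Ck_on.simps Suc by blast
  have "(g has_real_derivative f' x) (at x)" if "x \<in> A" for x
    by (rule has_field_derivative_transform_within_open[OF bspec[OF f'(1) that] assms(1) that assms(2)])
  with f'(2) show ?thesis unfolding Suc by (rule Ck_on_SucI[rotated])
qed

lemma Ck_on_imp_continuous: "Ck_on k A f \<Longrightarrow> continuous_on A f"
proof (cases k)
  case (Suc j)
  moreover assume "Ck_on k A f"
  ultimately obtain f' where "\<forall>x\<in>A. (f has_real_derivative f' x) (at x)"
    by (auto elim: Ck_on_SucE simp del: Ck_on.simps)
  then show ?thesis
    by (meson DERIV_isCont continuous_at_imp_continuous_on)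
qed simp

lemma Ck_on_SucD: "Ck_on (Suc k) A f \<Longrightarrow> Ck_on k A f"
proof (induction k arbitrary: f)
  case 0
  then show ?case using Ck_on_imp_continuous[of "Suc 0" A f] by simp
next
  case (Suc k)
  then show ?case by (metis Ck_on.simps(2))
qed

lemma Ck_on_const: "Ck_on k A (\<lambda>x. c)"
proof (induction k arbitrary: c)
  case (Suc k)
  show ?case by (rule Ck_on_SucI[OF DERIV_const Suc])
qed simp

lemma Ck_on_ident: "Ck_on k A (\<lambda>x. x)"
  by (cases k) (auto simp del: Ck_on.simps(2) intro!: Ck_on_SucI[OF DERIV_ident Ck_on_const])

lemma Ck_on_add: "Ck_on k A f \<Longrightarrow> Ck_on k A g \<Longrightarrow> Ck_on k A (\<lambda>x. f x + g x)"
proof (induction k arbitrary: f g)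
  case (Suc k)
  obtain f' where f': "\<forall>x\<in>A. (f has_real_derivative f' x) (at x)" "Ck_on k A f'"
    by (rule Ck_on_SucE[OF Suc.prems(1)])
  obtain g' where g': "\<forall>x\<in>A. (g has_real_derivative g' x) (at x)" "Ck_on k A g'"
    by (rule Ck_on_SucE[OF Suc.prems(2)])
  show ?case
    by (rule Ck_on_SucI[OF _ Suc.IH[OF f'(2) g'(2)]]) (simp add: DERIV_add f'(1) g'(1))
qed (simp add: continuous_on_add)

lemma Ck_on_mult: "Ck_on k A f \<Longrightarrow> Ck_on k A g \<Longrightarrow> Ck_on k A (\<lambda>x. f x * g x)"
proof (induction k arbitrary: f g)
  case (Suc k)
  obtain f' where f': "\<forall>x\<in>A. (f has_real_derivative f' x) (at x)" "Ck_on k A f'"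
    by (rule Ck_on_SucE[OF Suc.prems(1)])
  obtain g' where g': "\<forall>x\<in>A. (g has_real_derivative g' x) (at x)" "Ck_on k A g'"
    by (rule Ck_on_SucE[OF Suc.prems(2)])
  have "Ck_on k A (\<lambda>x. f' x * g x + g' x * f x)"
    by (intro Ck_on_add Suc.IH f'(2) g'(2) Suc.prems[THEN Ck_on_SucD])
  from Ck_on_SucI[OF _ this] show ?case by (simp add: DERIV_mult f'(1) g'(1) del: Ck_on.simps)
qed (simp add: continuous_on_mult)

lemma Ck_on_compose:
  assumes "Ck_on k B f" "Ck_on k A g" "\<And>x. x \<in> A \<Longrightarrow> g x \<in> B"
  shows "Ck_on k A (\<lambda>x. f (g x))"
  using assms(1,2)
proof (induction k arbitrary: f)
  case 0
  then show ?case using assms(3) by (auto intro: continuous_on_compose2)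
next
  case (Suc k)
  obtain f' where f': "\<forall>x\<in>B. (f has_real_derivative f' x) (at x)" "Ck_on k B f'"
    by (rule Ck_on_SucE[OF Suc.prems(1)])
  obtain g' where g': "\<forall>x\<in>A. (g has_real_derivative g' x) (at x)" "Ck_on k A g'"
    by (rule Ck_on_SucE[OF Suc.prems(2)])
  have *: "Ck_on k A (\<lambda>x. f' (g x) * g' x)"
    by (rule Ck_on_mult[OF Suc.IH[OF f'(2) Ck_on_SucD[OF Suc.prems(2)]] g'(2)])
  show ?case
    by (rule Ck_on_SucI[OF _ *], rule DERIV_chain2) (simp_all add: f'(1) g'(1) assms(3))
qed

text \<open>Derivatives are unique, so those on the two pieces agree on the overlap.\<close>

lemma Ck_on_Un:
  assumes "open A" "open B" "Ck_on k A f" "Ck_on k B f"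
  shows "Ck_on k (A \<union> B) f"
  using assms(3,4)
proof (induction k arbitrary: f)
  case 0
  then show ?case using assms by (simp add: continuous_on_open_Un)
next
  case (Suc k)
  obtain f' where f': "\<forall>x\<in>A. (f has_real_derivative f' x) (at x)" "Ck_on k A f'"
    by (rule Ck_on_SucE[OF Suc.prems(1)])
  obtain g' where g': "\<forall>x\<in>B. (f has_real_derivative g' x) (at x)" "Ck_on k B g'"
    by (rule Ck_on_SucE[OF Suc.prems(2)])
  define h where "h = (\<lambda>x. if x \<in> A then f' x else g' x)"
  have hB: "g' x = h x" if "x \<in> B" for x
    using DERIV_unique[OF bspec[OF f'(1)] bspec[OF g'(1) that]] by (simp add: h_def)
  have "Ck_on k (A \<union> B) h"
    using Ck_on_cong[OF assms(1) _ f'(2), of h] Ck_on_cong[OF assms(2) hB g'(2)]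
    by (intro Suc.IH) (simp_all add: h_def)
  moreover have "(f has_real_derivative h x) (at x)" if "x \<in> A \<union> B" for x
    using that f'(1) g'(1) by (auto simp: h_def)
  ultimately show ?case by (rule Ck_on_SucI[rotated])
qed

lemma Ck_on_powr:
  assumes "A \<subseteq> {0<..}"
  shows "Ck_on k A (\<lambda>x. x powr c)"
proof (induction k arbitrary: c)
  case 0
  have "continuous_on A (\<lambda>x. x powr c)"
    using assms by (intro continuous_intros) auto
  then show ?case by simp
next
  case (Suc k)
  have "Ck_on k A (\<lambda>x. c * x powr (c - 1))"
    by (intro Ck_on_mult Ck_on_const Suc)
  then show ?case
    by (rule Ck_on_SucI[rotated]) (use assms in \<open>auto intro: has_real_derivative_powr\<close>)
qed

text \<open>The standard smooth function that vanishes on a half-line.\<close>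

definition flat :: "real \<Rightarrow> real" where
  "flat x = (if 0 < x then exp (- inverse x) else 0)"

lemma poly_times_exp_tendsto_0:
  fixes P :: "real poly"
  shows "((\<lambda>t. poly P t * exp (- t)) \<longlongrightarrow> 0) at_top"
proof -
  have "((\<lambda>t. \<Sum>i\<le>degree P. coeff P i * (t ^ i / exp t)) \<longlongrightarrow> (\<Sum>i\<le>degree P. coeff P i * 0)) at_top"
    by (intro tendsto_intros tendsto_power_div_exp_0)
  moreover have "poly P t * exp (- t) = (\<Sum>i\<le>degree P. coeff P i * (t ^ i / exp t))" for t
    by (simp add: poly_altdef sum_distrib_right exp_minus divide_inverse mult.assoc)
  ultimately show ?thesis by simp
qed

text \<open>Products of \<open>flat\<close> with a polynomial in $1/x$ form a class that is closed under
  differentiation, also at 0, where the exponential beats every power of $1/x$.\<close>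

lemma DERIV_poly_flat:
  fixes P :: "real poly"
  shows "((\<lambda>x. poly P (inverse x) * flat x) has_real_derivative
    poly (monom 1 2 * (P - pderiv P)) (inverse x) * flat x) (at x)"
proof -
  consider "x > 0" | "x < 0" | "x = 0" by linarith
  then show ?thesis
  proof cases
    case 1
    have "((\<lambda>x. poly P (inverse x) * exp (- inverse x)) has_real_derivative
        poly (monom 1 2 * (P - pderiv P)) (inverse x) * exp (- inverse x)) (at x)"
      using 1 by (auto intro!: derivative_eq_intros DERIV_chain2[OF poly_DERIV]
          simp: poly_monom algebra_simps power2_eq_square)
    moreover have "eventually (\<lambda>y. poly P (inverse y) * exp (- inverse y) = poly P (inverse y) * flat y) (nhds x)"
      using eventually_nhds_in_open[of "{0<..}" x] 1 by (auto elim: eventually_mono simp: flat_def)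
    ultimately show ?thesis using 1
      by (subst DERIV_cong_ev[OF refl _ refl, symmetric]) (auto simp: flat_def)
  next
    case 2
    have "eventually (\<lambda>y. 0 = poly P (inverse y) * flat y) (nhds x)"
      using eventually_nhds_in_open[of "{..<0}" x] 2 by (auto elim: eventually_mono simp: flat_def)
    then show ?thesis using 2
      by (subst DERIV_cong_ev[OF refl _ refl, symmetric, where f = "\<lambda>_. 0"]) (auto simp: flat_def)
  next
    case 3
    \<comment> \<open>The difference quotient at 0 has one more factor \<open>inverse h\<close>.\<close>
    define Q where "Q = pCons 0 P"
    have "((\<lambda>h. poly Q (inverse h) * exp (- inverse h)) \<longlongrightarrow> 0) (at_right 0)"
      by (rule filterlim_compose[OF poly_times_exp_tendsto_0 filterlim_inverse_at_top_right])
    then have "((\<lambda>h. poly Q (inverse h) * flat h) \<longlongrightarrow> 0) (at_right 0)"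
      by (rule Lim_transform_eventually)
        (use eventually_at_right_less[of "0::real"] in \<open>auto elim!: eventually_mono simp: flat_def\<close>)
    moreover have "((\<lambda>h. poly Q (inverse h) * flat h) \<longlongrightarrow> 0) (at_left 0)"
      by (rule Lim_transform_eventually[OF tendsto_const])
        (auto simp: flat_def eventually_at_filter)
    ultimately have "((\<lambda>h. poly Q (inverse h) * flat h) \<longlongrightarrow> 0) (at 0)"
      by (simp add: filterlim_at_split)
    moreover have "(\<lambda>h. (poly P (inverse (0 + h)) * flat (0 + h) - poly P (inverse 0) * flat 0) / h) =
        (\<lambda>h. poly Q (inverse h) * flat h)"
      by (auto simp: Q_def flat_def divide_inverse)
    moreover have "poly (monom 1 2 * (P - pderiv P)) (inverse 0) * flat 0 = 0"
      by (simp add: flat_def)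
    ultimately show ?thesis unfolding 3 DERIV_def by metis
  qed
qed

lemma Ck_on_flat: "Ck_on k A flat"
proof -
  have "Ck_on k A (\<lambda>x. poly P (inverse x) * flat x)" for P
  proof (induction k arbitrary: P)
    case 0
    show ?case unfolding Ck_on.simps
      by (intro continuous_at_imp_continuous_on ballI DERIV_isCont[OF DERIV_poly_flat])
  next
    case (Suc k)
    show ?case by (rule Ck_on_SucI[OF DERIV_poly_flat Suc])
  qed
  from this[of 1] show ?thesis by simp
qed

lemma Ck_SucI:
  assumes "\<And>x. (f has_derivative f' x) (at x)" "\<And>v. Ck k (\<lambda>x. f' x v)"
  shows "Ck (Suc k) f"
proof -
  have "frechet_derivative f (at x) = f' x" for x
    using frechet_derivative_at[OF assms(1)] by simp
  then show ?thesis using assms by (auto simp: differentiable_def)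
qed

lemma Ck_SucD: "Ck (Suc k) f \<Longrightarrow> Ck k f"
proof (induction k arbitrary: f)
  case 0
  then show ?case
    by (auto intro!: continuous_at_imp_continuous_on differentiable_imp_continuous_within)
qed simp

lemma Ck_Suc_has_derivative:
  "Ck (Suc k) f \<Longrightarrow> (f has_derivative frechet_derivative f (at x)) (at x)"
  by (simp add: frechet_derivative_works[symmetric])

lemma Ck_const: "Ck k (\<lambda>x. c)"
proof (induction k arbitrary: c)
  case (Suc k)
  show ?case by (rule Ck_SucI[OF has_derivative_const Suc])
qed simp

lemma Ck_inner: "Ck k (\<lambda>x. inner x v)"
proof (cases k)
  case (Suc j)
  show ?thesis unfolding Suc
    by (rule Ck_SucI[OF bounded_linear_imp_has_derivative[OF bounded_linear_inner_left] Ck_const])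
qed (simp add: continuous_on_inner)

lemma Ck_add: "Ck k f \<Longrightarrow> Ck k g \<Longrightarrow> Ck k (\<lambda>x. f x + g x)"
proof (induction k arbitrary: f g)
  case (Suc k)
  show ?case
    by (rule Ck_SucI[OF has_derivative_add[OF Suc.prems[THEN Ck_Suc_has_derivative]]])
      (use Suc in auto)
qed (simp add: continuous_on_add)

lemma Ck_mult: "Ck k f \<Longrightarrow> Ck k g \<Longrightarrow> Ck k (\<lambda>x. f x * g x)"
proof (induction k arbitrary: f g)
  case (Suc k)
  show ?case
  proof (rule Ck_SucI[OF has_derivative_mult[OF Suc.prems[THEN Ck_Suc_has_derivative]]])
    fix v
    have "Ck k f" "Ck k g" using Suc.prems by (auto dest: Ck_SucD simp del: Ck.simps)
    moreover have "Ck k (\<lambda>x. frechet_derivative f (at x) v)" "Ck k (\<lambda>x. frechet_derivative g (at x) v)"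
      using Suc.prems by auto
    ultimately show "Ck k (\<lambda>x. f x * frechet_derivative g (at x) v + frechet_derivative f (at x) v * g x)"
      by (intro Ck_add Suc.IH)
  qed
qed (simp add: continuous_on_mult)

text \<open>Radial functions are written as functions of $|x|^2$ since $|x|$ is not differentiable at the
  origin.\<close>

lemma Ck_radial_profile:
  fixes g :: "real \<Rightarrow> real"
  assumes "Ck_on k A g" "{0..} \<subseteq> A"
  shows "Ck k (\<lambda>x::'a::euclidean_space. g (inner x x))"
  using assms(1)
proof (induction k arbitrary: g)
  case 0
  then have "continuous_on A g" by simp
  then have "continuous_on (UNIV :: 'a set) (\<lambda>x. g (inner x x))"
    by (rule continuous_on_compose2) (use assms(2) in \<open>auto intro: continuous_intros simp: subset_iff\<close>)
  then show ?case by simp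
next
  case (Suc k)
  obtain g' where g': "\<forall>x\<in>A. (g has_real_derivative g' x) (at x)" "Ck_on k A g'"
    by (rule Ck_on_SucE[OF Suc.prems])
  show ?case
  proof (rule Ck_SucI)
    fix x :: 'a
    have "((\<lambda>x. inner x x) has_derivative (\<lambda>v. inner x v + inner v x)) (at x)"
      by (rule has_derivative_inner[OF has_derivative_ident has_derivative_ident])
    moreover have "(g has_derivative (*) (g' (inner x x))) (at (inner x x))"
      using bspec[OF g'(1) subsetD[OF assms(2)], of "inner x x"] by (simp add: has_field_derivative_def)
    ultimately show "((\<lambda>x. g (inner x x)) has_derivative
        (\<lambda>v. g' (inner x x) * (inner x v + inner v x))) (at x)"
      by (rule has_derivative_compose)
  next
    fix v :: 'a
    have "Ck k (\<lambda>x. g' (inner x x) * (inner x v + inner x v))"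
      by (rule Ck_mult[OF Suc.IH[OF g'(2)] Ck_add[OF Ck_inner Ck_inner]])
    then show "Ck k (\<lambda>x. g' (inner x x) * (inner x v + inner v x))"
      by (simp add: inner_commute[of v])
  qed
qed

lemma test_rad_profile:
  fixes g :: "real \<Rightarrow> real"
  assumes g: "\<And>k. Ck_on k A g" "{0..} \<subseteq> A"
    and r: "0 < r" "r < R" "\<And>t. r\<^sup>2 < t \<Longrightarrow> g t = 0"
  shows "(\<lambda>x::'a::euclidean_space. g (inner x x)) \<in> test_rad R"
proof -
  let ?f = "\<lambda>x::'a. g (inner x x)"
  have "{x. ?f x \<noteq> 0} \<subseteq> cball 0 r"
  proof clarify
    fix x assume "?f x \<noteq> 0"
    then have "\<not> r\<^sup>2 < inner x x"
      using r(3)[of "inner x x"] by blast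
    then have "(norm x)\<^sup>2 \<le> r\<^sup>2"
      unfolding power2_norm_eq_inner by simp
    then have "norm x \<le> r" using r(1) power2_le_imp_le by auto
    then show "x \<in> cball 0 r" by simp
  qed
  then have sub: "closure {x. ?f x \<noteq> 0} \<subseteq> cball 0 r"
    by (rule closure_minimal) simp
  then have "bounded (closure {x. ?f x \<noteq> 0})"
    using bounded_cball bounded_subset by blast
  then have "compact (closure {x. ?f x \<noteq> 0})"
    by (simp add: compact_eq_bounded_closed)
  moreover have "closure {x. ?f x \<noteq> 0} \<subseteq> ball 0 R"
    using sub r(2) by auto
  moreover have "?f x = ?f y" if "norm x = norm y" for x y
    using that unfolding dot_square_norm by simp
  ultimately show ?thesis
    unfolding test_rad_def mem_Collect_eq using Ck_radial_profile[OF g] by blast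
qed

lemma grad_eqI:
  assumes "(f has_derivative (\<lambda>h. inner h D)) (at x)"
  shows "grad f x = D"
  unfolding grad_def frechet_derivative_at[OF assms, symmetric]
  by (subst inner_commute) (rule euclidean_representation)

lemma Ck_1_continuous_grad:
  fixes f :: "'a::euclidean_space \<Rightarrow> real"
  assumes "Ck 1 f"
  shows "continuous_on UNIV (grad f)"
  unfolding grad_def[abs_def] using assms by (intro continuous_intros) (auto simp: numeral_eq_Suc)

section \<open>The lower bound\<close>

text \<open>Convexity of the $p$-th power with weights $1-l$ and $l$. For small $l$ the first coefficient is
  close to 1, which replaces the triangle inequality of the weighted $L^p$ norm.\<close>

lemma norm_add_powr_le:
  fixes a b :: "'a::real_normed_vector" and p l :: real
  assumes p: "1 < p" and l: "0 < l" "l < 1"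
  shows "norm (a + b) powr p \<le> (1 - l) powr (1 - p) * norm a powr p + l powr (1 - p) * norm b powr p"
proof -
  define t where "t = norm a + norm b"
  have t: "0 \<le> t" by (simp add: t_def)
  have "norm (a + b) powr p \<le> t powr p"
    using p by (intro powr_mono2) (auto simp: t_def norm_triangle_ineq)
  also have "\<dots> = p * t powr (p - 1) * t - (p - 1) * t powr p"
    using t by (cases "t = 0") (simp_all add: powr_diff algebra_simps)
  also have "\<dots> = (1 - l) * (p * t powr (p - 1) * (norm a / (1 - l)) - (p - 1) * t powr p) +
      l * (p * t powr (p - 1) * (norm b / l) - (p - 1) * t powr p)"
  proof -
    have "(1 - l) * (norm a / (1 - l)) = norm a" "l * (norm b / l) = norm b" using l by simp_all
    then have "(1 - l) * (p * t powr (p - 1) * (norm a / (1 - l))) = p * t powr (p - 1) * norm a"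
      "l * (p * t powr (p - 1) * (norm b / l)) = p * t powr (p - 1) * norm b"
      by (metis mult.left_commute)+
    then show ?thesis unfolding right_diff_distrib by (simp add: t_def algebra_simps)
  qed
  also have "\<dots> \<le> (1 - l) * \<bar>norm a / (1 - l)\<bar> powr p + l * \<bar>norm b / l\<bar> powr p"
    using l by (intro add_mono mult_left_mono Young_tangent p t) auto
  also have "\<dots> = (1 - l) powr (1 - p) * norm a powr p + l powr (1 - p) * norm b powr p"
    using l by (simp add: powr_divide powr_diff)
  finally show ?thesis .
qed

text \<open>The radial derivative is a component of the gradient, and it is the same in all
  directions.\<close>

lemma radial_derivative:
  fixes \<phi> :: "'a::euclidean_space \<Rightarrow> real"
  assumes radius: "\<And>x y. norm x = norm y \<Longrightarrow> \<phi> x = \<phi> y"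
    and diff: "\<And>x. \<phi> differentiable (at x)" and e: "norm e = 1" and x: "x \<noteq> 0"
  shows "\<bar>frechet_derivative \<phi> (at (norm x *\<^sub>R e)) e\<bar> \<le> norm (grad \<phi> x)"
proof -
  have D: "((\<lambda>r. \<phi> (r *\<^sub>R w)) has_real_derivative frechet_derivative \<phi> (at (r *\<^sub>R w)) w) (at r)" for r w
  proof -
    have "(\<phi> has_derivative frechet_derivative \<phi> (at (r *\<^sub>R w))) (at (r *\<^sub>R w))"
      using diff by (simp add: frechet_derivative_works[symmetric])
    note d = this
    have "((\<lambda>r. r *\<^sub>R w) has_derivative (\<lambda>h. h *\<^sub>R w)) (at r)"
      by (auto intro!: derivative_eq_intros)
    from has_derivative_compose[OF this d]
    have "((\<lambda>r. \<phi> (r *\<^sub>R w)) has_derivative (\<lambda>h. frechet_derivative \<phi> (at (r *\<^sub>R w)) (h *\<^sub>R w))) (at r)" .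
    then show ?thesis unfolding has_field_derivative_def
      by (rule has_derivative_eq_rhs) (simp add: fun_eq_iff linear_cmul[OF has_derivative_linear[OF d]])
  qed
  have "(\<lambda>r. \<phi> (r *\<^sub>R e)) = (\<lambda>r. \<phi> (r *\<^sub>R sgn x))"
    by (intro ext radius) (use e x in \<open>simp add: norm_sgn\<close>)
  then have "frechet_derivative \<phi> (at (norm x *\<^sub>R e)) e = frechet_derivative \<phi> (at (norm x *\<^sub>R sgn x)) (sgn x)"
    using D[of e "norm x"] D[of "sgn x" "norm x"] by (metis DERIV_unique)
  also have "norm x *\<^sub>R sgn x = x" using x by (simp add: sgn_div_norm)
  also have "frechet_derivative \<phi> (at x) (sgn x) = inner (sgn x) (grad \<phi> x)"
    using GDERIV_grad[OF diff[of x]] unfolding gderiv_def by (metis frechet_derivative_at)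
  finally show ?thesis
    using Cauchy_Schwarz_ineq2[of "sgn x" "grad \<phi> x"] x by (simp add: norm_sgn)
qed

context radial_weights
begin

definition sharp_constant :: real where
  "sharp_constant = energy_factor * constraint_factor powr (- (p / q)) * Bliss_const p q"

lemma Bliss_const_pos: "0 < Bliss_const p q"
proof -
  have "0 < Beta (q * (p - 1) / (q - p)) (q / (q - p))" using p pq by (intro Beta_pos) auto
  then show ?thesis using p pq by (simp add: Bliss_const_def)
qed

lemma weight_nonneg: "0 \<le> norm x powr a * (1 - (norm x / R) powr \<gamma>) powr b"
  by simp

text \<open>In the coordinate $s$ this is the inequality of Bliss. The number $\delta$ stands for any value
  below the constraint integral, so that a compact interval of the half-line already
  carries more than $\delta$.\<close>

lemma energy_test_ge:
  fixes \<phi> :: "'a::euclidean_space \<Rightarrow> real"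
  assumes n: "N = real DIM('a)" and \<phi>: "\<phi> \<in> test_rad R"
    and \<delta>: "0 \<le> \<delta>" "ennreal \<delta> < constraint p q \<alpha> \<beta> \<gamma> R \<phi>"
  shows "ennreal (sharp_constant * \<delta> powr (p / q)) \<le> energy p \<alpha> \<beta> \<gamma> R (grad \<phi>)"
proof -
  have Ck: "Ck k \<phi>" for k using \<phi> unfolding test_rad_def by blast
  have radial: "\<phi> x = \<phi> y" if "norm x = norm y" for x y
    using \<phi> that unfolding test_rad_def by blast
  have diff: "\<phi> differentiable at x" for x using Ck[of 1] by simp
  have D_cont: "continuous_on UNIV (\<lambda>x. frechet_derivative \<phi> (at x) v)" for v using Ck[of 1] by simp
  have \<phi>_cont: "continuous_on UNIV \<phi>" using Ck[of 0] by simp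
  obtain e :: 'a where "e \<in> Basis" using nonempty_Basis by blast
  then have e: "norm e = 1" by simp
  define v where "v = (\<lambda>s. \<phi> (radius s *\<^sub>R e))"
  define D where "D = (\<lambda>s. frechet_derivative \<phi> (at (radius s *\<^sub>R e)) e)"
  define v' where "v' = (\<lambda>s. D s * (- radius_speed s))"
  have \<phi>_meas: "\<phi> \<in> borel_measurable borel" and D_meas: "(\<lambda>x. frechet_derivative \<phi> (at x) e) \<in> borel_measurable borel"
    using \<phi>_cont D_cont by (auto intro: borel_measurable_continuous_onI)
  have v_meas[measurable]: "v \<in> borel_measurable borel" 
    unfolding v_def by (rule measurable_compose[OF _ \<phi>_meas]) measurable
  have D_meas'[measurable]: "D \<in> borel_measurable borel"
    unfolding D_def by (rule measurable_compose[OF _ D_meas]) measurable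
  have v'_meas[measurable]: "v' \<in> borel_measurable borel"
    unfolding v'_def by measurable
  have v_der: "(v has_real_derivative v' s) (at s)" if s: "0 < s" for s
  proof -
    have d: "(\<phi> has_derivative frechet_derivative \<phi> (at (radius s *\<^sub>R e))) (at (radius s *\<^sub>R e))"
      using diff by (simp add: frechet_derivative_works[symmetric])
    have "((\<lambda>s. radius s *\<^sub>R e) has_derivative (\<lambda>h. (- radius_speed s * h) *\<^sub>R e)) (at s)"
      using DERIV_radius[OF s] by (auto simp: has_field_derivative_def intro!: derivative_eq_intros)
    from has_derivative_compose[OF this d] show ?thesis
      unfolding has_field_derivative_def v_def
      by (rule has_derivative_eq_rhs)
        (simp add: fun_eq_iff v'_def D_def linear_cmul[OF has_derivative_linear[OF d]]
          linear_neg[OF has_derivative_linear[OF d]])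
  qed
  have rad_cont: "continuous_on {0<..} radius"
    using DERIV_radius by (meson DERIV_isCont continuous_at_imp_continuous_on greaterThan_iff)
  have v'_cont: "continuous_on {0<..} v'"
  proof -
    have "continuous_on {0<..} (\<lambda>s. radius s *\<^sub>R e)" by (intro continuous_intros rad_cont)
    then have "continuous_on {0<..} D"
      unfolding D_def by (rule continuous_on_compose2[OF D_cont]) auto
    moreover have "continuous_on {0<..} radius_speed"
      using isCont_radius_speed by (intro continuous_at_imp_continuous_on) auto
    ultimately show ?thesis unfolding v'_def by (intro continuous_intros)
  qed
  obtain r\<^sub>0 where r0: "r\<^sub>0 < R" "\<And>x. r\<^sub>0 < norm x \<Longrightarrow> \<phi> x = 0"
  proof -
    let ?K = "closure {x. \<phi> x \<noteq> 0}"
    have K: "compact ?K" "?K \<subseteq> ball 0 R" using \<phi> unfolding test_rad_def by blast+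
    show thesis
    proof (cases "?K = {}")
      case True
      then show ?thesis using that[of 0] R closure_subset[of "{x. \<phi> x \<noteq> 0}"] by auto
    next
      case False
      then obtain x where x: "x \<in> ?K" "\<And>y. y \<in> ?K \<Longrightarrow> norm y \<le> norm x"
        using continuous_attains_sup[OF K(1) False, of norm] continuous_on_norm_id by blast
      have "\<phi> y = 0" if "norm x < norm y" for y
        using x(2)[of y] that closure_subset[of "{x. \<phi> x \<noteq> 0}"] by force
      moreover have "norm x < R" using x(1) K(2) by auto
      ultimately show ?thesis using that by blast
    qed
  qed
  \<comment> \<open>The support stays away from the sphere, that is, from \<open>s = 0\<close>.\<close>
  obtain s\<^sub>0 where s0: "0 < s\<^sub>0" "\<And>s. 0 < s \<Longrightarrow> s \<le> s\<^sub>0 \<Longrightarrow> v s = 0"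
  proof -
    have "eventually (\<lambda>s. r\<^sub>0 < radius s) (at_right 0)"
      using order_tendstoD(1)[OF radius_at_0 r0(1)] .
    then obtain b where b: "b > 0" "\<And>s. 0 < s \<Longrightarrow> s < b \<Longrightarrow> r\<^sub>0 < radius s"
      by (auto simp: eventually_at_right_field)
    have "v s = 0" if "0 < s" "s \<le> b / 2" for s
      using b(2)[of s] b(1) that radius_bounds[of s] e unfolding v_def by (intro r0(2)) auto
    then show thesis using that[of "b / 2"] b(1) by auto
  qed
  define f where "f = (\<lambda>s. \<bar>v s\<bar> powr q * s powr (- 1 - q * (p - 1) / p))"
  have f_meas[measurable]: "f \<in> borel_measurable borel" unfolding f_def by measurable
  have "constraint p q \<alpha> \<beta> \<gamma> R \<phi> = ennreal constraint_factor * (\<integral>\<^sup>+ s. ennreal (f s) * indicator {0<..} s \<partial>lborel)"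
    unfolding f_def
  proof (rule radial_constraint[OF n v_meas])
    fix x :: 'a assume x: "x \<noteq> 0" "norm x < R"
    show "\<phi> x = v (coord (norm x))"
      unfolding v_def using x e by (intro radial) (simp add: radius_coord)
  qed
  also have "(\<integral>\<^sup>+ s. ennreal (f s) * indicator {0<..} s \<partial>lborel) =
      (\<integral>\<^sup>+ s. (SUP k. ennreal (f s) * indicator {s\<^sub>0..s\<^sub>0 + 1 + real k} s) \<partial>lborel)"
  proof (intro nn_integral_cong)
    fix s :: real
    show "ennreal (f s) * indicator {0<..} s = (SUP k. ennreal (f s) * indicator {s\<^sub>0..s\<^sub>0 + 1 + real k} s)"
    proof (cases "s\<^sub>0 \<le> s")
      case True
      obtain k where "s \<le> real k" using real_arch_simple by blast
      then have "indicator {s\<^sub>0..s\<^sub>0 + 1 + real k} s = (1::ennreal)" using True s0(1) by simp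
      then have "ennreal (f s) \<le> (SUP k. ennreal (f s) * indicator {s\<^sub>0..s\<^sub>0 + 1 + real k} s)"
        by (intro SUP_upper2[of k]) auto
      moreover have "(SUP k. ennreal (f s) * indicator {s\<^sub>0..s\<^sub>0 + 1 + real k} s) \<le> ennreal (f s)"
        by (intro SUP_least) (auto simp: indicator_def)
      ultimately show ?thesis using True s0(1) by (simp add: antisym)
    next
      case False
      then show ?thesis using s0(2)[of s] pq p by (cases "0 < s") (simp_all add: f_def)
    qed
  qed
  also have "\<dots> = (SUP k. \<integral>\<^sup>+ s. ennreal (f s) * indicator {s\<^sub>0..s\<^sub>0 + 1 + real k} s \<partial>lborel)"
    by (rule nn_integral_monotone_convergence_SUP)
      (auto simp: incseq_def le_fun_def indicator_def)
  finally have "ennreal \<delta> < (SUP k. ennreal constraint_factor * (\<integral>\<^sup>+ s. ennreal (f s) * indicator {s\<^sub>0..s\<^sub>0 + 1 + real k} s \<partial>lborel))"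
    using \<delta>(2) by (simp add: SUP_mult_left_ennreal)
  then obtain k where k: "ennreal \<delta> < ennreal constraint_factor *
      (\<integral>\<^sup>+ s. ennreal (f s) * indicator {s\<^sub>0..s\<^sub>0 + 1 + real k} s \<partial>lborel)"
    by (auto simp: less_SUP_iff)
  define S where "S = s\<^sub>0 + 1 + real k"
  have S: "s\<^sub>0 < S" by (simp add: S_def)
  define I where "I = integral {s\<^sub>0..S} f"
  define J where "J = integral {s\<^sub>0..S} (\<lambda>s. \<bar>v' s\<bar> powr p)"
  have v_cont: "continuous_on {s\<^sub>0..S} v"
    using s0(1) by (intro continuous_at_imp_continuous_on ballI DERIV_isCont[OF v_der]) auto
  have v'_cont': "continuous_on {s\<^sub>0..S} v'"
    by (rule continuous_on_subset[OF v'_cont]) (use s0(1) in auto)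
  have "f integrable_on {s\<^sub>0..S}"
    unfolding f_def using v_cont p pq s0(1)
    by (intro integrable_continuous_real continuous_intros continuous_on_powr') auto
  then have fI: "(f has_integral I) {s\<^sub>0..S}" by (simp add: I_def integrable_integral)
  have "(\<lambda>s. \<bar>v' s\<bar> powr p) integrable_on {s\<^sub>0..S}"
    using v'_cont' p by (intro integrable_continuous_real continuous_intros continuous_on_powr') auto
  then have vJ: "((\<lambda>s. \<bar>v' s\<bar> powr p) has_integral J) {s\<^sub>0..S}" by (simp add: J_def integrable_integral)
  have I0: "0 \<le> I" by (rule has_integral_nonneg[OF fI]) (simp add: f_def)
  have J0: "0 \<le> J" by (rule has_integral_nonneg[OF vJ]) simp
  have "(\<integral>\<^sup>+ s. ennreal (f s) * indicator {s\<^sub>0..S} s \<partial>lborel) = ennreal I"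
    using nn_integral_has_integral_lebesgue[OF _ fI] 
    by (simp add: f_def ennreal_mult'' ennreal_indicator mult.commute)
  then have "ennreal \<delta> < ennreal (constraint_factor * I)"
    using k factors_pos I0 by (simp add: S_def ennreal_mult')
  then have \<delta>I: "\<delta> / constraint_factor \<le> I"
    using factors_pos I0 \<delta>(1) by (simp add: ennreal_less_iff field_simps)
  have "Bliss_const p q * I powr (p / q) \<le> J"
    unfolding I_def J_def f_def
    by (rule Bliss_inequality[OF p pq s0(1) S _ v'_cont'])
      (use v_der s0 in auto)
  moreover have "(\<delta> / constraint_factor) powr (p / q) \<le> I powr (p / q)"
    using \<delta>I \<delta>(1) factors_pos p pq by (intro powr_mono2) auto
  ultimately have "Bliss_const p q * (\<delta> / constraint_factor) powr (p / q) \<le> J"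
    using Bliss_const_pos by (smt (verit) mult_left_mono)
  then have "energy_factor * (Bliss_const p q * (\<delta> / constraint_factor) powr (p / q)) \<le> energy_factor * J"
    using factors_pos by (intro mult_left_mono) auto
  also have "energy_factor * (Bliss_const p q * (\<delta> / constraint_factor) powr (p / q)) = sharp_constant * \<delta> powr (p / q)"
    using \<delta>(1) factors_pos by (simp add: sharp_constant_def powr_divide powr_minus_divide)
  finally have "ennreal (sharp_constant * \<delta> powr (p / q)) \<le> ennreal energy_factor * ennreal J"
    using factors_pos by (simp add: ennreal_mult'[symmetric] ennreal_leI)
  also have "ennreal J = (\<integral>\<^sup>+ s. ennreal (\<bar>v' s\<bar> powr p) * indicator {s\<^sub>0..S} s \<partial>lborel)"
    using nn_integral_has_integral_lebesgue[OF _ vJ]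
    by (simp add: ennreal_mult'' ennreal_indicator mult.commute)
  also have "\<dots> \<le> (\<integral>\<^sup>+ s. ennreal (\<bar>v' s\<bar> powr p) * indicator {0<..} s \<partial>lborel)"
    using s0(1) by (intro nn_integral_mono) (auto simp: indicator_def)
  also have "ennreal energy_factor * (\<integral>\<^sup>+ s. ennreal (\<bar>v' s\<bar> powr p) * indicator {0<..} s \<partial>lborel) =
      (\<integral>\<^sup>+ x. ennreal ((\<bar>v' (coord (norm x))\<bar> / radius_speed (coord (norm x))) powr p /
        (norm x powr (\<alpha> - p) * (1 - (norm x / R) powr \<gamma>) powr (\<beta> - p)))
      \<partial>lebesgue_on (ball (0::'a::euclidean_space) R))"
    by (rule radial_energy[OF n, symmetric]) auto
  also have "\<dots> \<le> energy p \<alpha> \<beta> \<gamma> R (grad \<phi>)"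
    unfolding energy_def
  proof (intro nn_integral_mono_AE)
    show "AE x in lebesgue_on (ball 0 R).
        ennreal ((\<bar>v' (coord (norm x))\<bar> / radius_speed (coord (norm x))) powr p /
          (norm x powr (\<alpha> - p) * (1 - (norm x / R) powr \<gamma>) powr (\<beta> - p)))
        \<le> ennreal (norm (grad \<phi> x) powr p /
          (norm x powr (\<alpha> - p) * (1 - (norm x / R) powr \<gamma>) powr (\<beta> - p)))"
      using AE_punctured_ball
    proof eventually_elim
      case (elim x)
      have "0 < radius_speed (coord (norm x))" using elim by (intro radius_speed_pos coord_pos) auto
      then have "\<bar>v' (coord (norm x))\<bar> / radius_speed (coord (norm x)) = \<bar>frechet_derivative \<phi> (at (norm x *\<^sub>R e)) e\<bar>"
        using elim by (simp add: v'_def D_def radius_coord abs_mult)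
      also have "\<dots> \<le> norm (grad \<phi> x)"
        using radial_derivative[OF radial diff e] elim by blast
      finally show ?case
        using p weight_nonneg \<open>0 < radius_speed (coord (norm x))\<close> by (intro ennreal_leI divide_right_mono powr_mono2) auto
    qed
  qed
  finally show ?thesis by (simp add: mult_left_mono)
qed

lemma energy_triangle:
  fixes g h :: "'a::euclidean_space \<Rightarrow> 'a"
  assumes [measurable]: "g \<in> borel_measurable (lebesgue_on (ball 0 R))"
      "h \<in> borel_measurable (lebesgue_on (ball 0 R))"
    and l: "0 < l" "l < 1"
  shows "energy p \<alpha> \<beta> \<gamma> R h \<le> ennreal ((1 - l) powr (1 - p)) * energy p \<alpha> \<beta> \<gamma> R g +
    ennreal (l powr (1 - p)) * energy p \<alpha> \<beta> \<gamma> R (\<lambda>x. h x - g x)"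
proof -
  define W where "W = (\<lambda>x::'a. norm x powr (\<alpha> - p) * (1 - (norm x / R) powr \<gamma>) powr (\<beta> - p))"
  have [measurable]: "W \<in> borel_measurable (lebesgue_on (ball 0 R))"
    unfolding W_def by (intro measurable_restrict_space1 measurable_completion) measurable
  have en: "energy p \<alpha> \<beta> \<gamma> R v = (\<integral>\<^sup>+ x. ennreal (norm (v x) powr p / W x) \<partial>lebesgue_on (ball 0 R))"
    for v :: "'a \<Rightarrow> 'a" by (simp add: energy_def W_def)
  have "energy p \<alpha> \<beta> \<gamma> R h \<le> (\<integral>\<^sup>+ x. ennreal ((1 - l) powr (1 - p)) * ennreal (norm (g x) powr p / W x) +
      ennreal (l powr (1 - p)) * ennreal (norm (h x - g x) powr p / W x) \<partial>lebesgue_on (ball 0 R))"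
    unfolding en
  proof (intro nn_integral_mono)
    fix x :: 'a
    have W0: "0 \<le> W x" by (simp add: W_def)
    have *: "ennreal (A * X + B * Y) = ennreal A * ennreal X + ennreal B * ennreal Y"
      if "0 \<le> A" "0 \<le> X" "0 \<le> B" "0 \<le> Y" for A X B Y
      using that by (simp add: ennreal_mult)
    have "norm (h x) powr p / W x \<le>
        ((1 - l) powr (1 - p) * norm (g x) powr p + l powr (1 - p) * norm (h x - g x) powr p) / W x"
      using norm_add_powr_le[OF p l, of "g x" "h x - g x"] W0 by (intro divide_right_mono) auto
    also have "\<dots> = (1 - l) powr (1 - p) * (norm (g x) powr p / W x) +
        l powr (1 - p) * (norm (h x - g x) powr p / W x)"
      by (simp add: add_divide_distrib)
    finally have "ennreal (norm (h x) powr p / W x) \<le> ennreal ((1 - l) powr (1 - p) * (norm (g x) powr p / W x) +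
        l powr (1 - p) * (norm (h x - g x) powr p / W x))"
      by (rule ennreal_leI)
    then show "ennreal (norm (h x) powr p / W x) \<le> ennreal ((1 - l) powr (1 - p)) * ennreal (norm (g x) powr p / W x) +
      ennreal (l powr (1 - p)) * ennreal (norm (h x - g x) powr p / W x)"
      using W0 by (simp only: *[OF powr_ge_zero _ powr_ge_zero] divide_nonneg_nonneg powr_ge_zero)
  qed
  also have "\<dots> = ennreal ((1 - l) powr (1 - p)) * energy p \<alpha> \<beta> \<gamma> R g +
    ennreal (l powr (1 - p)) * energy p \<alpha> \<beta> \<gamma> R (\<lambda>x. h x - g x)"
    unfolding en by (simp add: nn_integral_add nn_integral_cmult)
  finally show ?thesis .
qed

text \<open>Almost everywhere convergence gives lower semicontinuity, and this is the direction that the lower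
  bound uses: the approximating functions asymptotically have at least the mass of the limit.\<close>

lemma constraint_Fatou:
  fixes u :: "'a::euclidean_space \<Rightarrow> real"
  assumes [measurable]: "\<And>n. \<phi> n \<in> borel_measurable (lebesgue_on (ball 0 R))"
    and lim: "AE x in lebesgue_on (ball 0 R). (\<lambda>n. \<phi> n x) \<longlonglongrightarrow> u x"
  shows "constraint p q \<alpha> \<beta> \<gamma> R u \<le> liminf (\<lambda>n. constraint p q \<alpha> \<beta> \<gamma> R (\<phi> n))"
proof -
  define W where "W = (\<lambda>x::'a. norm x powr (real DIM('a) - q / p * (real DIM('a) - \<alpha>)) *
         (1 - (norm x / R) powr \<gamma>) powr (1 + (\<beta> - 1) / p * q))"
  have [measurable]: "W \<in> borel_measurable (lebesgue_on (ball 0 R))"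
    unfolding W_def by (intro measurable_restrict_space1 measurable_completion) measurable
  have con: "constraint p q \<alpha> \<beta> \<gamma> R v = (\<integral>\<^sup>+ x. ennreal (\<bar>v x\<bar> powr q / W x) \<partial>lebesgue_on (ball 0 R))"
    for v by (simp add: constraint_def W_def)
  have "constraint p q \<alpha> \<beta> \<gamma> R u =
      (\<integral>\<^sup>+ x. liminf (\<lambda>n. ennreal (\<bar>\<phi> n x\<bar> powr q / W x)) \<partial>lebesgue_on (ball 0 R))"
    unfolding con
  proof (rule nn_integral_cong_AE)
    show "AE x in lebesgue_on (ball 0 R).
        ennreal (\<bar>u x\<bar> powr q / W x) = liminf (\<lambda>n. ennreal (\<bar>\<phi> n x\<bar> powr q / W x))"
      using lim
    proof eventually_elim
      case (elim x)
      have "(\<lambda>n. \<bar>\<phi> n x\<bar> powr q * inverse (W x)) \<longlonglongrightarrow> \<bar>u x\<bar> powr q * inverse (W x)"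
        using p pq by (intro tendsto_intros tendsto_powr2 elim) auto
      then have "(\<lambda>n. ennreal (\<bar>\<phi> n x\<bar> powr q / W x)) \<longlonglongrightarrow> ennreal (\<bar>u x\<bar> powr q / W x)"
        unfolding divide_inverse by (rule tendsto_ennrealI)
      then show ?case by (intro lim_imp_Liminf[symmetric]) auto
    qed
  qed
  also have "\<dots> \<le> liminf (\<lambda>n. constraint p q \<alpha> \<beta> \<gamma> R (\<phi> n))"
    unfolding con by (rule nn_integral_liminf) simp
  finally show ?thesis .
qed

lemma test_rad_measurable:
  fixes \<phi> :: "'a::euclidean_space \<Rightarrow> real"
  assumes "\<phi> \<in> test_rad R"
  shows "\<phi> \<in> borel_measurable (lebesgue_on (ball 0 R))"
    "grad \<phi> \<in> borel_measurable (lebesgue_on (ball 0 R))"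
proof -
  have Ck: "Ck k \<phi>" for k using assms unfolding test_rad_def by blast
  have "continuous_on UNIV \<phi>" "continuous_on UNIV (grad \<phi>)"
    using Ck[of 0] Ck_1_continuous_grad[OF Ck] by simp_all
  then have [measurable]: "\<phi> \<in> borel_measurable borel" "grad \<phi> \<in> borel_measurable borel"
    by (auto intro: borel_measurable_continuous_onI)
  show "\<phi> \<in> borel_measurable (lebesgue_on (ball 0 R))"
    "grad \<phi> \<in> borel_measurable (lebesgue_on (ball 0 R))"
    by (intro measurable_restrict_space1 measurable_completion; measurable)+
qed

lemma X_rad_energy_ge:
  fixes u :: "'a::euclidean_space \<Rightarrow> real"
  assumes n: "N = real DIM('a)" and X: "X_rad_grad p \<alpha> \<beta> \<gamma> R u g"
    and u: "constraint p q \<alpha> \<beta> \<gamma> R u = 1"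
  shows "ennreal sharp_constant \<le> energy p \<alpha> \<beta> \<gamma> R g"
proof (cases "energy p \<alpha> \<beta> \<gamma> R g")
  case (real G)
  from X obtain \<phi> where g: "g \<in> borel_measurable (lebesgue_on (ball 0 R))"
    and \<phi>: "\<And>n. \<phi> n \<in> test_rad R"
    and lim: "(\<lambda>n. energy p \<alpha> \<beta> \<gamma> R (\<lambda>x. grad (\<phi> n) x - g x)) \<longlonglongrightarrow> 0"
    and ae: "AE x in lebesgue_on (ball 0 R). (\<lambda>n. \<phi> n x) \<longlonglongrightarrow> u x"
    unfolding X_rad_grad_def by blast
  \<comment> \<open>The parameter \<open>l\<close> bounds the mass lost in the limit and is also the weight in the convexity inequality.\<close>
  have key: "sharp_constant * (1 - l) powr (p / q) \<le> (1 - l) powr (1 - p) * G" if l: "0 < l" "l < 1" for l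
  proof -
    let ?A = "ennreal ((1 - l) powr (1 - p))" and ?B = "ennreal (l powr (1 - p))"
    have "ennreal (1 - l) < constraint p q \<alpha> \<beta> \<gamma> R u"
      unfolding u using l by (simp add: ennreal_less_one_iff)
    also have "\<dots> \<le> liminf (\<lambda>n. constraint p q \<alpha> \<beta> \<gamma> R (\<phi> n))"
      by (rule constraint_Fatou[OF test_rad_measurable(1)[OF \<phi>] ae])
    finally have "eventually (\<lambda>n. ennreal (1 - l) < constraint p q \<alpha> \<beta> \<gamma> R (\<phi> n)) sequentially"
      by (rule less_LiminfD)
    then have ev: "eventually (\<lambda>n. ennreal (sharp_constant * (1 - l) powr (p / q)) \<le>
        ?A * ennreal G + ?B * energy p \<alpha> \<beta> \<gamma> R (\<lambda>x. grad (\<phi> n) x - g x)) sequentially"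
    proof eventually_elim
      case (elim k)
      have "ennreal (sharp_constant * (1 - l) powr (p / q)) \<le> energy p \<alpha> \<beta> \<gamma> R (grad (\<phi> k))"
        using l by (intro energy_test_ge[OF n \<phi> _ elim]) auto
      also have "\<dots> \<le> ?A * energy p \<alpha> \<beta> \<gamma> R g + ?B * energy p \<alpha> \<beta> \<gamma> R (\<lambda>x. grad (\<phi> k) x - g x)"
        by (rule energy_triangle[OF g test_rad_measurable(2)[OF \<phi>] l])
      finally show ?case by (simp add: real)
    qed
    have "(\<lambda>n. ?A * ennreal G + ?B * energy p \<alpha> \<beta> \<gamma> R (\<lambda>x. grad (\<phi> n) x - g x))
        \<longlonglongrightarrow> ?A * ennreal G + ?B * 0"
      by (intro tendsto_add tendsto_const ennreal_tendsto_cmult lim) auto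
    from tendsto_lowerbound[OF this ev] have "ennreal (sharp_constant * (1 - l) powr (p / q)) \<le> ?A * ennreal G"
      by simp
    then show ?thesis
      using real by (simp add: ennreal_mult'[symmetric] ennreal_le_iff)
  qed
  have "((\<lambda>l. sharp_constant * (1 - l) powr (p / q)) \<longlongrightarrow> sharp_constant * (1 - 0) powr (p / q)) (at_right 0)"
    "((\<lambda>l. (1 - l) powr (1 - p) * G) \<longlongrightarrow> (1 - 0) powr (1 - p) * G) (at_right 0)"
    by (intro tendsto_intros; simp)+
  moreover have "eventually (\<lambda>l::real. 0 < l \<and> l < 1) (at_right 0)"
    by (auto simp: eventually_at_right_field intro!: exI[of _ 1])
  then have "eventually (\<lambda>l. sharp_constant * (1 - l) powr (p / q) \<le> (1 - l) powr (1 - p) * G) (at_right 0)"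
    by eventually_elim (use key in auto)
  ultimately have "sharp_constant * (1 - 0) powr (p / q) \<le> (1 - 0) powr (1 - p) * G"
    by (intro tendsto_le[OF trivial_limit_at_right_real]) auto
  then show ?thesis using real by (simp add: ennreal_leI)
qed simp

end

section \<open>Radial test functions with a prescribed profile\<close>

context radial_weights
begin

text \<open>The coordinate is a composition of powers, hence differentiable, and its derivative is read off
  from \<open>radius (coord r) = r\<close>.\<close>

lemma DERIV_coord:
  assumes r: "0 < r" "r < R"
  shows "(coord has_real_derivative - 1 / radius_speed (coord r)) (at r)"
proof -
  have base: "0 < (r / R) powr (- \<gamma>) - 1" using coord_base[OF r] by simp
  have "((\<lambda>r. (r / R) powr (- \<gamma>) - 1) has_real_derivative - \<gamma> * (r / R) powr (- \<gamma> - 1) * (1 / R) - 0) (at r)"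
    using r R by (intro DERIV_diff DERIV_const DERIV_chain2[OF has_real_derivative_powr]) (auto intro!: derivative_eq_intros)
  from DERIV_chain2[OF has_real_derivative_powr[OF base] this]
  obtain D where D: "(coord has_real_derivative D) (at r)"
    unfolding coord_def[abs_def] by blast
  have pos: "0 < radius_speed (coord r)" by (intro radius_speed_pos coord_pos r)
  have "((\<lambda>r. radius (coord r)) has_real_derivative - radius_speed (coord r) * D) (at r)"
    by (rule DERIV_chain2[OF DERIV_radius D]) (rule coord_pos[OF r])
  moreover have "((\<lambda>r. radius (coord r)) has_real_derivative 1) (at r)"
    by (rule has_field_derivative_transform_within_open[OF DERIV_ident, of "{0<..<R}"])
      (use r radius_coord in auto)
  ultimately have "- radius_speed (coord r) * D = 1" by (rule DERIV_unique)
  then have "D = - 1 / radius_speed (coord r)" using pos by (simp add: field_simps)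
  with D show ?thesis by simp
qed

lemma Ck_on_coord_sqrt: "Ck_on k {0<..<R\<^sup>2} (\<lambda>\<tau>. coord (sqrt \<tau>))"
proof -
  have sq: "0 < sqrt \<tau>" "sqrt \<tau> < R" if "0 < \<tau>" "\<tau> < R\<^sup>2" for \<tau>
    using that R by (auto intro: real_less_lsqrt)
  have eq: "(sqrt \<tau> / R) powr (- \<gamma>) = R powr \<gamma> * \<tau> powr (- \<gamma> / 2) + 0" if "0 < \<tau>" for \<tau>
  proof -
    have "(sqrt \<tau> / R) powr (- \<gamma>) = (\<tau> powr (1 / 2)) powr (- \<gamma>) / R powr (- \<gamma>)"
      using that R by (simp add: powr_divide powr_half_sqrt)
    also have "\<dots> = R powr \<gamma> * \<tau> powr (- \<gamma> / 2)"
    proof -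
      have 1: "u / inverse v = v * u" for u v :: real by (cases "v = 0") (simp_all add: divide_simps)
      have 2: "1 / 2 * - \<gamma> = - \<gamma> / 2" by simp
      show ?thesis unfolding powr_powr powr_minus[of R] 2 by (rule 1)
    qed
    finally show ?thesis by simp
  qed
  have pos: "0 < R powr \<gamma> * \<tau> powr (- \<gamma> / 2) + (- 1)" if "0 < \<tau>" "\<tau> < R\<^sup>2" for \<tau>
    using coord_base[OF sq[OF that]] eq[OF that(1)] by simp
  have 1: "Ck_on k {0<..<R\<^sup>2} (\<lambda>\<tau>. R powr \<gamma> * \<tau> powr (- \<gamma> / 2) + (- 1))"
    by (rule Ck_on_add[OF Ck_on_mult[OF Ck_on_const Ck_on_powr] Ck_on_const]) auto
  have 2: "Ck_on k {0<..} (\<lambda>x. x powr \<kappa>)"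
    by (rule Ck_on_powr) simp
  have 3: "Ck_on k {0<..<R\<^sup>2} (\<lambda>\<tau>. (R powr \<gamma> * \<tau> powr (- \<gamma> / 2) + (- 1)) powr \<kappa>)"
    by (rule Ck_on_compose[OF 2 1]) (use pos in auto)
  show ?thesis
    by (rule Ck_on_cong[OF _ _ 3]) (simp_all add: coord_def eq)
qed

text \<open>The radial function with profile $v$ in the coordinate $s$. The constant $c$ is the value of $v$
  near infinity, hence that of the function near the origin.\<close>

definition radial_lift :: "(real \<Rightarrow> real) \<Rightarrow> real \<Rightarrow> 'a::euclidean_space \<Rightarrow> real" where
  "radial_lift v c x = (if x = 0 then c else if norm x < R then v (coord (norm x)) else 0)"

text \<open>As a function of $|x|^2$ the lift is constant near 0, zero near $R^2$ and beyond, and smooth in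
  between; the three open sets cover the line.\<close>

lemma radial_lift_test_rad:
  assumes v: "\<And>k. Ck_on k {0<..} v"
    and s0: "0 < s\<^sub>0" "\<And>s. 0 < s \<Longrightarrow> s \<le> s\<^sub>0 \<Longrightarrow> v s = 0"
    and S: "0 < S" "\<And>s. S < s \<Longrightarrow> v s = c"
  shows "(radial_lift v c :: 'a::euclidean_space \<Rightarrow> real) \<in> test_rad R"
proof -
  define g where "g = (\<lambda>\<tau>. if \<tau> \<le> 0 then c else if \<tau> < R\<^sup>2 then v (coord (sqrt \<tau>)) else 0)"
  have sq: "0 < sqrt \<tau>" "sqrt \<tau> < R" if "0 < \<tau>" "\<tau> < R\<^sup>2" for \<tau>
    using that R by (auto intro: real_less_lsqrt)
  note rs = radius_bounds[OF s0(1)] and rS = radius_bounds[OF S(1)]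
  have sq_bounds: "0 < (radius S)\<^sup>2" "(radius s\<^sub>0)\<^sup>2 < R\<^sup>2"
    using rs rS by (auto intro: power_strict_mono)
  have zero: "g \<tau> = 0" if "(radius s\<^sub>0)\<^sup>2 < \<tau>" for \<tau>
  proof (cases "\<tau> < R\<^sup>2")
    case True
    have \<tau>: "0 < \<tau>" using that by (smt (verit) zero_le_power2)
    have "radius s\<^sub>0 < sqrt \<tau>" using that rs by (intro real_less_rsqrt) auto
    then have "\<not> s\<^sub>0 < coord (sqrt \<tau>)"
      using less_coord_iff[OF sq[OF \<tau> True] s0(1)] by simp
    then show ?thesis using \<tau> True s0(2)[of "coord (sqrt \<tau>)"] coord_pos[OF sq[OF \<tau> True]] by (simp add: g_def)
  next
    case False
    then show ?thesis using that by (smt (verit) g_def zero_le_power2)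
  qed
  have const: "g \<tau> = c" if "\<tau> < (radius S)\<^sup>2" for \<tau>
  proof (cases "\<tau> \<le> 0")
    case False
    have \<tau>: "0 < \<tau>" "\<tau> < R\<^sup>2"
      using False that rS power_strict_mono[of "radius S" R 2] by auto
    have "sqrt \<tau> < radius S" using that rS by (intro real_less_lsqrt) auto
    then have "S < coord (sqrt \<tau>)" using less_coord_iff[OF sq[OF \<tau>] S(1)] by simp
    then show ?thesis using \<tau> S(2) by (simp add: g_def)
  qed (simp add: g_def)
  have smooth: "Ck_on k UNIV g" for k
  proof -
    have 1: "Ck_on k {..<(radius S)\<^sup>2} g"
      by (rule Ck_on_cong[OF _ _ Ck_on_const[of _ _ c]]) (use const in auto)
    have 2: "Ck_on k {(radius s\<^sub>0)\<^sup>2<..} g"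
      by (rule Ck_on_cong[OF _ _ Ck_on_const[of _ _ 0]]) (use zero in auto)
    have "Ck_on k {0<..<R\<^sup>2} (\<lambda>\<tau>. v (coord (sqrt \<tau>)))"
      by (rule Ck_on_compose[OF v Ck_on_coord_sqrt]) (use sq coord_pos in auto)
    then have 3: "Ck_on k {0<..<R\<^sup>2} g"
      by (rule Ck_on_cong[rotated 2]) (auto simp: g_def)
    have "Ck_on k (({..<(radius S)\<^sup>2} \<union> {(radius s\<^sub>0)\<^sup>2<..}) \<union> {0<..<R\<^sup>2}) g"
      by (intro Ck_on_Un 1 2 3) auto
    moreover have "({..<(radius S)\<^sup>2} \<union> {(radius s\<^sub>0)\<^sup>2<..}) \<union> {0<..<R\<^sup>2} = UNIV"
    proof -
      have "x < (radius S)\<^sup>2 \<or> (radius s\<^sub>0)\<^sup>2 < x \<or> 0 < x \<and> x < R\<^sup>2" for x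
        using sq_bounds by linarith
      then show ?thesis
        unfolding set_eq_iff Un_iff lessThan_iff greaterThan_iff greaterThanLessThan_iff by blast
    qed
    ultimately show ?thesis by (simp only:)
  qed
  have "(\<lambda>x::'a. g (inner x x)) \<in> test_rad R"
    using rs by (intro test_rad_profile[OF smooth subset_UNIV _ _ zero]) simp_all
  moreover have "(\<lambda>x::'a. g (inner x x)) = radial_lift v c"
  proof
    fix x :: 'a
    have 1: "inner x x < R\<^sup>2 \<longleftrightarrow> norm x < R"
      unfolding norm_lt_square using R by simp
    have 2: "sqrt (inner x x) = norm x" by (rule norm_eq_sqrt_inner[symmetric])
    have 3: "inner x x \<le> 0 \<longleftrightarrow> x = 0"
      unfolding not_less[symmetric] inner_gt_zero_iff by simp
    show "g (inner x x) = radial_lift v c x"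
      by (simp only: g_def radial_lift_def 1 2 3)
  qed
  ultimately show ?thesis by (simp only:)
qed

lemma grad_radial_lift:
  fixes x :: "'a::euclidean_space"
  assumes x: "x \<noteq> 0" "norm x < R" and v: "(v has_real_derivative d) (at (coord (norm x)))"
  shows "grad (radial_lift v c) x = (- d / radius_speed (coord (norm x))) *\<^sub>R sgn x"
proof (rule grad_eqI)
  have nx: "0 < norm x" using x by simp
  have 1: "(v has_derivative (*) d) (at (coord (norm x)))"
    using v by (simp add: has_field_derivative_def)
  have 2: "(coord has_derivative (*) (- 1 / radius_speed (coord (norm x)))) (at (norm x))"
    using DERIV_coord[OF nx x(2)] by (simp add: has_field_derivative_def)
  have 3: "(norm has_derivative (\<lambda>h. inner h (sgn x))) (at x)"
    using GDERIV_norm[OF x(1)] by (simp add: gderiv_def)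
  have "((\<lambda>y. v (coord (norm y))) has_derivative
      (\<lambda>h. d * (- 1 / radius_speed (coord (norm x)) * inner h (sgn x)))) (at x)"
    by (rule has_derivative_compose[OF has_derivative_compose[OF 3 2] 1])
  then have "(radial_lift v c has_derivative
      (\<lambda>h. d * (- 1 / radius_speed (coord (norm x)) * inner h (sgn x)))) (at x)"
  proof (rule has_derivative_transform_within_open)
    show "open (ball 0 R - {0::'a})" by (intro open_Diff) auto
    show "x \<in> ball 0 R - {0}" using x by simp
    show "v (coord (norm y)) = radial_lift v c y" if "y \<in> ball 0 R - {0}" for y
      using that by (simp add: radial_lift_def)
  qed
  then show "(radial_lift v c has_derivative
      (\<lambda>h. inner h ((- d / radius_speed (coord (norm x))) *\<^sub>R sgn x))) (at x)"
    by (rule has_derivative_eq_rhs) (simp add: fun_eq_iff)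
qed

end

section \<open>Truncation of the extremals\<close>

lemma flat_bounds: "0 \<le> flat x" "flat x \<le> 1"
  by (auto simp: flat_def)

lemma flat_nonpos: "x \<le> 0 \<Longrightarrow> flat x = 0"
  by (simp add: flat_def)

lemma flat_at_top: "(flat \<longlongrightarrow> 1) at_top"
proof -
  have "((\<lambda>x::real. exp (- inverse x)) \<longlongrightarrow> exp (- 0)) at_top"
    by (intro tendsto_intros tendsto_inverse_0_at_top filterlim_ident)
  then have "((\<lambda>x::real. exp (- inverse x)) \<longlongrightarrow> 1) at_top" by simp
  then show ?thesis
    by (rule Lim_transform_eventually)
      (use eventually_gt_at_top[of "0::real"] in \<open>auto elim!: eventually_mono simp: flat_def\<close>)
qed

lemma flat_measurable[measurable]: "flat \<in> borel_measurable borel"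
  by (rule borel_measurable_continuous_onI[OF Ck_on_imp_continuous[OF Ck_on_flat[of 0 UNIV]]])

text \<open>The first factor vanishes up to $1/(n+1)$, the second one from $n+1$ on.\<close>

definition cutoff :: "nat \<Rightarrow> real \<Rightarrow> real" where
  "cutoff n s = flat (real (Suc n) * s - 1) * flat (real (Suc n) - s)"

lemma cutoff_bounds: "0 \<le> cutoff n s" "cutoff n s \<le> 1"
  unfolding cutoff_def by (intro mult_nonneg_nonneg mult_le_one flat_bounds)+

lemma cutoff_measurable[measurable]: "cutoff n \<in> borel_measurable borel"
  unfolding cutoff_def[abs_def] by measurable

lemma Ck_on_cutoff: "Ck_on k A (cutoff n)"
proof -
  have 1: "Ck_on k A (\<lambda>s. real (Suc n) * s + (- 1))"
    by (rule Ck_on_add[OF Ck_on_mult[OF Ck_on_const Ck_on_ident] Ck_on_const])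
  have 2: "Ck_on k A (\<lambda>s. real (Suc n) + (- 1) * s)"
    by (rule Ck_on_add[OF Ck_on_const Ck_on_mult[OF Ck_on_const Ck_on_ident]])
  have "Ck_on k A (\<lambda>s. flat (real (Suc n) * s + (- 1)) * flat (real (Suc n) + (- 1) * s))"
    by (rule Ck_on_mult[OF Ck_on_compose[OF Ck_on_flat 1] Ck_on_compose[OF Ck_on_flat 2]])
      (rule UNIV_I)+
  then show ?thesis by (simp add: cutoff_def[abs_def])
qed

lemma cutoff_eq_0:
  "s \<le> 1 / real (Suc n) \<Longrightarrow> cutoff n s = 0" "real (Suc n) \<le> s \<Longrightarrow> cutoff n s = 0"
proof -
  assume "s \<le> 1 / real (Suc n)"
  then have "real (Suc n) * s - 1 \<le> 0"
    by (simp add: pos_le_divide_eq mult.commute del: of_nat_Suc)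
  then show "cutoff n s = 0" unfolding cutoff_def by (simp only: flat_nonpos mult_zero_left)
next
  assume "real (Suc n) \<le> s"
  then have "real (Suc n) - s \<le> 0" by simp
  then show "cutoff n s = 0" unfolding cutoff_def by (simp only: flat_nonpos mult_zero_right)
qed

lemma cutoff_tendsto_1:
  assumes "0 < s"
  shows "(\<lambda>n. cutoff n s) \<longlonglongrightarrow> 1"
proof -
  have n: "filterlim (\<lambda>n. real (Suc n)) at_top sequentially"
    by (rule filterlim_compose[OF filterlim_real_sequentially filterlim_Suc])
  have "filterlim (\<lambda>n. - 1 + real (Suc n) * s) at_top sequentially"
    by (intro filterlim_tendsto_add_at_top[OF tendsto_const] filterlim_at_top_mult_tendsto_pos[OF tendsto_const assms] n)
  moreover have "filterlim (\<lambda>n. - s + real (Suc n)) at_top sequentially"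
    by (intro filterlim_tendsto_add_at_top[OF tendsto_const] n)
  ultimately have "(\<lambda>n. flat (- 1 + real (Suc n) * s) * flat (- s + real (Suc n))) \<longlonglongrightarrow> 1 * 1"
    by (intro tendsto_mult filterlim_compose[OF flat_at_top])
  then show ?thesis by (simp add: cutoff_def algebra_simps)
qed

lemma Bliss_extremal_deriv_bounds:
  "0 < a \<Longrightarrow> 0 < b \<Longrightarrow> 0 \<le> Bliss_extremal_deriv r a b s"
  by (simp add: Bliss_extremal_deriv_def)

lemma Bliss_extremal_measurable[measurable]:
  "Bliss_extremal r a b \<in> borel_measurable borel" "Bliss_extremal_deriv r a b \<in> borel_measurable borel"
  unfolding Bliss_extremal_def[abs_def] Bliss_extremal_deriv_def[abs_def] by measurable

lemma continuous_on_Bliss_extremal: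
  assumes "0 < r" "0 < a" "0 < b"
  shows "continuous_on {0..} (Bliss_extremal r a b)" "continuous_on {0..} (Bliss_extremal_deriv r a b)"
proof -
  have base: "a * s powr r + b \<noteq> 0" for s
    using Bliss_base_pos[OF assms(2,3), of s r] by simp
  have "continuous_on {0..} (\<lambda>s::real. s powr r)"
    using assms(1) by (intro continuous_on_powr' continuous_on_id continuous_on_const) auto
  note 1 = continuous_on_add[OF continuous_on_mult[OF continuous_on_const[of _ a] this] continuous_on_const[of _ b]]
  have 2: "continuous_on {0..} (\<lambda>s. (a * s powr r + b) powr c)" for c
    by (rule continuous_on_powr[OF 1 continuous_on_const]) (use base in blast)
  show "continuous_on {0..} (Bliss_extremal r a b)" "continuous_on {0..} (Bliss_extremal_deriv r a b)"
    unfolding Bliss_extremal_def[abs_def] Bliss_extremal_deriv_def[abs_def]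
    by (rule continuous_on_mult[OF continuous_on_id 2] continuous_on_mult[OF continuous_on_const 2])+
qed

lemma Ck_on_Bliss_extremal_deriv:
  assumes "0 < a" "0 < b"
  shows "Ck_on k {0<..} (Bliss_extremal_deriv r a b)"
proof -
  have 0: "Ck_on k {0<..} (\<lambda>s. s powr r)" and 2: "Ck_on k {0<..} (\<lambda>x. x powr (- 1 / r - 1))"
    by (rule Ck_on_powr, simp)+
  have 1: "Ck_on k {0<..} (\<lambda>s. a * s powr r + b)"
    by (rule Ck_on_add[OF Ck_on_mult[OF Ck_on_const 0] Ck_on_const])
  have "Ck_on k {0<..} (\<lambda>s. b * (a * s powr r + b) powr (- 1 / r - 1))"
    by (rule Ck_on_mult[OF Ck_on_const Ck_on_compose[OF 2 1]]) (simp add: Bliss_base_pos[OF assms])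
  then show ?thesis by (simp only: Bliss_extremal_deriv_def[abs_def])
qed

definition truncated_deriv :: "real \<Rightarrow> real \<Rightarrow> real \<Rightarrow> nat \<Rightarrow> real \<Rightarrow> real" where
  "truncated_deriv r a b n s = cutoff n s * Bliss_extremal_deriv r a b s"

text \<open>Cutting off the derivative rather than the extremal itself leaves no error term with
  the derivative of the cutoff function, and it gives the constant behaviour near infinity that a
  test function has near the origin.\<close>

definition truncated_extremal :: "real \<Rightarrow> real \<Rightarrow> real \<Rightarrow> nat \<Rightarrow> real \<Rightarrow> real" where
  "truncated_extremal r a b n s = integral {0..s} (truncated_deriv r a b n)"

context
  fixes r a b :: real
  assumes r: "0 < r" and ab: "0 < a" "0 < b"
begin

lemma continuous_on_truncated_deriv: "continuous_on {0..} (truncated_deriv r a b n)"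
  unfolding truncated_deriv_def[abs_def]
  by (rule continuous_on_mult[OF Ck_on_imp_continuous[OF Ck_on_cutoff[of 0]] continuous_on_Bliss_extremal(2)[OF r ab]])

lemma integrable_truncated_deriv: "0 \<le> c \<Longrightarrow> truncated_deriv r a b n integrable_on {c..s}"
  by (rule integrable_continuous_real, rule continuous_on_subset[OF continuous_on_truncated_deriv]) auto

lemma DERIV_truncated_extremal:
  assumes "0 < s"
  shows "(truncated_extremal r a b n has_real_derivative truncated_deriv r a b n s) (at s)"
proof -
  have "continuous_on {0..s + 1} (truncated_deriv r a b n)"
    by (rule continuous_on_subset[OF continuous_on_truncated_deriv]) auto
  from integral_has_vector_derivative[OF this, of s] assms
  show ?thesis
    by (simp add: truncated_extremal_def[abs_def] has_real_derivative_iff_has_vector_derivative at_within_Icc_at)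
qed

lemma Ck_on_truncated_extremal: "Ck_on k {0<..} (truncated_extremal r a b n)"
proof -
  have "Ck_on k {0<..} (truncated_deriv r a b n)"
    unfolding truncated_deriv_def[abs_def]
    by (rule Ck_on_mult[OF Ck_on_cutoff Ck_on_Bliss_extremal_deriv[OF ab]])
  then have "Ck_on (Suc k) {0<..} (truncated_extremal r a b n)"
    by (rule Ck_on_SucI[rotated]) (simp add: DERIV_truncated_extremal)
  then show ?thesis by (rule Ck_on_SucD)
qed

lemma truncated_extremal_small: "s \<le> 1 / real (Suc n) \<Longrightarrow> truncated_extremal r a b n s = 0"
  unfolding truncated_extremal_def
  by (rule integral_unique, rule has_integral_is_0)
    (simp add: truncated_deriv_def cutoff_eq_0(1) del: of_nat_Suc)

lemma truncated_extremal_large: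
  assumes "real (Suc n) \<le> s"
  shows "truncated_extremal r a b n s = truncated_extremal r a b n (real (Suc n))"
proof -
  have "integral {real (Suc n)..s} (truncated_deriv r a b n) = 0"
    by (rule integral_unique, rule has_integral_is_0)
      (simp add: truncated_deriv_def cutoff_eq_0(2) del: of_nat_Suc)
  moreover have "integral {0..real (Suc n)} (truncated_deriv r a b n) +
      integral {real (Suc n)..s} (truncated_deriv r a b n) = integral {0..s} (truncated_deriv r a b n)"
    by (rule Henstock_Kurzweil_Integration.integral_combine[OF of_nat_0_le_iff assms
          integrable_truncated_deriv[OF order_refl]])
  ultimately show ?thesis
    unfolding truncated_extremal_def by linarith
qed

lemma truncated_extremal_tendsto:
  assumes s: "0 < s"
  shows "(\<lambda>n. truncated_extremal r a b n s) \<longlonglongrightarrow> Bliss_extremal r a b s"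
proof -
  let ?e = "Bliss_extremal_deriv r a b"
  \<comment> \<open>The truncated derivatives vanish at 0, whereas the derivative of the extremal does not.\<close>
  define e\<^sub>0 where "e\<^sub>0 = (\<lambda>x. if x = 0 then 0 else ?e x)"
  have e: "(?e has_integral Bliss_extremal r a b s - Bliss_extremal r a b 0) {0..s}"
  proof (rule fundamental_theorem_of_calculus_interior)
    show "continuous_on {0..s} (Bliss_extremal r a b)"
      by (rule continuous_on_subset[OF continuous_on_Bliss_extremal(1)[OF r ab]]) auto
    show "(Bliss_extremal r a b has_vector_derivative ?e x) (at x)" if "x \<in> {0<..<s}" for x
      using DERIV_Bliss_extremal[OF r ab, of x] that
      by (simp add: has_real_derivative_iff_has_vector_derivative)
  qed (use s in simp)
  have e0: "(e\<^sub>0 has_integral Bliss_extremal r a b s) {0..s}"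
    by (rule has_integral_spike_finite[OF _ _ e[unfolded Bliss_extremal_def[of _ _ _ 0], simplified], of "{0}"])
      (auto simp: e\<^sub>0_def)
  have "(\<lambda>n. integral {0..s} (truncated_deriv r a b n)) \<longlonglongrightarrow> integral {0..s} e\<^sub>0"
  proof (rule dominated_convergence(2))
    show "truncated_deriv r a b n integrable_on {0..s}" for n
      by (rule integrable_truncated_deriv) simp
    show "?e integrable_on {0..s}" using e by blast
    show "norm (truncated_deriv r a b n x) \<le> ?e x" for n x
      using cutoff_bounds[of n x] Bliss_extremal_deriv_bounds[OF ab, of r x]
        mult_left_le_one_le[of "?e x" "cutoff n x"]
      by (simp add: truncated_deriv_def abs_mult)
    show "(\<lambda>n. truncated_deriv r a b n x) \<longlonglongrightarrow> e\<^sub>0 x" if x: "x \<in> {0..s}" for x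
    proof (cases "x = 0")
      case True
      then show ?thesis by (simp add: truncated_deriv_def e\<^sub>0_def cutoff_eq_0)
    next
      case False
      then have "(\<lambda>n. cutoff n x * ?e x) \<longlonglongrightarrow> 1 * ?e x"
        using x by (intro tendsto_mult tendsto_const cutoff_tendsto_1) auto
      then show ?thesis using False by (simp add: truncated_deriv_def e\<^sub>0_def)
    qed
  qed
  then show ?thesis unfolding truncated_extremal_def integral_unique[OF e0] .
qed

end

section \<open>The extremals attain the infimum\<close>

context radial_weights
begin

definition Bliss_exponent :: real where "Bliss_exponent = (q - p) / p"

lemma Bliss_exponent_pos: "0 < Bliss_exponent"
  using p pq by (simp add: Bliss_exponent_def)

text \<open>The exponent of $(|x|/R)^{-\gamma} - 1$ in $U$ is $-\kappa r$, so that the bracket is $a + b s^{-r}$.\<close>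

lemma U_fun_eq_Bliss_extremal:
  fixes x :: "'a::euclidean_space"
  assumes ab: "0 < a" "0 < b" and x: "x \<noteq> 0" "norm x < R"
  shows "U_fun p q \<beta> \<gamma> R a b x = Bliss_extremal Bliss_exponent a b (coord (norm x))"
proof -
  define y where "y = (norm x / R) powr (- \<gamma>) - 1"
  have y: "0 < y" using coord_base[of "norm x"] x by (simp add: y_def)
  define s where "s = coord (norm x)"
  have s: "s = y powr \<kappa>" "0 < s" using y by (simp_all add: s_def coord_def y_def)
  have "- ((q - p) * (\<beta> - 1) / (p * (p - 1))) = \<kappa> * (- Bliss_exponent)"
    by (simp add: \<kappa>_def Bliss_exponent_def mult.commute)
  then have 1: "y powr (- ((q - p) * (\<beta> - 1) / (p * (p - 1)))) = s powr (- Bliss_exponent)"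
    by (simp only: s(1) powr_powr)
  have 2: "- (p / (q - p)) = - 1 / Bliss_exponent" by (simp add: Bliss_exponent_def)
  have M: "0 < a * s powr Bliss_exponent + b" by (rule Bliss_base_pos[OF ab])
  have "a + b * s powr (- Bliss_exponent) = (a * s powr Bliss_exponent + b) * s powr (- Bliss_exponent)"
    using s(2) by (simp add: powr_minus distrib_right)
  then have "U_fun p q \<beta> \<gamma> R a b x = ((a * s powr Bliss_exponent + b) * s powr (- Bliss_exponent)) powr (- 1 / Bliss_exponent)"
    unfolding U_fun_def y_def[symmetric] 1 2 by (simp only:)
  also have "\<dots> = (a * s powr Bliss_exponent + b) powr (- 1 / Bliss_exponent) * (s powr (- Bliss_exponent)) powr (- 1 / Bliss_exponent)"
    by (rule powr_mult)
  also have "(s powr (- Bliss_exponent)) powr (- 1 / Bliss_exponent) = s"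
    unfolding powr_powr using Bliss_exponent_pos s(2) by simp
  finally show ?thesis by (simp only: Bliss_extremal_def s_def mult.commute)
qed

text \<open>The gradient of $U$, by the chain rule.\<close>

definition extremal_grad :: "real \<Rightarrow> real \<Rightarrow> 'a::euclidean_space \<Rightarrow> 'a" where
  "extremal_grad a b x = (- Bliss_extremal_deriv Bliss_exponent a b (coord (norm x)) / radius_speed (coord (norm x))) *\<^sub>R sgn x"

lemma energy_radial_field:
  fixes g :: "'a::euclidean_space \<Rightarrow> 'a"
  assumes n: "N = real DIM('a)" and w: "w \<in> borel_measurable borel" "\<And>s. 0 < s \<Longrightarrow> 0 \<le> w s"
    and g: "\<And>x. x \<noteq> 0 \<Longrightarrow> norm x < R \<Longrightarrow> norm (g x) = w (coord (norm x)) / radius_speed (coord (norm x))"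
  shows "energy p \<alpha> \<beta> \<gamma> R g = ennreal energy_factor * (\<integral>\<^sup>+ s. ennreal (w s powr p) * indicator {0<..} s \<partial>lborel)"
proof -
  have "energy p \<alpha> \<beta> \<gamma> R g = (\<integral>\<^sup>+ x. ennreal ((w (coord (norm x)) / radius_speed (coord (norm x))) powr p /
        (norm x powr (\<alpha> - p) * (1 - (norm x / R) powr \<gamma>) powr (\<beta> - p)))
      \<partial>lebesgue_on (ball (0::'a) R))"
    unfolding energy_def using AE_punctured_ball by (intro nn_integral_cong_AE) (auto simp: g)
  also note radial_energy[OF n w]
  finally show ?thesis .
qed

text \<open>The gradients of the lifted truncations are that of $U$ times the cutoff function. The difference
  thus has the factor $1 - \chi_n(s)$, which is at most 1 and tends to 0, while the energy of $U$ is
  finite.\<close>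

lemma extremal_X_rad:
  assumes n: "N = real DIM('a::euclidean_space)" and ab: "0 < a" "0 < b"
  shows "X_rad_grad p \<alpha> \<beta> \<gamma> R (U_fun p q \<beta> \<gamma> R a b :: 'a \<Rightarrow> real) (extremal_grad a b)"
proof -
  let ?e = "Bliss_extremal_deriv Bliss_exponent a b"
  let ?v = "truncated_extremal Bliss_exponent a b"
  let ?h = "truncated_deriv Bliss_exponent a b"
  note rab = Bliss_exponent_pos ab
  define \<phi> where "\<phi> = (\<lambda>k. radial_lift (?v k) (?v k (real (Suc k))) :: 'a \<Rightarrow> real)"
  have \<phi>: "\<phi> k \<in> test_rad R" for k
    unfolding \<phi>_def
  proof (rule radial_lift_test_rad)
    show "Ck_on j {0<..} (?v k)" for j by (rule Ck_on_truncated_extremal[OF rab])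
    show "0 < 1 / real (Suc k)" "0 < real (Suc k)" by simp_all
    show "?v k s = 0" if "s \<le> 1 / real (Suc k)" for s by (rule truncated_extremal_small[OF rab that])
    show "?v k s = ?v k (real (Suc k))" if "real (Suc k) < s" for s
      by (rule truncated_extremal_large[OF rab less_imp_le[OF that]])
  qed
  have meas[measurable]: "?h k \<in> borel_measurable borel" for k
    unfolding truncated_deriv_def[abs_def] by measurable
  have diff: "norm (grad (\<phi> k) x - extremal_grad a b x) = \<bar>?h k (coord (norm x)) - ?e (coord (norm x))\<bar> / radius_speed (coord (norm x))"
    if x: "x \<noteq> 0" "norm x < R" for k and x :: 'a
  proof -
    have c: "0 < coord (norm x)" using x by (intro coord_pos) auto
    have "grad (\<phi> k) x - extremal_grad a b x =
        (- ?h k (coord (norm x)) / radius_speed (coord (norm x)) - - ?e (coord (norm x)) / radius_speed (coord (norm x))) *\<^sub>R sgn x"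
      unfolding \<phi>_def grad_radial_lift[OF x DERIV_truncated_extremal[OF rab c]] extremal_grad_def
      by (simp only: scaleR_left_diff_distrib)
    also have "- ?h k (coord (norm x)) / radius_speed (coord (norm x)) - - ?e (coord (norm x)) / radius_speed (coord (norm x)) =
        - ((?h k (coord (norm x)) - ?e (coord (norm x))) / radius_speed (coord (norm x)))"
      by (simp add: diff_divide_distrib)
    finally show ?thesis using x radius_speed_pos[OF c] by (simp add: norm_sgn)
  qed
  have en: "energy p \<alpha> \<beta> \<gamma> R (\<lambda>x. grad (\<phi> k) x - extremal_grad a b x) =
      ennreal energy_factor * (\<integral>\<^sup>+ s. ennreal (\<bar>?h k s - ?e s\<bar> powr p) * indicator {0<..} s \<partial>lborel)" for k
    by (rule energy_radial_field[OF n _ _ diff]) auto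
  obtain I where I: "(\<integral>\<^sup>+ s. ennreal (?e s powr p) * indicator {0<..} s \<partial>lborel) = ennreal I"
    by (rule Bliss_extremal_integrals[OF p pq ab, folded Bliss_exponent_def])
  have "(\<lambda>k. \<integral>\<^sup>+ s. ennreal (\<bar>?h k s - ?e s\<bar> powr p) * indicator {0<..} s \<partial>lborel) \<longlonglongrightarrow> (\<integral>\<^sup>+ s. 0 \<partial>(lborel :: real measure))"
  proof (rule nn_integral_dominated_convergence)
    show "(\<integral>\<^sup>+ s. ennreal (?e s powr p) * indicator {0<..} s \<partial>lborel) < \<infinity>" by (simp add: I)
    show "AE s in lborel. ennreal (\<bar>?h k s - ?e s\<bar> powr p) * indicator {0<..} s \<le> ennreal (?e s powr p) * indicator {0<..} s" for k
    proof (rule AE_I2)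
      fix s :: real
      have e: "0 \<le> ?e s" by (rule Bliss_extremal_deriv_bounds[OF ab])
      have "\<bar>?h k s - ?e s\<bar> = (1 - cutoff k s) * ?e s"
        using mult_left_le_one_le[OF e cutoff_bounds[of k s]] by (simp add: truncated_deriv_def algebra_simps)
      also have "\<dots> \<le> ?e s"
        using cutoff_bounds[of k s] by (intro mult_left_le_one_le e) auto
      finally have "\<bar>?h k s - ?e s\<bar> powr p \<le> ?e s powr p"
        using p by (intro powr_mono2) auto
      then show "ennreal (\<bar>?h k s - ?e s\<bar> powr p) * indicator {0<..} s \<le> ennreal (?e s powr p) * indicator {0<..} s"
        by (intro mult_right_mono ennreal_leI) auto
    qed
    show "AE s in lborel. (\<lambda>k. ennreal (\<bar>?h k s - ?e s\<bar> powr p) * indicator {0<..} s) \<longlonglongrightarrow> 0"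
    proof (rule AE_I2)
      fix s :: real
      show "(\<lambda>k. ennreal (\<bar>?h k s - ?e s\<bar> powr p) * indicator {0<..} s) \<longlonglongrightarrow> 0"
      proof (cases "0 < s")
        case True
        have "(\<lambda>k. \<bar>cutoff k s * ?e s - ?e s\<bar> powr p) \<longlonglongrightarrow> \<bar>1 * ?e s - ?e s\<bar> powr p"
          using p True by (intro tendsto_powr2 tendsto_rabs tendsto_diff tendsto_mult tendsto_const cutoff_tendsto_1) auto
        then have "(\<lambda>k. \<bar>?h k s - ?e s\<bar> powr p) \<longlonglongrightarrow> 0" by (simp add: truncated_deriv_def)
        then have "(\<lambda>k. ennreal (\<bar>?h k s - ?e s\<bar> powr p)) \<longlonglongrightarrow> ennreal 0" by (rule tendsto_ennrealI)
        then show ?thesis using True by simp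
      qed simp
    qed
  qed measurable
  then have "(\<lambda>k. ennreal energy_factor * (\<integral>\<^sup>+ s. ennreal (\<bar>?h k s - ?e s\<bar> powr p) * indicator {0<..} s \<partial>lborel)) \<longlonglongrightarrow> ennreal energy_factor * 0"
    by (intro ennreal_tendsto_cmult) auto
  then have lim: "(\<lambda>k. energy p \<alpha> \<beta> \<gamma> R (\<lambda>x. grad (\<phi> k) x - extremal_grad a b x)) \<longlonglongrightarrow> 0"
    unfolding en by simp
  have "AE x in lebesgue_on (ball 0 R). (\<lambda>k. \<phi> k x) \<longlonglongrightarrow> U_fun p q \<beta> \<gamma> R a b x"
    using AE_punctured_ball
  proof eventually_elim
    case (elim x)
    then have c: "0 < coord (norm x)" by (intro coord_pos) auto
    have "U_fun p q \<beta> \<gamma> R a b x = Bliss_extremal Bliss_exponent a b (coord (norm x))"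
      using elim by (intro U_fun_eq_Bliss_extremal ab) auto
    then show ?case
      using truncated_extremal_tendsto[OF rab c] elim by (simp add: \<phi>_def radial_lift_def)
  qed
  moreover have "extremal_grad a b \<in> borel_measurable (lebesgue_on (ball (0::'a) R))"
    unfolding extremal_grad_def[abs_def]
    by (intro measurable_restrict_space1 measurable_completion) measurable
  ultimately show ?thesis
    unfolding X_rad_grad_def using \<phi> lim by blast
qed

lemma extremal_values:
  assumes n: "N = real DIM('a::euclidean_space)" and ab: "0 < a" "0 < b"
  obtains I where "0 < I"
    "constraint p q \<alpha> \<beta> \<gamma> R (U_fun p q \<beta> \<gamma> R a b :: 'a \<Rightarrow> real) = ennreal (constraint_factor * I)"
    "energy p \<alpha> \<beta> \<gamma> R (extremal_grad a b :: 'a \<Rightarrow> 'a) = ennreal (energy_factor * (Bliss_const p q * I powr (p / q)))"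
proof -
  let ?E = "Bliss_extremal Bliss_exponent a b" and ?e = "Bliss_extremal_deriv Bliss_exponent a b"
  obtain I where I: "0 < I"
    "(\<integral>\<^sup>+ s. ennreal (?E s powr q * s powr (- 1 - q * (p - 1) / p)) * indicator {0<..} s \<partial>lborel) = ennreal I"
    "(\<integral>\<^sup>+ s. ennreal (?e s powr p) * indicator {0<..} s \<partial>lborel) = ennreal (Bliss_const p q * I powr (p / q))"
    by (rule Bliss_extremal_integrals[OF p pq ab, folded Bliss_exponent_def])
  have "constraint p q \<alpha> \<beta> \<gamma> R (U_fun p q \<beta> \<gamma> R a b :: 'a \<Rightarrow> real) = ennreal constraint_factor *
      (\<integral>\<^sup>+ s. ennreal (\<bar>?E s\<bar> powr q * s powr (- 1 - q * (p - 1) / p)) * indicator {0<..} s \<partial>lborel)"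
    by (rule radial_constraint[OF n]) (simp_all add: U_fun_eq_Bliss_extremal ab)
  also have "(\<integral>\<^sup>+ s. ennreal (\<bar>?E s\<bar> powr q * s powr (- 1 - q * (p - 1) / p)) * indicator {0<..} s \<partial>lborel) = ennreal I"
    unfolding I(2)[symmetric]
    by (intro nn_integral_cong) (auto simp: indicator_def Bliss_extremal_def abs_mult)
  finally have 1: "constraint p q \<alpha> \<beta> \<gamma> R (U_fun p q \<beta> \<gamma> R a b :: 'a \<Rightarrow> real) = ennreal (constraint_factor * I)"
    using I(1) by (simp add: ennreal_mult'')
  have "energy p \<alpha> \<beta> \<gamma> R (extremal_grad a b :: 'a \<Rightarrow> 'a) =
      ennreal energy_factor * (\<integral>\<^sup>+ s. ennreal (?e s powr p) * indicator {0<..} s \<partial>lborel)"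
  proof (rule energy_radial_field[OF n])
    fix x :: 'a assume x: "x \<noteq> 0" "norm x < R"
    then have "0 < radius_speed (coord (norm x))" by (intro radius_speed_pos coord_pos) auto
    then show "norm (extremal_grad a b x) = ?e (coord (norm x)) / radius_speed (coord (norm x))"
      using x Bliss_extremal_deriv_bounds[OF ab, of Bliss_exponent "coord (norm x)"] by (simp add: extremal_grad_def norm_sgn)
  qed (simp_all add: Bliss_extremal_deriv_bounds ab)
  then have 2: "energy p \<alpha> \<beta> \<gamma> R (extremal_grad a b :: 'a \<Rightarrow> 'a) = ennreal (energy_factor * (Bliss_const p q * I powr (p / q)))"
    unfolding I(3) using Bliss_const_pos by (simp add: ennreal_mult'')
  show thesis by (rule that[OF I(1) 1 2])
qed

lemma normalised_extremal_energy:
  assumes n: "N = real DIM('a::euclidean_space)" and ab: "0 < a" "0 < b"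
    and norm: "constraint p q \<alpha> \<beta> \<gamma> R (U_fun p q \<beta> \<gamma> R a b :: 'a \<Rightarrow> real) = 1"
  shows "energy p \<alpha> \<beta> \<gamma> R (extremal_grad a b :: 'a \<Rightarrow> 'a) = ennreal sharp_constant"
proof -
  obtain I where I: "0 < I"
    "constraint p q \<alpha> \<beta> \<gamma> R (U_fun p q \<beta> \<gamma> R a b :: 'a \<Rightarrow> real) = ennreal (constraint_factor * I)"
    "energy p \<alpha> \<beta> \<gamma> R (extremal_grad a b :: 'a \<Rightarrow> 'a) = ennreal (energy_factor * (Bliss_const p q * I powr (p / q)))"
    by (rule extremal_values[OF n ab])
  have "constraint_factor * I = 1" using I(2) norm by (simp add: ennreal_eq_1)
  then have "I = 1 / constraint_factor" using factors_pos by (simp add: field_simps)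
  then have "I powr (p / q) = constraint_factor powr (- (p / q))"
    using factors_pos by (simp add: powr_divide powr_minus_divide)
  then show ?thesis unfolding I(3) by (simp add: sharp_constant_def mult_ac)
qed

lemma scaled_U_fun:
  assumes ab: "0 < a" "0 < b" and c: "0 < c"
  shows "c * U_fun p q \<beta> \<gamma> R a b x = U_fun p q \<beta> \<gamma> R (c powr (- Bliss_exponent) * a) (c powr (- Bliss_exponent) * b) x"
proof -
  have 2: "- (p / (q - p)) = - 1 / Bliss_exponent" by (simp add: Bliss_exponent_def)
  define z where "z = ((norm x / R) powr (- \<gamma>) - 1) powr (- ((q - p) * (\<beta> - 1) / (p * (p - 1))))"
  have "(c powr (- Bliss_exponent) * (a + b * z)) powr (- 1 / Bliss_exponent) = (c powr (- Bliss_exponent)) powr (- 1 / Bliss_exponent) * (a + b * z) powr (- 1 / Bliss_exponent)"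
    by (rule powr_mult)
  also have "(c powr (- Bliss_exponent)) powr (- 1 / Bliss_exponent) = c"
    unfolding powr_powr using Bliss_exponent_pos c by simp
  finally show ?thesis unfolding U_fun_def z_def[symmetric] 2 by (simp add: algebra_simps)
qed

text \<open>The constraint integral of $U$ is finite and positive and is homogeneous of degree $q$.\<close>

lemma exists_normalisation:
  assumes n: "N = real DIM('a::euclidean_space)" and ab: "0 < a" "0 < b"
  obtains c where "0 < c" "constraint p q \<alpha> \<beta> \<gamma> R (\<lambda>x::'a. c * U_fun p q \<beta> \<gamma> R a b x) = 1"
proof -
  obtain I where I: "0 < I"
    "constraint p q \<alpha> \<beta> \<gamma> R (U_fun p q \<beta> \<gamma> R a b :: 'a \<Rightarrow> real) = ennreal (constraint_factor * I)"
    by (rule extremal_values[OF n ab])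
  define K where "K = constraint_factor * I"
  have K: "0 < K" using I factors_pos by (simp add: K_def)
  define c where "c = K powr (- 1 / q)"
  have c: "0 < c" using K by (simp add: c_def)
  have "- 1 / q * q = - 1" using p pq by simp
  then have cq: "c powr q = 1 / K"
    unfolding c_def powr_powr using K by (simp add: powr_minus_divide)
  define h where "h = Bliss_extremal Bliss_exponent a b"
  have [measurable]: "h \<in> borel_measurable borel" by (simp add: h_def)
  let ?f = "\<lambda>s. ennreal (\<bar>h s\<bar> powr q * s powr (- 1 - q * (p - 1) / p)) * indicator {0<..} s"
  have "constraint p q \<alpha> \<beta> \<gamma> R (U_fun p q \<beta> \<gamma> R a b :: 'a \<Rightarrow> real) = ennreal constraint_factor * (\<integral>\<^sup>+ s. ?f s \<partial>lborel)"
    by (rule radial_constraint[OF n]) (simp_all add: U_fun_eq_Bliss_extremal ab h_def)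
  then have base: "ennreal constraint_factor * (\<integral>\<^sup>+ s. ?f s \<partial>lborel) = ennreal K"
    using I(2) by (simp add: K_def)
  have "constraint p q \<alpha> \<beta> \<gamma> R (\<lambda>x::'a. c * U_fun p q \<beta> \<gamma> R a b x) = ennreal constraint_factor *
      (\<integral>\<^sup>+ s. ennreal (\<bar>c * h s\<bar> powr q * s powr (- 1 - q * (p - 1) / p)) * indicator {0<..} s \<partial>lborel)"
    by (rule radial_constraint[OF n]) (simp_all add: U_fun_eq_Bliss_extremal ab h_def)
  also have "\<dots> = ennreal constraint_factor * (\<integral>\<^sup>+ s. ennreal (c powr q) * ?f s \<partial>lborel)"
  proof -
    have "\<bar>c * h s\<bar> powr q * w = c powr q * (\<bar>h s\<bar> powr q * w)" for s w
      using c by (simp add: abs_mult powr_mult)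
    then show ?thesis by (simp only: ennreal_mult'[OF powr_ge_zero] mult.assoc)
  qed
  also have "\<dots> = ennreal constraint_factor * (ennreal (c powr q) * (\<integral>\<^sup>+ s. ?f s \<partial>lborel))"
    by (subst nn_integral_cmult) auto
  also have "\<dots> = ennreal (c powr q) * ennreal K"
    unfolding base[symmetric] by (simp only: mult.left_commute)
  also have "\<dots> = 1" using K unfolding cq by (simp add: ennreal_mult'[symmetric])
  finally show thesis by (rule that[OF c])
qed

lemma T_rad_eq_sharp_constant:
  assumes n: "N = real DIM('a::euclidean_space)"
  shows "T_rad TYPE('a) p q \<alpha> \<beta> \<gamma> R = ennreal sharp_constant"
proof (rule antisym)
  show "ennreal sharp_constant \<le> T_rad TYPE('a) p q \<alpha> \<beta> \<gamma> R"
    unfolding T_rad_def by (rule Inf_greatest) (auto intro: X_rad_energy_ge[OF n])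
  obtain c where c: "0 < c" "constraint p q \<alpha> \<beta> \<gamma> R (\<lambda>x::'a. c * U_fun p q \<beta> \<gamma> R 1 1 x) = 1"
    by (rule exists_normalisation[OF n zero_less_one zero_less_one])
  define a where "a = c powr (- Bliss_exponent)"
  have a: "0 < a" using c by (simp add: a_def)
  have u: "constraint p q \<alpha> \<beta> \<gamma> R (U_fun p q \<beta> \<gamma> R a a :: 'a \<Rightarrow> real) = 1"
    using c(2) scaled_U_fun[OF zero_less_one zero_less_one c(1), where 'a = 'a] by (simp add: a_def)
  show "T_rad TYPE('a) p q \<alpha> \<beta> \<gamma> R \<le> ennreal sharp_constant"
    unfolding T_rad_def
    by (rule Inf_lower2[OF _ eq_refl[OF normalised_extremal_energy[OF n a a u]]])
      (use extremal_X_rad[OF n a a] u in blast)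
qed

lemma attains_normalised:
  assumes n: "N = real DIM('a::euclidean_space)" and ab: "0 < a" "0 < b"
    and u: "constraint p q \<alpha> \<beta> \<gamma> R (U_fun p q \<beta> \<gamma> R a b :: 'a \<Rightarrow> real) = 1"
  shows "attains_T_rad p q \<alpha> \<beta> \<gamma> R (U_fun p q \<beta> \<gamma> R a b :: 'a \<Rightarrow> real)"
  unfolding attains_T_rad_def T_rad_eq_sharp_constant[OF n]
  using extremal_X_rad[OF n ab] u normalised_extremal_energy[OF n ab u] by blast

text \<open>A positive multiple of a function $U$ is again of this form, which gives both the attainment by
  some $U$ itself and the attainment by a multiple of each $U$.\<close>

lemma attains_scaled:
  assumes n: "N = real DIM('a::euclidean_space)" and ab: "0 < a" "0 < b"
  shows "\<exists>c>0. \<exists>a'>0. \<exists>b'>0.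
    (\<lambda>x::'a. c * U_fun p q \<beta> \<gamma> R a b x) = U_fun p q \<beta> \<gamma> R a' b' \<and>
    attains_T_rad p q \<alpha> \<beta> \<gamma> R (U_fun p q \<beta> \<gamma> R a' b' :: 'a \<Rightarrow> real)"
proof -
  obtain c where c: "0 < c" "constraint p q \<alpha> \<beta> \<gamma> R (\<lambda>x::'a. c * U_fun p q \<beta> \<gamma> R a b x) = 1"
    by (rule exists_normalisation[OF n ab])
  define a' where "a' = c powr (- Bliss_exponent) * a"
  define b' where "b' = c powr (- Bliss_exponent) * b"
  have ab': "0 < a'" "0 < b'" using ab c(1) by (simp_all add: a'_def b'_def)
  have eq: "(\<lambda>x::'a. c * U_fun p q \<beta> \<gamma> R a b x) = U_fun p q \<beta> \<gamma> R a' b'"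
    unfolding a'_def b'_def by (rule ext) (rule scaled_U_fun[OF ab c(1)])
  have "attains_T_rad p q \<alpha> \<beta> \<gamma> R (U_fun p q \<beta> \<gamma> R a' b' :: 'a \<Rightarrow> real)"
    by (rule attains_normalised[OF n ab']) (use c(2) eq in simp)
  then show ?thesis using c(1) ab' eq by blast
qed

text \<open>The power of $R$ in the energy is cancelled by that in the constraint. The
  volume of the unit ball contributes the power of $\pi$ and $\Gamma(N/2)$; the Beta function in the
  constant of Bliss contributes the other values of $\Gamma$. In logarithms the identity is
  linear.\<close>

lemma sharp_constant_eq:
  "sharp_constant = pi powr (N * (q - p) / (2 * q)) * N *
        (N * p / (q * (p - 1))) powr (p - 1) *
        (q * (N - \<alpha>) / (N * p)) powr (p - 1 + p / q) *
        (2 * q * (p - 1) / (N * (q - p))) powr ((q - p) / q) *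
        (Gamma (q / (q - p)) * Gamma (q * (p - 1) / (q - p)) /
          (Gamma (N / 2) * Gamma (q * p / (q - p)))) powr ((q - p) / q)"
    (is "_ = ?rhs")
proof -
  define x where "x = q * (p - 1) / (q - p)"
  define y where "y = q / (q - p)"
  define z where "z = q * p / (q - p)"
  define t where "t = p / q"
  define L where "L = ln R"
  define D where "D = N - \<alpha>"
  have D: "0 < D" using \<alpha> by (simp add: D_def)
  have xyz: "x + y = z" by (simp add: x_def y_def z_def add_divide_distrib[symmetric] algebra_simps)
  have pos: "0 < x" "0 < y" "0 < z" using p pq by (simp_all add: x_def y_def z_def)
  have G: "0 < Gamma x" "0 < Gamma y" "0 < Gamma z" "0 < Gamma (N / 2)"
    using pos N by (simp_all add: Gamma_real_pos)
  have t: "(q - p) / q = 1 - t" "N * (q - p) / (2 * q) = (1 - t) * (N / 2)" "q / p * D * t = D"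
  proof -
    show 1: "(q - p) / q = 1 - t" using p pq by (simp add: t_def diff_divide_distrib)
    show "N * (q - p) / (2 * q) = (1 - t) * (N / 2)" unfolding 1[symmetric] by (simp add: mult.commute)
    show "q / p * D * t = D" using p pq by (simp add: t_def)
  qed
  have G1: "Gamma (N / 2 + 1) = N / 2 * Gamma (N / 2)"
    using Gamma_plus1[of "N / 2"] N nonpos_Ints_nonpos[of "N / 2"] by force
  have w: "N * unit_ball_vol N = exp (ln 2 + N / 2 * ln pi - ln (Gamma (N / 2)))"
    unfolding unit_ball_vol_def G1 using N G(4) by (simp add: exp_add exp_diff powr_def)
  define W where "W = ln 2 + N / 2 * ln pi - ln (Gamma (N / 2))"
  define K where "K = ln D - ln (p - 1)"
  have K: "ln (D / (p - 1)) = K" "ln ((p - 1) / D) = - K" using D p by (simp_all add: K_def ln_div)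
  have en: "energy_factor = exp (W + D * L + (p - 1) * K)"
    unfolding energy_factor_def w W_def[symmetric] D_def[symmetric] using R D p
    by (simp add: powr_def exp_add K L_def)
  have con: "constraint_factor = exp (W + q / p * D * L - K)"
  proof -
    have "(p - 1) / D = exp (- K)" using D p K(2) by (metis exp_ln divide_pos_pos diff_gt_0_iff_gt)
    then show ?thesis
      unfolding constraint_factor_def w W_def[symmetric] D_def[symmetric] using R
      by (simp add: powr_def exp_add exp_diff exp_minus divide_inverse L_def)
  qed
  have con_t: "constraint_factor powr (- t) = exp (- t * (W + q / p * D * L - K))"
    unfolding con by (simp add: powr_def)
  have B: "Bliss_const p q = exp (ln (p - 1) + t * (ln q - ln p) +
      (1 - t) * (ln q - ln (q - p) + (ln (Gamma x) + ln (Gamma y) - ln (Gamma z))))"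
  proof -
    have "Beta x y = Gamma x * Gamma y / Gamma z" by (simp add: Beta_def xyz)
    then have "ln (q / (q - p) * Beta x y) = ln q - ln (q - p) + (ln (Gamma x) + ln (Gamma y) - ln (Gamma z))"
      "0 < q / (q - p) * Beta x y"
      using G p pq by (simp_all add: ln_mult ln_div)
    then have "(q / (q - p) * Beta x y) powr (1 - t) =
        exp ((1 - t) * (ln q - ln (q - p) + (ln (Gamma x) + ln (Gamma y) - ln (Gamma z))))"
      by (simp only: powr_def less_imp_neq[THEN not_sym] if_False)
    moreover have "(q / p) powr t = exp (t * (ln q - ln p))"
      using p pq by (simp add: powr_def ln_div)
    ultimately show ?thesis
      unfolding Bliss_const_def x_def[symmetric] y_def[symmetric] t(1) t_def[symmetric]
      using p by (simp add: exp_add)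
  qed
  have f1: "pi powr ((1 - t) * (N / 2)) = exp ((1 - t) * (N / 2) * ln pi)" by (simp add: powr_def)
  have f2: "N = exp (ln N)" using N by simp
  have f3: "(N * p / (q * (p - 1))) powr (p - 1) = exp ((p - 1) * (ln N + ln p - (ln q + ln (p - 1))))"
    using N p pq by (simp add: powr_def ln_div ln_mult)
  have f4: "(q * D / (N * p)) powr (p - 1 + t) = exp ((p - 1 + t) * (ln q + ln D - (ln N + ln p)))"
    using N p pq D by (simp add: powr_def ln_div ln_mult)
  have f5: "(2 * q * (p - 1) / (N * (q - p))) powr (1 - t) =
      exp ((1 - t) * (ln 2 + ln q + ln (p - 1) - (ln N + ln (q - p))))"
    using N p pq by (simp add: powr_def ln_div ln_mult)
  have f6: "(Gamma y * Gamma x / (Gamma (N / 2) * Gamma z)) powr (1 - t) =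
      exp ((1 - t) * (ln (Gamma y) + ln (Gamma x) - (ln (Gamma (N / 2)) + ln (Gamma z))))"
    using G by (simp add: powr_def ln_div ln_mult)
  have "?rhs = pi powr ((1 - t) * (N / 2)) * N * (N * p / (q * (p - 1))) powr (p - 1) *
      (q * D / (N * p)) powr (p - 1 + t) * (2 * q * (p - 1) / (N * (q - p))) powr (1 - t) *
      (Gamma y * Gamma x / (Gamma (N / 2) * Gamma z)) powr (1 - t)"
    unfolding t(1,2) by (simp only: x_def y_def z_def t_def D_def)
  also have "\<dots> = exp ((1 - t) * (N / 2) * ln pi + ln N + (p - 1) * (ln N + ln p - (ln q + ln (p - 1))) +
      (p - 1 + t) * (ln q + ln D - (ln N + ln p)) +
      (1 - t) * (ln 2 + ln q + ln (p - 1) - (ln N + ln (q - p))) +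
      (1 - t) * (ln (Gamma y) + ln (Gamma x) - (ln (Gamma (N / 2)) + ln (Gamma z))))"
    unfolding exp_add f1 f3 f4 f5 f6 using N by simp
  also have "\<dots> = exp ((W + D * L + (p - 1) * K) + (- t * (W + q / p * D * L - K)) +
      (ln (p - 1) + t * (ln q - ln p) +
      (1 - t) * (ln q - ln (q - p) + (ln (Gamma x) + ln (Gamma y) - ln (Gamma z)))))"
  proof (rule arg_cong[where f = exp])
    have "t * (q / p * D * L) = D * L" using t(3) by (metis mult.assoc mult.commute)
    moreover have "- t * (W + q / p * D * L - K) = - t * W - t * (q / p * D * L) + t * K"
      by (simp only: ring_distribs)
    ultimately have e: "- t * (W + q / p * D * L - K) = - t * W - D * L + t * K" by simp
    show "(1 - t) * (N / 2) * ln pi + ln N + (p - 1) * (ln N + ln p - (ln q + ln (p - 1))) +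
      (p - 1 + t) * (ln q + ln D - (ln N + ln p)) +
      (1 - t) * (ln 2 + ln q + ln (p - 1) - (ln N + ln (q - p))) +
      (1 - t) * (ln (Gamma y) + ln (Gamma x) - (ln (Gamma (N / 2)) + ln (Gamma z))) =
      (W + D * L + (p - 1) * K) + (- t * (W + q / p * D * L - K)) +
      (ln (p - 1) + t * (ln q - ln p) +
      (1 - t) * (ln q - ln (q - p) + (ln (Gamma x) + ln (Gamma y) - ln (Gamma z))))"
      unfolding e unfolding W_def K_def
      by (simp add: algebra_simps add_divide_distrib diff_divide_distrib)
  qed
  also have "\<dots> = sharp_constant"
    unfolding sharp_constant_def t_def[symmetric] en con_t B exp_add by (simp only: mult.assoc)
  finally show ?thesis by simp
qed

end

theorem theorem5:
  fixes R p q \<alpha> \<beta> \<gamma> N :: real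
  assumes "R > 0" and "1 < p" and "p < q"
    and "CARD('n::finite) \<ge> 2" and "N = real CARD('n)"
    and "\<alpha> < N" and "\<beta> > 1" and "\<gamma> = (N - \<alpha>) / (\<beta> - 1)"
  shows "T_rad TYPE(real ^ 'n) p q \<alpha> \<beta> \<gamma> R =
      ennreal (pi powr (N * (q - p) / (2 * q)) * N *
        (N * p / (q * (p - 1))) powr (p - 1) *
        (q * (N - \<alpha>) / (N * p)) powr (p - 1 + p / q) *
        (2 * q * (p - 1) / (N * (q - p))) powr ((q - p) / q) *
        (Gamma (q / (q - p)) * Gamma (q * (p - 1) / (q - p)) /
          (Gamma (N / 2) * Gamma (q * p / (q - p)))) powr ((q - p) / q)) \<and>
    (\<exists>a>0. \<exists>b>0. attains_T_rad p q \<alpha> \<beta> \<gamma> R (U_fun p q \<beta> \<gamma> R a b :: real ^ 'n \<Rightarrow> real)) \<and>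
    (\<forall>a>0. \<forall>b>0. \<exists>c>0.
      attains_T_rad p q \<alpha> \<beta> \<gamma> R (\<lambda>x :: real ^ 'n. c * U_fun p q \<beta> \<gamma> R a b x))"
proof -
  interpret radial_weights p q \<alpha> \<beta> \<gamma> R N
    using assms by unfold_locales auto
  have n: "N = real DIM(real ^ 'n)" using assms(5) by simp
  have 1: "T_rad TYPE(real ^ 'n) p q \<alpha> \<beta> \<gamma> R = ennreal sharp_constant"
    by (rule T_rad_eq_sharp_constant[OF n])
  have 2: "\<exists>a>0. \<exists>b>0. attains_T_rad p q \<alpha> \<beta> \<gamma> R (U_fun p q \<beta> \<gamma> R a b :: real ^ 'n \<Rightarrow> real)"
    using attains_scaled[OF n zero_less_one zero_less_one] by blast
  have 3: "\<forall>a>0. \<forall>b>0. \<exists>c>0.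
      attains_T_rad p q \<alpha> \<beta> \<gamma> R (\<lambda>x :: real ^ 'n. c * U_fun p q \<beta> \<gamma> R a b x)"
    using attains_scaled[OF n] by metis
  show ?thesis
    unfolding sharp_constant_eq[symmetric] using 1 2 3 by blast
qed
end
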